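(* Let $\mathbf{SkeLC}$ be the category of all locally compact Hausdorff spaces and all continuous skeletal maps between them. Let $\mathbf{ESkeLC}$ be the category whose objects are all complete local contact algebras and whose morphisms $\psi:(A,\rho,\mathbb{B})\to(B,\eta,\mathbb{B}')$ are all functions $\psi:A\to B$ satisfying: (EF1) for every $a\in A$, $\psi(a)=0$ iff $a=0$; (EF2) $\psi$ preserves all joins; (EF3) if $a\in A$, $b\in B$ and $b\le\psi(a)$ then there exists $c\in A$ such that $c\le a$ and $\psi(c)=b$; (EL4) for all $a,b\in A$, $a\,\rho\,b$ implies $\psi(a)\,\eta\,\psi(b)$; (EL5) if $a\in\mathbb{B}$ then $\psi(a)\in\mathbb{B}'$. Then the categories $\mathbf{SkeLC}$ and $\mathbf{ESkeLC}$ are equivalent.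
   Context: A function $f:X\to Y$ between topological spaces is skeletal if $\mathrm{int}(f^{-1}(\mathrm{cl}(V)))\subseteq \mathrm{cl}(f^{-1}(V))$ for every open $V\subseteq Y$. Maps are not assumed to be onto. A contact algebra $(B,C)$ is a Boolean algebra $B=(B,0,1,\vee,\wedge,{}^* )$ ($0=1$ is allowed; $^*$ is complement) with a binary relation $C$ on $B$ such that: (C1) $a\neq 0$ implies $aCa$; (C2) $aCb$ implies $a\ne 0$ and $b\neq 0$; (C3) $aCb$ implies $bCa$; (C4) $aC(b\vee c)$ iff $aCb$ or $aCc$. Write $a\ll_C b$ iff not $aCb^*$. A local contact algebra $(B,\rho,\mathbb{B})$ consists of a contact algebra $(B,\rho)$ and an ideal $\mathbb{B}$ of $B$ (possibly non-proper) such that: (BC1) if $a\in\mathbb{B}$, $c\in B$ and $a\ll_\rho c$ then $a\ll_\rho b\ll_\rho c$ for some $b\in\mathbb{B}$; (BC2) if $a\rho b$ then there is $c\in\mathbb{B}$ with $a\rho(c\wedge b)$; (BC3) if $a\ne 0$ then there is $b\in\mathbb{B}\setminus\{0\}$ with $b\ll_\rho a$. It is complete if $B$ is a complete Boolean algebra. Composition of morphisms is composition of functions. *)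

theory Defs
  imports
    "HOL-Analysis.Analysis"
    "HOL-Algebra.Complete_Lattice"
    "HOL-Library.Equipollence"
begin

section \<open>Categories, functors and equivalence\<close>

text \<open>Hom-sets of different pairs of objects are allowed to overlap (one and the same HOL function
  may be a morphism between several pairs of objects). Identities, composition and the arrow part
  of a functor therefore take the objects concerned as arguments;
  \<open>Comp C X Y Z g f\<close> is the composite of \<open>f\<close> from \<open>X\<close> to \<open>Y\<close> with \<open>g\<close> from \<open>Y\<close> to \<open>Z\<close>.\<close>

record ('o, 'm) cat =
  Obj :: "'o set"
  Hom :: "'o \<Rightarrow> 'o \<Rightarrow> 'm set"
  Ident :: "'o \<Rightarrow> 'm"
  Comp :: "'o \<Rightarrow> 'o \<Rightarrow> 'o \<Rightarrow> 'm \<Rightarrow> 'm \<Rightarrow> 'm"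

definition category :: "('o, 'm) cat \<Rightarrow> bool" where
  "category C \<longleftrightarrow>
    (\<forall>X\<in>Obj C. Ident C X \<in> Hom C X X) \<and>
    (\<forall>X\<in>Obj C. \<forall>Y\<in>Obj C. \<forall>Z\<in>Obj C. \<forall>f\<in>Hom C X Y. \<forall>g\<in>Hom C Y Z.
        Comp C X Y Z g f \<in> Hom C X Z) \<and>
    (\<forall>X\<in>Obj C. \<forall>Y\<in>Obj C. \<forall>f\<in>Hom C X Y.
        Comp C X X Y f (Ident C X) = f \<and> Comp C X Y Y (Ident C Y) f = f) \<and>
    (\<forall>W\<in>Obj C. \<forall>X\<in>Obj C. \<forall>Y\<in>Obj C. \<forall>Z\<in>Obj C.
      \<forall>f\<in>Hom C W X. \<forall>g\<in>Hom C X Y. \<forall>h\<in>Hom C Y Z.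
        Comp C W X Z (Comp C X Y Z h g) f = Comp C W Y Z h (Comp C W X Y g f))"

definition is_functor ::
  "('o, 'm) cat \<Rightarrow> ('p, 'n) cat \<Rightarrow> ('o \<Rightarrow> 'p) \<Rightarrow> ('o \<Rightarrow> 'o \<Rightarrow> 'm \<Rightarrow> 'n) \<Rightarrow> bool" where
  "is_functor C D F0 F1 \<longleftrightarrow>
    (\<forall>X\<in>Obj C. F0 X \<in> Obj D) \<and>
    (\<forall>X\<in>Obj C. \<forall>Y\<in>Obj C. \<forall>f\<in>Hom C X Y. F1 X Y f \<in> Hom D (F0 X) (F0 Y)) \<and>
    (\<forall>X\<in>Obj C. F1 X X (Ident C X) = Ident D (F0 X)) \<and>
    (\<forall>X\<in>Obj C. \<forall>Y\<in>Obj C. \<forall>Z\<in>Obj C. \<forall>f\<in>Hom C X Y. \<forall>g\<in>Hom C Y Z.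
        F1 X Z (Comp C X Y Z g f) = Comp D (F0 X) (F0 Y) (F0 Z) (F1 Y Z g) (F1 X Y f))"

definition isomorphism :: "('o, 'm) cat \<Rightarrow> 'o \<Rightarrow> 'o \<Rightarrow> 'm \<Rightarrow> bool" where
  "isomorphism C X Y f \<longleftrightarrow>
    f \<in> Hom C X Y \<and>
    (\<exists>g\<in>Hom C Y X. Comp C X Y X g f = Ident C X \<and> Comp C Y X Y f g = Ident C Y)"

definition natural_isomorphism ::
  "('o, 'm) cat \<Rightarrow> ('p, 'n) cat \<Rightarrow> ('o \<Rightarrow> 'p) \<Rightarrow> ('o \<Rightarrow> 'o \<Rightarrow> 'm \<Rightarrow> 'n) \<Rightarrow>
   ('o \<Rightarrow> 'p) \<Rightarrow> ('o \<Rightarrow> 'o \<Rightarrow> 'm \<Rightarrow> 'n) \<Rightarrow> ('o \<Rightarrow> 'n) \<Rightarrow> bool" where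
  "natural_isomorphism C D F0 F1 G0 G1 \<tau> \<longleftrightarrow>
    (\<forall>X\<in>Obj C. isomorphism D (F0 X) (G0 X) (\<tau> X)) \<and>
    (\<forall>X\<in>Obj C. \<forall>Y\<in>Obj C. \<forall>f\<in>Hom C X Y.
        Comp D (F0 X) (F0 Y) (G0 Y) (\<tau> Y) (F1 X Y f) =
        Comp D (F0 X) (G0 X) (G0 Y) (G1 X Y f) (\<tau> X))"

definition equivalent_categories :: "('o, 'm) cat \<Rightarrow> ('p, 'n) cat \<Rightarrow> bool" where
  "equivalent_categories C D \<longleftrightarrow>
    category C \<and> category D \<and>
    (\<exists>F0 F1 G0 G1 \<sigma> \<tau>.
      is_functor C D F0 F1 \<and> is_functor D C G0 G1 \<and>
      natural_isomorphism C C (\<lambda>X. X) (\<lambda>X Y f. f)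
        (\<lambda>X. G0 (F0 X)) (\<lambda>X Y f. G1 (F0 X) (F0 Y) (F1 X Y f)) \<sigma> \<and>
      natural_isomorphism D D (\<lambda>A. F0 (G0 A)) (\<lambda>A B f. F1 (G0 A) (G0 B) (G1 A B f))
        (\<lambda>A. A) (\<lambda>A B f. f) \<tau>)"


section \<open>Universes of small sets\<close>

text \<open>A HOL type cannot contain spaces, or algebras, of all sizes. The categories below are
  therefore formed, as usual in category theory, relative to a universe \<open>U\<close> of small sets:
  objects are the structures whose underlying set belongs to \<open>U\<close>. The family \<open>U\<close> has to be closed
  under subsets and, up to bijection (the elements of its members all have the same type),
  under powersets. The sets coded by the elements of a Grothendieck universe are an instance.\<close>

definition powerset_universe :: "'u set set \<Rightarrow> bool" where
  "powerset_universe U \<longleftrightarrow>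
    (\<forall>A\<in>U. \<forall>B. B \<subseteq> A \<longrightarrow> B \<in> U) \<and>
    (\<forall>A\<in>U. \<exists>P\<in>U. Pow A \<approx> P)"

text \<open>For example, the sets of cardinality below that of a type whose cardinality is a strong
  limit form such a universe.\<close>

lemma powerset_universe_strong_limit:
  assumes "\<And>A :: 'u set. A \<prec> (UNIV :: 'u set) \<Longrightarrow> Pow A \<prec> (UNIV :: 'u set)"
  shows "powerset_universe {A :: 'u set. A \<prec> (UNIV :: 'u set)}"
proof -
  have "B \<prec> (UNIV :: 'u set)" if "A \<prec> (UNIV :: 'u set)" "B \<subseteq> A" for A B :: "'u set"
    using lesspoll_trans1[OF subset_imp_lepoll[OF that(2)] that(1)] .
  moreover have "\<exists>P :: 'u set. P \<prec> (UNIV :: 'u set) \<and> Pow A \<approx> P" if A: "A \<prec> (UNIV :: 'u set)" for A :: "'u set"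
  proof -
    have *: "Pow A \<prec> (UNIV :: 'u set)"
      using assms[OF A] .
    then obtain f :: "'u set \<Rightarrow> 'u" where "inj_on f (Pow A)"
      unfolding lesspoll_def lepoll_def by auto
    then have e: "f ` Pow A \<approx> Pow A"
      by (rule inj_on_image_eqpoll_self)
    show ?thesis
      using lesspoll_trans1[OF eqpoll_imp_lepoll[OF e] *] eqpoll_sym[OF e] by (intro exI[of _ "f ` Pow A"] conjI)
  qed
  ultimately show ?thesis
    unfolding powerset_universe_def by simp
qed


section \<open>Locally compact Hausdorff spaces and skeletal maps\<close>

definition skeletal_map :: "'a topology \<Rightarrow> 'b topology \<Rightarrow> ('a \<Rightarrow> 'b) \<Rightarrow> bool" where
  "skeletal_map X Y f \<longleftrightarrow>
    f \<in> topspace X \<rightarrow> topspace Y \<and>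
    (\<forall>V. openin Y V \<longrightarrow>
      X interior_of {x \<in> topspace X. f x \<in> Y closure_of V}
        \<subseteq> X closure_of {x \<in> topspace X. f x \<in> V})"

text \<open>Here and for \<open>ESkeLC\<close> morphisms are extensional (\<open>undefined\<close> outside the underlying set of the
  source), so that equality of morphisms is equality of functions on that set.\<close>

definition SkeLC :: "'u set set \<Rightarrow> ('u topology, 'u \<Rightarrow> 'u) cat" where
  "SkeLC U =
    \<lparr> Obj = {X. topspace X \<in> U \<and> locally_compact_space X \<and> Hausdorff_space X},
      Hom = (\<lambda>X Y. {f. f \<in> extensional (topspace X) \<and> continuous_map X Y f \<and> skeletal_map X Y f}),
      Ident = (\<lambda>X. restrict (\<lambda>x. x) (topspace X)),
      Comp = (\<lambda>X Y Z g f. compose (topspace X) g f) \<rparr>"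


section \<open>Local contact algebras\<close>

text \<open>Boolean algebras with an explicit carrier: bounded distributive complemented lattices in the
  sense of HOL-Algebra. The trivial algebra is allowed.\<close>

locale boolean_lattice = Lattice.bounded_lattice L for L (structure) +
  assumes meet_join_distrib:
      "\<lbrakk>x \<in> carrier L; y \<in> carrier L; z \<in> carrier L\<rbrakk> \<Longrightarrow> x \<sqinter> (y \<squnion> z) = (x \<sqinter> y) \<squnion> (x \<sqinter> z)"
    and complement_exists:
      "x \<in> carrier L \<Longrightarrow> \<exists>y\<in>carrier L. x \<squnion> y = \<top> \<and> x \<sqinter> y = \<bottom>"

definition complement :: "('a, 'b) gorder_scheme \<Rightarrow> 'a \<Rightarrow> 'a" where
  "complement L x =
    (THE y. y \<in> carrier L \<and> x \<squnion>\<^bsub>L\<^esub> y = \<top>\<^bsub>L\<^esub> \<and> x \<sqinter>\<^bsub>L\<^esub> y = \<bottom>\<^bsub>L\<^esub>)"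

record 'a contact_alg = "'a gorder" +
  contact :: "'a \<Rightarrow> 'a \<Rightarrow> bool"

record 'a local_contact_alg = "'a contact_alg" +
  bounded_elts :: "'a set"

definition way_inside :: "('a, 'b) contact_alg_scheme \<Rightarrow> 'a \<Rightarrow> 'a \<Rightarrow> bool" where
  "way_inside L a b \<longleftrightarrow> \<not> contact L a (complement L b)"

locale contact_algebra = boolean_lattice L for L :: "('a, 'b) contact_alg_scheme" (structure) +
  assumes C1: "\<lbrakk>a \<in> carrier L; a \<noteq> \<bottom>\<rbrakk> \<Longrightarrow> contact L a a"
    and C2: "\<lbrakk>a \<in> carrier L; b \<in> carrier L; contact L a b\<rbrakk> \<Longrightarrow> a \<noteq> \<bottom> \<and> b \<noteq> \<bottom>"
    and C3: "\<lbrakk>a \<in> carrier L; b \<in> carrier L; contact L a b\<rbrakk> \<Longrightarrow> contact L b a"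
    and C4: "\<lbrakk>a \<in> carrier L; b \<in> carrier L; c \<in> carrier L\<rbrakk>
      \<Longrightarrow> contact L a (b \<squnion> c) \<longleftrightarrow> contact L a b \<or> contact L a c"

definition lattice_ideal :: "('a, 'b) gorder_scheme \<Rightarrow> 'a set \<Rightarrow> bool" where
  "lattice_ideal L I \<longleftrightarrow>
    I \<subseteq> carrier L \<and> \<bottom>\<^bsub>L\<^esub> \<in> I \<and>
    (\<forall>x\<in>I. \<forall>y\<in>carrier L. y \<sqsubseteq>\<^bsub>L\<^esub> x \<longrightarrow> y \<in> I) \<and>
    (\<forall>x\<in>I. \<forall>y\<in>I. x \<squnion>\<^bsub>L\<^esub> y \<in> I)"

locale local_contact_algebra =
  contact_algebra L for L :: "('a, 'b) local_contact_alg_scheme" (structure) +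
  assumes ideal: "lattice_ideal L (bounded_elts L)"
    and BC1: "\<lbrakk>a \<in> bounded_elts L; c \<in> carrier L; way_inside L a c\<rbrakk>
      \<Longrightarrow> \<exists>b\<in>bounded_elts L. way_inside L a b \<and> way_inside L b c"
    and BC2: "\<lbrakk>a \<in> carrier L; b \<in> carrier L; contact L a b\<rbrakk>
      \<Longrightarrow> \<exists>c\<in>bounded_elts L. contact L a (c \<sqinter> b)"
    and BC3: "\<lbrakk>a \<in> carrier L; a \<noteq> \<bottom>\<rbrakk>
      \<Longrightarrow> \<exists>b\<in>bounded_elts L - {\<bottom>}. way_inside L b a"

locale complete_local_contact_algebra =
  local_contact_algebra L + Complete_Lattice.complete_lattice L
  for L :: "('a, 'b) local_contact_alg_scheme" (structure)

definition ESkeLC_morphism ::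
  "'a local_contact_alg \<Rightarrow> 'b local_contact_alg \<Rightarrow> ('a \<Rightarrow> 'b) \<Rightarrow> bool" where
  "ESkeLC_morphism A B \<psi> \<longleftrightarrow>
    \<psi> \<in> carrier A \<rightarrow> carrier B \<and>
    \<comment> \<open>EF1\<close> (\<forall>a\<in>carrier A. \<psi> a = \<bottom>\<^bsub>B\<^esub> \<longleftrightarrow> a = \<bottom>\<^bsub>A\<^esub>) \<and>
    \<comment> \<open>EF2\<close> (\<forall>S. S \<subseteq> carrier A \<longrightarrow> \<psi> (\<Squnion>\<^bsub>A\<^esub>S) = \<Squnion>\<^bsub>B\<^esub>(\<psi> ` S)) \<and>
    \<comment> \<open>EF3\<close> (\<forall>a\<in>carrier A. \<forall>b\<in>carrier B. b \<sqsubseteq>\<^bsub>B\<^esub> \<psi> a \<longrightarrow>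
                (\<exists>c\<in>carrier A. c \<sqsubseteq>\<^bsub>A\<^esub> a \<and> \<psi> c = b)) \<and>
    \<comment> \<open>EL4\<close> (\<forall>a\<in>carrier A. \<forall>b\<in>carrier A. contact A a b \<longrightarrow> contact B (\<psi> a) (\<psi> b)) \<and>
    \<comment> \<open>EL5\<close> (\<forall>a\<in>bounded_elts A. \<psi> a \<in> bounded_elts B)"

definition ESkeLC :: "'u set set \<Rightarrow> ('u local_contact_alg, 'u \<Rightarrow> 'u) cat" where
  "ESkeLC U =
    \<lparr> Obj = {A. carrier A \<in> U \<and> complete_local_contact_algebra A},
      Hom = (\<lambda>A B. {\<psi>. \<psi> \<in> extensional (carrier A) \<and> ESkeLC_morphism A B \<psi>}),
      Ident = (\<lambda>A. restrict (\<lambda>a. a) (carrier A)),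
      Comp = (\<lambda>A B C \<psi> \<phi>. compose (carrier A) \<psi> \<phi>) \<rparr>"

end

theory Submission
  imports Defs
begin

text \<open>
  The equivalence sends a locally compact Hausdorff space \<open>X\<close> to its Boolean algebra of regular
  closed sets, where two regular closed sets are in contact when they meet and the bounded elements
  are the compact ones, and it sends a continuous skeletal map \<open>f\<close> to the operation
  \<open>F \<mapsto> cl (f F)\<close>. It is shown to be a functor that is full, faithful and essentially surjective.

  A continuous map is skeletal exactly when the closure of the image of a nonempty open set has
  nonempty interior (\<open>continuous_skeletal_map_iff\<close>). For such maps \<open>cl (f F)\<close> is again regular
  closed, and \<open>F \<mapsto> cl (f F)\<close> is a morphism
  (\<open>ESkeLC_morphism_closure_image\<close>). It determines \<open>f\<close>, because \<open>f x\<close> is the only point that lies in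
  \<open>cl (f F)\<close> for all regular closed neighbourhoods \<open>F\<close> of \<open>x\<close>. The same description recovers a map
  from an arbitrary morphism \<open>\<psi>\<close>: the sets \<open>\<psi> F\<close>, for \<open>F\<close> a neighbourhood of \<open>x\<close>, have
  exactly one common point, existence coming from compactness and uniqueness from the way in which
  \<open>\<psi>\<close> interacts with complements (\<open>ex_continuous_map_of_morphism\<close>).

  Every complete local contact algebra is, up to isomorphism, the algebra of a space. The points are
  the clusters of bounded ultrafilters, where the cluster of \<open>u\<close> consists of the elements in
  contact with all members of \<open>u\<close>; the set of clusters containing \<open>a\<close> is then the regular closed set
  that corresponds to \<open>a\<close> (\<open>rc_representation_extent\<close>).

  Both halves are phrased by a locale \<open>rc_representation\<close>, which says that a bijection \<open>d\<close> identifies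
  an algebra \<open>L\<close> with the regular closed sets of \<open>X\<close>. This treats uniformly the algebras obtained
  from spaces, whose elements have to be coded by elements of the universe, and the given algebras
  with their spaces of clusters. Two algebras represented by the same space are isomorphic through the
  morphism induced by the identity map.
\<close>

text \<open>The notation for the closure of a set under the equivalence of a setoid would clash with that for
  topological closure.\<close>

no_notation eq_closure_of (\<open>closure'_of\<index>\<close>)

section \<open>Fully faithful and essentially surjective functors\<close>

text \<open>The quasi-inverse picks for every \<open>A\<close> an object \<open>G A\<close> with an isomorphism from \<open>F (G A)\<close> to \<open>A\<close>;
  fullness and faithfulness then lift arrows, and the equations between them, along \<open>F\<close>.\<close>

lemma equivalent_categories_if_fully_faithful_essentially_surjective:
  assumes C: "category C" and D: "category D" and F: "is_functor C D F0 F1"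
    and faithful: "\<And>X Y f g. \<lbrakk>X \<in> Obj C; Y \<in> Obj C; f \<in> Hom C X Y; g \<in> Hom C X Y; F1 X Y f = F1 X Y g\<rbrakk> \<Longrightarrow> f = g"
    and full: "\<And>X Y h. \<lbrakk>X \<in> Obj C; Y \<in> Obj C; h \<in> Hom D (F0 X) (F0 Y)\<rbrakk> \<Longrightarrow> \<exists>f\<in>Hom C X Y. F1 X Y f = h"
    and surj: "\<And>A. A \<in> Obj D \<Longrightarrow> \<exists>X\<in>Obj C. \<exists>t. isomorphism D (F0 X) A t"
  shows "equivalent_categories C D"
proof -
  have Did: "\<And>A. A \<in> Obj D \<Longrightarrow> Ident D A \<in> Hom D A A"
    and Dcomp: "\<And>A B E f g. \<lbrakk>A \<in> Obj D; B \<in> Obj D; E \<in> Obj D; f \<in> Hom D A B; g \<in> Hom D B E\<rbrakk> \<Longrightarrow> Comp D A B E g f \<in> Hom D A E"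
    and DidR: "\<And>A B f. \<lbrakk>A \<in> Obj D; B \<in> Obj D; f \<in> Hom D A B\<rbrakk> \<Longrightarrow> Comp D A A B f (Ident D A) = f"
    and DidL: "\<And>A B f. \<lbrakk>A \<in> Obj D; B \<in> Obj D; f \<in> Hom D A B\<rbrakk> \<Longrightarrow> Comp D A B B (Ident D B) f = f"
    and Dassoc: "\<And>A B E K f g h. \<lbrakk>A \<in> Obj D; B \<in> Obj D; E \<in> Obj D; K \<in> Obj D; f \<in> Hom D A B; g \<in> Hom D B E; h \<in> Hom D E K\<rbrakk>
       \<Longrightarrow> Comp D A B K (Comp D B E K h g) f = Comp D A E K h (Comp D A B E g f)"
    using D unfolding category_def by blast+
  have Cid: "\<And>A. A \<in> Obj C \<Longrightarrow> Ident C A \<in> Hom C A A"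
    and Ccomp: "\<And>A B E f g. \<lbrakk>A \<in> Obj C; B \<in> Obj C; E \<in> Obj C; f \<in> Hom C A B; g \<in> Hom C B E\<rbrakk> \<Longrightarrow> Comp C A B E g f \<in> Hom C A E"
    using C unfolding category_def by blast+
  have F0: "\<And>X. X \<in> Obj C \<Longrightarrow> F0 X \<in> Obj D"
    and F1: "\<And>X Y f. \<lbrakk>X \<in> Obj C; Y \<in> Obj C; f \<in> Hom C X Y\<rbrakk> \<Longrightarrow> F1 X Y f \<in> Hom D (F0 X) (F0 Y)"
    and Fid: "\<And>X. X \<in> Obj C \<Longrightarrow> F1 X X (Ident C X) = Ident D (F0 X)"
    and Fcomp: "\<And>X Y Z f g. \<lbrakk>X \<in> Obj C; Y \<in> Obj C; Z \<in> Obj C; f \<in> Hom C X Y; g \<in> Hom C Y Z\<rbrakk>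
       \<Longrightarrow> F1 X Z (Comp C X Y Z g f) = Comp D (F0 X) (F0 Y) (F0 Z) (F1 Y Z g) (F1 X Y f)"
    using F unfolding is_functor_def by blast+
  obtain G0 where G0: "\<And>A. A \<in> Obj D \<Longrightarrow> G0 A \<in> Obj C" and ex: "\<And>A. A \<in> Obj D \<Longrightarrow> \<exists>t. isomorphism D (F0 (G0 A)) A t"
    using surj by metis
  have "\<exists>t s. t \<in> Hom D (F0 (G0 A)) A \<and> s \<in> Hom D A (F0 (G0 A)) \<and>
      Comp D (F0 (G0 A)) A (F0 (G0 A)) s t = Ident D (F0 (G0 A)) \<and> Comp D A (F0 (G0 A)) A t s = Ident D A"
    if "A \<in> Obj D" for A
    using ex[OF that] unfolding isomorphism_def by blast
  then obtain t s where t: "\<And>A. A \<in> Obj D \<Longrightarrow> t A \<in> Hom D (F0 (G0 A)) A"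
    and s: "\<And>A. A \<in> Obj D \<Longrightarrow> s A \<in> Hom D A (F0 (G0 A))"
    and st: "\<And>A. A \<in> Obj D \<Longrightarrow> Comp D (F0 (G0 A)) A (F0 (G0 A)) (s A) (t A) = Ident D (F0 (G0 A))"
    and ts: "\<And>A. A \<in> Obj D \<Longrightarrow> Comp D A (F0 (G0 A)) A (t A) (s A) = Ident D A"
    by metis
  \<comment> \<open>The arrow part of the quasi-inverse is conjugation by the chosen isomorphisms, pulled back along \<open>F\<close>.\<close>
  define conj where "conj A B h = Comp D (F0 (G0 A)) B (F0 (G0 B)) (s B) (Comp D (F0 (G0 A)) A B h (t A))" for A B h
  have conj: "conj A B h \<in> Hom D (F0 (G0 A)) (F0 (G0 B))" if "A \<in> Obj D" "B \<in> Obj D" "h \<in> Hom D A B" for A B h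
    unfolding conj_def using that by (intro Dcomp[where B=B] Dcomp[where B=A] F0 G0 s t)
  have "\<exists>f. f \<in> Hom C X Y \<and> F1 X Y f = h" if "X \<in> Obj C" "Y \<in> Obj C" "h \<in> Hom D (F0 X) (F0 Y)" for X Y h
    using full[OF that] by blast
  then obtain inv1 where inv1: "\<And>X Y h. \<lbrakk>X \<in> Obj C; Y \<in> Obj C; h \<in> Hom D (F0 X) (F0 Y)\<rbrakk> \<Longrightarrow> inv1 X Y h \<in> Hom C X Y"
    and F1inv: "\<And>X Y h. \<lbrakk>X \<in> Obj C; Y \<in> Obj C; h \<in> Hom D (F0 X) (F0 Y)\<rbrakk> \<Longrightarrow> F1 X Y (inv1 X Y h) = h"
    by metis
  define G1 where "G1 A B h = inv1 (G0 A) (G0 B) (conj A B h)" for A B h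
  have G1: "G1 A B h \<in> Hom C (G0 A) (G0 B)" and FG1: "F1 (G0 A) (G0 B) (G1 A B h) = conj A B h"
    if "A \<in> Obj D" "B \<in> Obj D" "h \<in> Hom D A B" for A B h
    using that unfolding G1_def by (auto intro: inv1 F1inv conj G0)
  have t_conj: "Comp D (F0 (G0 A)) (F0 (G0 B)) B (t B) (conj A B h) = Comp D (F0 (G0 A)) A B h (t A)"
    if "A \<in> Obj D" "B \<in> Obj D" "h \<in> Hom D A B" for A B h
  proof -
    have "Comp D (F0 (G0 A)) (F0 (G0 B)) B (t B) (conj A B h)
       = Comp D (F0 (G0 A)) B B (Comp D B (F0 (G0 B)) B (t B) (s B)) (Comp D (F0 (G0 A)) A B h (t A))"
      unfolding conj_def by (rule Dassoc[symmetric]) (use that in \<open>auto intro: Dcomp[where B=A] F0 G0 s t\<close>)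
    also have "\<dots> = Comp D (F0 (G0 A)) A B h (t A)"
      unfolding ts[OF that(2)] by (rule DidL) (use that in \<open>auto intro: Dcomp[where B=A] F0 G0 s t\<close>)
    finally show ?thesis .
  qed
  have conj_comp: "conj A E (Comp D A B E g h) = Comp D (F0 (G0 A)) (F0 (G0 B)) (F0 (G0 E)) (conj B E g) (conj A B h)"
    if [simp]: "A \<in> Obj D" "B \<in> Obj D" "E \<in> Obj D" and h: "h \<in> Hom D A B" and g: "g \<in> Hom D B E" for A B E g h
  proof -
    let ?A = "F0 (G0 A)" and ?B = "F0 (G0 B)" and ?E = "F0 (G0 E)"
    have [simp]: "?A \<in> Obj D" "?B \<in> Obj D" "?E \<in> Obj D" by (simp_all add: F0 G0)
    note facts = t[OF that(1)] t[OF that(2)] s[OF that(3)] h g conj[OF that(1,2) h]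
    have "Comp D ?A ?B ?E (conj B E g) (conj A B h) = Comp D ?A E ?E (s E) (Comp D ?A ?B E (Comp D ?B B E g (t B)) (conj A B h))"
      unfolding conj_def[of B E g] by (rule Dassoc) (use facts in \<open>auto intro: Dcomp[where B=B]\<close>)
    also have "Comp D ?A ?B E (Comp D ?B B E g (t B)) (conj A B h) = Comp D ?A B E g (Comp D ?A ?B B (t B) (conj A B h))"
      by (rule Dassoc) (use facts in auto)
    also have "\<dots> = Comp D ?A B E g (Comp D ?A A B h (t A))"
      using t_conj h by simp
    also have "\<dots> = Comp D ?A A E (Comp D A B E g h) (t A)"
      by (rule Dassoc[symmetric]) (use facts in auto)
    finally show ?thesis unfolding conj_def[of A E] by simp
  qed
  have G: "is_functor D C G0 G1"
    unfolding is_functor_def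
  proof (intro conjI ballI)
    fix A assume A: "A \<in> Obj D"
    have "conj A A (Ident D A) = Ident D (F0 (G0 A))"
      unfolding conj_def using A st t Did DidL F0 G0 by metis
    then show "G1 A A (Ident D A) = Ident C (G0 A)"
      using A by (intro faithful[of "G0 A" "G0 A"]) (auto simp: FG1 Fid Did G0 intro: G1 Cid)
  next
    fix A B E h g assume *: "A \<in> Obj D" "B \<in> Obj D" "E \<in> Obj D" "h \<in> Hom D A B" "g \<in> Hom D B E"
    then have **: "Comp D A B E g h \<in> Hom D A E" by (auto intro: Dcomp)
    have "F1 (G0 A) (G0 E) (Comp C (G0 A) (G0 B) (G0 E) (G1 B E g) (G1 A B h)) = conj A E (Comp D A B E g h)"
      using * by (subst Fcomp) (auto simp: conj_comp FG1 G0 intro: G1)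
    then show "G1 A E (Comp D A B E g h) = Comp C (G0 A) (G0 B) (G0 E) (G1 B E g) (G1 A B h)"
      using * ** by (intro faithful[of "G0 A" "G0 E"]) (auto simp: FG1 G0 intro!: G1 Ccomp[where B="G0 B"])
  qed (auto intro: G0 G1)
  have \<tau>: "natural_isomorphism D D (\<lambda>A. F0 (G0 A)) (\<lambda>A B f. F1 (G0 A) (G0 B) (G1 A B f)) (\<lambda>A. A) (\<lambda>A B f. f) t"
    unfolding natural_isomorphism_def isomorphism_def
    using t s st ts by (fastforce simp: FG1 t_conj)
  \<comment> \<open>The unit at \<open>X\<close> is the preimage under \<open>F\<close> of the inverse of the counit at \<open>F X\<close>.\<close>
  define \<sigma> where "\<sigma> X = inv1 X (G0 (F0 X)) (s (F0 X))" for X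
  define \<sigma>' where "\<sigma>' X = inv1 (G0 (F0 X)) X (t (F0 X))" for X
  have \<sigma>: "\<sigma> X \<in> Hom C X (G0 (F0 X))" "F1 X (G0 (F0 X)) (\<sigma> X) = s (F0 X)"
     "\<sigma>' X \<in> Hom C (G0 (F0 X)) X" "F1 (G0 (F0 X)) X (\<sigma>' X) = t (F0 X)" if "X \<in> Obj C" for X
    unfolding \<sigma>_def \<sigma>'_def using that by (auto intro!: inv1 F1inv s t F0 G0)
  have "natural_isomorphism C C (\<lambda>X. X) (\<lambda>X Y f. f)
        (\<lambda>X. G0 (F0 X)) (\<lambda>X Y f. G1 (F0 X) (F0 Y) (F1 X Y f)) \<sigma>"
    unfolding natural_isomorphism_def isomorphism_def
  proof (intro conjI ballI bexI[of _ "\<sigma>' _"])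
    fix X assume X: "X \<in> Obj C"
    then have X': "G0 (F0 X) \<in> Obj C" by (intro G0 F0)
    show "Comp C X (G0 (F0 X)) X (\<sigma>' X) (\<sigma> X) = Ident C X"
      using X X' \<sigma>[OF X] by (intro faithful[of X X]) (auto simp: Fcomp Fid F0 ts intro!: Ccomp[where B="G0 (F0 X)"] Cid)
    show "Comp C (G0 (F0 X)) X (G0 (F0 X)) (\<sigma> X) (\<sigma>' X) = Ident C (G0 (F0 X))"
      using X X' \<sigma>[OF X] by (intro faithful[of "G0 (F0 X)" "G0 (F0 X)"]) (auto simp: Fcomp Fid F0 st intro!: Ccomp[where B=X] Cid)
  next
    fix X Y f assume X: "X \<in> Obj C" and Y: "Y \<in> Obj C" and f: "f \<in> Hom C X Y"
    let ?X = "G0 (F0 X)" and ?Y = "G0 (F0 Y)"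
    have X': "?X \<in> Obj C" and Y': "?Y \<in> Obj C" using X Y by (auto intro: G0 F0)
    have f': "F1 X Y f \<in> Hom D (F0 X) (F0 Y)" using X Y f by (rule F1)
    have g: "G1 (F0 X) (F0 Y) (F1 X Y f) \<in> Hom C ?X ?Y" using X Y f' by (intro G1 F0)
    have "F1 X ?Y (Comp C X ?X ?Y (G1 (F0 X) (F0 Y) (F1 X Y f)) (\<sigma> X))
       = Comp D (F0 X) (F0 ?X) (F0 ?Y) (conj (F0 X) (F0 Y) (F1 X Y f)) (s (F0 X))"
      using X X' Y' Y \<sigma>[OF X] g f' by (simp add: Fcomp FG1 F0)
    also have "\<dots> = Comp D (F0 X) (F0 Y) (F0 ?Y) (s (F0 Y)) (Comp D (F0 X) (F0 ?X) (F0 Y) (Comp D (F0 ?X) (F0 X) (F0 Y) (F1 X Y f) (t (F0 X))) (s (F0 X)))"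
      unfolding conj_def using X Y X' Y' f' s t F0 by (intro Dassoc) (auto intro: Dcomp[where B="F0 X"])
    also have "Comp D (F0 X) (F0 ?X) (F0 Y) (Comp D (F0 ?X) (F0 X) (F0 Y) (F1 X Y f) (t (F0 X))) (s (F0 X))
       = Comp D (F0 X) (F0 X) (F0 Y) (F1 X Y f) (Comp D (F0 X) (F0 ?X) (F0 X) (t (F0 X)) (s (F0 X)))"
      using X Y X' Y' f' s t F0 by (intro Dassoc) auto
    also have "\<dots> = F1 X Y f" using X Y f' by (simp add: ts F0 DidR)
    also have "Comp D (F0 X) (F0 Y) (F0 ?Y) (s (F0 Y)) (F1 X Y f) = F1 X ?Y (Comp C X Y ?Y (\<sigma> Y) f)"
      using X Y Y' f \<sigma>[OF Y] by (simp add: Fcomp)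
    finally show "Comp C X Y ?Y (\<sigma> Y) f = Comp C X ?X ?Y (G1 (F0 X) (F0 Y) (F1 X Y f)) (\<sigma> X)"
      using X Y X' Y' f g \<sigma>[OF X] \<sigma>[OF Y]
      by (intro faithful[of X ?Y]) (auto intro: Ccomp[where B=Y] Ccomp[where B="?X"])
  qed (use \<sigma> in auto)
  with G \<tau> show ?thesis
    unfolding equivalent_categories_def using C D F by blast
qed

section \<open>Complements in Boolean lattices\<close>

lemma (in boolean_lattice)
  assumes x: "x \<in> carrier L"
  shows complement_closed: "complement L x \<in> carrier L"
    and join_complement: "x \<squnion> complement L x = \<top>"
    and meet_complement: "x \<sqinter> complement L x = \<bottom>"
    and complement_unique: "\<And>y. \<lbrakk>y \<in> carrier L; x \<squnion> y = \<top>; x \<sqinter> y = \<bottom>\<rbrakk> \<Longrightarrow> complement L x = y"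
proof -
  have le: "y \<sqsubseteq> z" if "y \<in> carrier L" "z \<in> carrier L" "x \<sqinter> y = \<bottom>" "x \<squnion> z = \<top>" for y z
  proof -
    have "y = y \<sqinter> (x \<squnion> z)" using that by (metis le_iff_join top_higher top_closed)
    also have "\<dots> = (y \<sqinter> x) \<squnion> (y \<sqinter> z)" using that x by (intro meet_join_distrib)
    also have "y \<sqinter> x = \<bottom>" using that by (metis meet_comm)
    also have "\<bottom> \<squnion> (y \<sqinter> z) = y \<sqinter> z" using that x
      by (metis bottom_closed bottom_lower le_iff_meet meet_closed)
    finally show ?thesis using that le_iff_join by blast
  qed
  have ex: "\<exists>!y. y \<in> carrier L \<and> x \<squnion> y = \<top> \<and> x \<sqinter> y = \<bottom>"
    using complement_exists[OF x] le le_antisym by metis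
  show "complement L x \<in> carrier L" "x \<squnion> complement L x = \<top>" "x \<sqinter> complement L x = \<bottom>"
    using theI'[OF ex] unfolding complement_def by simp_all
  show "complement L x = y" if "y \<in> carrier L" "x \<squnion> y = \<top>" "x \<sqinter> y = \<bottom>" for y
    unfolding complement_def by (rule the1_equality[OF ex]) (intro conjI that)
qed

context boolean_lattice
begin

lemma complement_complement: "x \<in> carrier L \<Longrightarrow> complement L (complement L x) = x"
  by (intro complement_unique complement_closed)
    (simp_all add: join_comm[of L "complement L x"] meet_comm[of L "complement L x"] join_complement meet_complement)

lemma complement_bottom: "complement L \<bottom> = \<top>"
  by (intro complement_unique) (auto simp: eq_is_equal intro: bottom_join[unfolded eq_is_equal] bottom_meet[unfolded eq_is_equal])

lemma complement_top: "complement L \<top> = \<bottom>"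
  using complement_complement[of \<bottom>] by (simp add: complement_bottom)

lemma le_iff_meet_complement:
  assumes x: "x \<in> carrier L" and y: "y \<in> carrier L"
  shows "x \<sqsubseteq> y \<longleftrightarrow> x \<sqinter> complement L y = \<bottom>"
proof
  have y': "complement L y \<in> carrier L" using y by (rule complement_closed)
  assume "x \<sqsubseteq> y"
  have "x \<sqinter> complement L y \<sqsubseteq> y"
    using \<open>x \<sqsubseteq> y\<close> meet_left[OF x y'] x y y' le_trans[of "x \<sqinter> complement L y" x y] by simp
  then have "x \<sqinter> complement L y \<sqsubseteq> y \<sqinter> complement L y"
    using meet_right[OF x y'] x y y' by (intro meet_le) auto
  then show "x \<sqinter> complement L y = \<bottom>"
    unfolding meet_complement[OF y] using le_antisym[OF _ bottom_lower[of "x \<sqinter> complement L y"]] x y' by simp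
next
  have y': "complement L y \<in> carrier L" using y by (rule complement_closed)
  assume 0: "x \<sqinter> complement L y = \<bottom>"
  have "x = x \<sqinter> (y \<squnion> complement L y)"
    unfolding join_complement[OF y] using x le_iff_join[of x \<top>] by simp
  also have "\<dots> = (x \<sqinter> y) \<squnion> \<bottom>" unfolding 0[symmetric] by (rule meet_join_distrib[OF x y y'])
  also have "\<dots> = \<bottom> \<squnion> (x \<sqinter> y)" by (rule join_comm)
  also have "\<dots> = x \<sqinter> y" using bottom_join[of "x \<sqinter> y"] x y by (simp add: eq_is_equal)
  finally show "x \<sqsubseteq> y" using le_iff_join[OF x y] by blast
qed

lemma complement_antimono:
  assumes "x \<in> carrier L" "y \<in> carrier L" "x \<sqsubseteq> y"
  shows "complement L y \<sqsubseteq> complement L x"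
  using assms le_iff_meet_complement[of x y] le_iff_meet_complement[of "complement L y" "complement L x"]
  by (simp add: complement_closed complement_complement meet_comm[of L x])

lemma split_by_complement:
  assumes "x \<in> carrier L" "y \<in> carrier L"
  shows "(x \<sqinter> y) \<squnion> (x \<sqinter> complement L y) = x"
  using meet_join_distrib[OF assms complement_closed[OF assms(2)]] assms le_iff_join[of x \<top>]
  by (simp add: join_complement)

lemma complement_le_of_join_eq_top:
  assumes "x \<in> carrier L" "y \<in> carrier L" "x \<squnion> y = \<top>" shows "complement L x \<sqsubseteq> y"
proof -
  have x': "complement L x \<in> carrier L" using assms(1) by (rule complement_closed)
  have "complement L x = complement L x \<sqinter> (x \<squnion> y)" unfolding assms(3) using x' le_iff_join[of "complement L x" \<top>] by simp
  also have "\<dots> = (complement L x \<sqinter> x) \<squnion> (complement L x \<sqinter> y)" by (rule meet_join_distrib[OF x' assms(1,2)])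
  also have "complement L x \<sqinter> x = \<bottom>" using meet_complement[OF assms(1)] by (simp add: meet_comm)
  also have "\<bottom> \<squnion> (complement L x \<sqinter> y) = complement L x \<sqinter> y" using bottom_join[of "complement L x \<sqinter> y"] x' assms(2) by (simp add: eq_is_equal)
  finally show ?thesis using le_iff_join[OF x' assms(2)] by blast
qed

end

section \<open>Regular closed sets\<close>

definition regular_closed :: "'a topology \<Rightarrow> 'a set \<Rightarrow> bool" where
  "regular_closed X F \<longleftrightarrow> X closure_of (X interior_of F) = F"

lemma regular_closed_closedin: "regular_closed X F \<Longrightarrow> closedin X F"
  unfolding regular_closed_def by (metis closedin_closure_of)

lemma regular_closed_subset_topspace: "regular_closed X F \<Longrightarrow> F \<subseteq> topspace X"
  by (simp add: regular_closed_closedin closedin_subset)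

lemma regular_closed_closure_of_open:
  assumes "openin X W" shows "regular_closed X (X closure_of W)"
proof -
  have "X closure_of W \<subseteq> X closure_of (X interior_of (X closure_of W))"
    by (intro closure_of_mono interior_of_maximal closure_of_subset openin_subset assms)
  moreover have "X closure_of (X interior_of (X closure_of W)) \<subseteq> X closure_of W"
    by (simp add: closure_of_minimal interior_of_subset)
  ultimately show ?thesis unfolding regular_closed_def by blast
qed

text \<open>A regular closed set is the closure of its interior, so inclusion in a closed set can be tested
  on the interior.\<close>

lemma regular_closed_subset_iff:
  assumes "regular_closed X F" "closedin X G"
  shows "F \<subseteq> G \<longleftrightarrow> X interior_of F \<subseteq> G"
  using assms closure_of_minimal interior_of_subset unfolding regular_closed_def by (metis order_trans)

lemma regular_closed_closure_of_Union:
  assumes "\<And>F. F \<in> \<F> \<Longrightarrow> regular_closed X F"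
  shows "regular_closed X (X closure_of \<Union>\<F>)"
proof -
  let ?G = "X closure_of \<Union>\<F>"
  have "F \<subseteq> X closure_of (X interior_of ?G)" if "F \<in> \<F>" for F
  proof -
    have "F \<subseteq> ?G" using that assms[OF that] regular_closed_subset_topspace[of X F]
      by (metis Union_upper closure_of_mono closure_of_closedin regular_closed_closedin)
    then have "X closure_of (X interior_of F) \<subseteq> X closure_of (X interior_of ?G)"
      by (intro closure_of_mono interior_of_mono)
    then show ?thesis using assms[OF that] unfolding regular_closed_def by simp
  qed
  then have "?G \<subseteq> X closure_of (X interior_of ?G)"
    by (intro closure_of_minimal) auto
  moreover have "X closure_of (X interior_of ?G) \<subseteq> ?G"
    by (simp add: closure_of_minimal interior_of_subset)
  ultimately show ?thesis unfolding regular_closed_def by blast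
qed

lemma regular_closed_Un:
  assumes "regular_closed X F" "regular_closed X G"
  shows "regular_closed X (F \<union> G)"
proof -
  have "regular_closed X (X closure_of \<Union>{F, G})"
    using assms by (intro regular_closed_closure_of_Union) auto
  then show ?thesis using assms by (simp add: closure_of_closedin regular_closed_closedin)
qed

lemma regular_closed_empty: "regular_closed X {}"
  and regular_closed_topspace: "regular_closed X (topspace X)"
  by (simp_all add: regular_closed_def)

lemma regular_closed_closure_of_complement:
  "regular_closed X F \<Longrightarrow> regular_closed X (X closure_of (topspace X - F))"
  by (intro regular_closed_closure_of_open openin_diff) (auto simp: regular_closed_closedin)

text \<open>The intersection of two regular closed sets need not be regular closed; the meet is obtained by passing
  to interiors first.\<close>

definition regular_meet :: "'a topology \<Rightarrow> 'a set \<Rightarrow> 'a set \<Rightarrow> 'a set" where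
  "regular_meet X F G = X closure_of (X interior_of F \<inter> X interior_of G)"

lemma regular_closed_regular_meet: "regular_closed X (regular_meet X F G)"
  unfolding regular_meet_def by (intro regular_closed_closure_of_open) auto

lemma regular_meet_subset:
  assumes "regular_closed X F" shows "regular_meet X F G \<subseteq> F" "regular_meet X G F \<subseteq> F"
  unfolding regular_meet_def using interior_of_subset[of X F]
  by (intro closure_of_minimal regular_closed_closedin[OF assms]; blast)+

text \<open>With \<open>regular_meet_subset\<close> this identifies \<open>regular_meet\<close> as the meet in the poset of regular
  closed sets.\<close>

lemma subset_regular_meet:
  assumes "regular_closed X H" "H \<subseteq> F" "H \<subseteq> G" shows "H \<subseteq> regular_meet X F G"
proof -
  have "X closure_of (X interior_of H) \<subseteq> regular_meet X F G"
    unfolding regular_meet_def using assms by (intro closure_of_mono Int_greatest interior_of_mono)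
  then show ?thesis using assms(1) unfolding regular_closed_def by simp
qed

text \<open>The intersection of an open set with the closure of a set is contained in the closure of their
  intersection, so passing to interiors loses nothing.\<close>

lemma regular_meet_Un_distrib:
  assumes "regular_closed X F" "regular_closed X G" "regular_closed X H"
  shows "regular_meet X F (G \<union> H) \<subseteq> regular_meet X F G \<union> regular_meet X F H"
proof -
  let ?W = "X interior_of F \<inter> X interior_of (G \<union> H)"
  have "?W \<subseteq> X closure_of (X interior_of G \<union> X interior_of H)"
    using interior_of_subset[of X "G \<union> H"] assms(2,3) unfolding regular_closed_def by auto
  then have "?W \<subseteq> X interior_of F \<inter> X closure_of (X interior_of G \<union> X interior_of H)"
    by blast
  also have "\<dots> \<subseteq> X closure_of (X interior_of F \<inter> (X interior_of G \<union> X interior_of H))"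
    by (intro openin_Int_closure_of_subset) auto
  also have "\<dots> = regular_meet X F G \<union> regular_meet X F H"
    unfolding regular_meet_def by (simp add: Int_Un_distrib)
  finally show ?thesis unfolding regular_meet_def[of X F "G \<union> H"]
    by (intro closure_of_minimal) (auto simp: regular_meet_def)
qed

lemma locally_compact_Hausdorff_nbhd:
  assumes "locally_compact_space X" "Hausdorff_space X" "openin X W" "x \<in> W"
  obtains V where "openin X V" "x \<in> V" "compactin X (X closure_of V)" "X closure_of V \<subseteq> W"
proof -
  have "neighbourhood_base_of (\<lambda>C. compactin X C \<and> closedin X C) X"
    using assms locally_compact_space_neighbourhood_base_closedin by blast
  then obtain V C where V: "openin X V" "compactin X C" "closedin X C" "x \<in> V" "V \<subseteq> C" "C \<subseteq> W"
    using assms unfolding neighbourhood_base_of by metis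
  then have sub: "X closure_of V \<subseteq> C" by (intro closure_of_minimal)
  then have "compactin X (X closure_of V)" using V(2) by (meson closed_compactin closedin_closure_of)
  with V sub show thesis by (intro that[of V]) auto
qed

text \<open>Cover the compact set by finitely many of the neighbourhoods of \<open>locally_compact_Hausdorff_nbhd\<close>.
  This gives interpolation for the algebra of regular closed sets.\<close>

lemma locally_compact_Hausdorff_compact_nbhd:
  assumes X: "locally_compact_space X" "Hausdorff_space X" and "compactin X K" "openin X W" "K \<subseteq> W"
  obtains V where "openin X V" "K \<subseteq> V" "compactin X (X closure_of V)" "X closure_of V \<subseteq> W"
proof -
  let ?\<V> = "{V. openin X V \<and> compactin X (X closure_of V) \<and> X closure_of V \<subseteq> W}"
  have "\<exists>V. V \<in> ?\<V> \<and> x \<in> V" if "x \<in> K" for x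
    using locally_compact_Hausdorff_nbhd[OF X assms(4)] that assms(5) by (metis (mono_tags, lifting) mem_Collect_eq subsetD)
  then have "K \<subseteq> \<Union>?\<V>" by blast
  moreover have "\<And>V. V \<in> ?\<V> \<Longrightarrow> openin X V" by blast
  ultimately obtain \<F> where \<F>: "finite \<F>" "\<F> \<subseteq> ?\<V>" "K \<subseteq> \<Union>\<F>"
    using \<open>compactin X K\<close> by (meson compactinD)
  have cl: "X closure_of \<Union>\<F> = (\<Union>V\<in>\<F>. X closure_of V)"
    by (rule closure_of_Union) (use \<F> in auto)
  show thesis
  proof (rule that[of "\<Union>\<F>"])
    show "openin X (\<Union>\<F>)" "X closure_of \<Union>\<F> \<subseteq> W" using \<F> by (auto simp: cl)
    show "compactin X (X closure_of \<Union>\<F>)" unfolding cl using \<F> by (intro compactin_Union) auto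
  qed (rule \<F>)
qed

section \<open>Local contact algebras of regular closed sets\<close>

text \<open>The algebra \<open>L\<close> is a copy, along \<open>d\<close>, of the regular closed sets of \<open>X\<close>. Working with copies
  makes it possible to compare algebras whose elements are not sets of points.\<close>

locale rc_representation =
  fixes X :: "'a topology" and L :: "'b local_contact_alg" (structure) and d :: "'b \<Rightarrow> 'a set"
  assumes lc: "locally_compact_space X" and haus: "Hausdorff_space X"
    and bij: "bij_betw d (carrier L) {F. regular_closed X F}"
    and eq_L: "(.=) = (=)"
    and le_iff: "\<lbrakk>a \<in> carrier L; b \<in> carrier L\<rbrakk> \<Longrightarrow> a \<sqsubseteq> b \<longleftrightarrow> d a \<subseteq> d b"
    and contact_iff: "\<lbrakk>a \<in> carrier L; b \<in> carrier L\<rbrakk> \<Longrightarrow> contact L a b \<longleftrightarrow> d a \<inter> d b \<noteq> {}"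
    and bounded_eq: "bounded_elts L = {a \<in> carrier L. compactin X (d a)}"
begin

lemma rc [simp]: "a \<in> carrier L \<Longrightarrow> regular_closed X (d a)"
  using bij_betw_apply[OF bij] by simp

lemma ex_rep: "regular_closed X F \<Longrightarrow> \<exists>a\<in>carrier L. d a = F"
proof -
  assume "regular_closed X F"
  then have "F \<in> d ` carrier L" using bij_betw_imp_surj_on[OF bij] by simp
  then show ?thesis by auto
qed

lemma d_inject: "\<lbrakk>a \<in> carrier L; b \<in> carrier L\<rbrakk> \<Longrightarrow> d a = d b \<longleftrightarrow> a = b"
  using inj_on_eq_iff[OF bij_betw_imp_inj_on[OF bij]] .

lemma closed_d [simp]: "a \<in> carrier L \<Longrightarrow> closedin X (d a)"
  by (simp add: regular_closed_closedin)

text \<open>Suprema are closures of unions; infima are then found as suprema of lower bounds.\<close>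

lemma least_Upper_iff:
  assumes A: "A \<subseteq> carrier L" and s: "s \<in> carrier L"
  shows "least L s (Upper L A) \<longleftrightarrow> d s = X closure_of \<Union>(d ` A)"
proof -
  have up: "u \<in> Upper L A \<longleftrightarrow> X closure_of \<Union>(d ` A) \<subseteq> d u" if "u \<in> carrier L" for u
  proof -
    have sub: "\<Union>(d ` A) \<subseteq> topspace X"
      using A by (meson UN_least closedin_subset closed_d subset_eq)
    have "u \<in> Upper L A \<longleftrightarrow> \<Union>(d ` A) \<subseteq> d u"
      unfolding Upper_def using A that by (auto simp: le_iff subset_iff)
    then show ?thesis using that sub by (simp add: closure_of_minimal_eq)
  qed
  have "regular_closed X (X closure_of \<Union>(d ` A))"
    using A by (intro regular_closed_closure_of_Union) auto
  then obtain t where t: "t \<in> carrier L" "d t = X closure_of \<Union>(d ` A)" using ex_rep by blast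
  show ?thesis
  proof
    assume l: "least L s (Upper L A)"
    then have "s \<in> Upper L A" "s \<sqsubseteq> t" using t up unfolding least_def by auto
    then show "d s = X closure_of \<Union>(d ` A)" using up[OF s] s t le_iff by auto
  next
    assume "d s = X closure_of \<Union>(d ` A)"
    then have ds: "d s \<subseteq> d u \<longleftrightarrow> u \<in> Upper L A" if "u \<in> carrier L" for u using up[OF that] by simp
    have "s \<in> Upper L A" using ds[OF s] by simp
    moreover have "s \<sqsubseteq> u" if "u \<in> Upper L A" for u
    proof -
      have "u \<in> carrier L" using that by (simp add: Upper_def)
      then show ?thesis using ds[of u] that le_iff[of s u] s by simp
    qed
    ultimately show "least L s (Upper L A)"
      unfolding least_def by (intro conjI ballI Upper_closed)
  qed
qed

sublocale partial_order L
proof unfold_locales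
  show "(.=) = (=)" by (rule eq_L)
  show "x .= y" if "x \<sqsubseteq> y" "y \<sqsubseteq> x" "x \<in> carrier L" "y \<in> carrier L" for x y
  proof -
    have "d x = d y" using that le_iff by (metis subset_antisym)
    then show ?thesis using that d_inject unfolding eq_L by metis
  qed
  show "x \<sqsubseteq> z" if "x \<sqsubseteq> y" "y \<sqsubseteq> z" "x \<in> carrier L" "y \<in> carrier L" "z \<in> carrier L" for x y z
    using that le_iff by (metis subset_trans)
qed (simp_all add: eq_L le_iff)

sublocale Complete_Lattice.complete_lattice L
proof (rule complete_latticeI)
  fix A assume A: "A \<subseteq> carrier L"
  have sup: "\<exists>s\<in>carrier L. d s = X closure_of \<Union>(d ` B)" if "B \<subseteq> carrier L" for B
    using that by (intro ex_rep regular_closed_closure_of_Union) auto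
  then show "\<exists>s. least L s (Upper L A)" using least_Upper_iff[OF A] A by blast
  have low: "Lower L A \<subseteq> carrier L" unfolding Lower_def by blast
  with sup obtain i where i: "i \<in> carrier L" "d i = X closure_of \<Union>(d ` Lower L A)" by blast
  have "d i \<subseteq> d a" if "a \<in> A" for a
    unfolding i
  proof (rule closure_of_minimal)
    have "d l \<subseteq> d a" if "l \<in> Lower L A" for l
      using that \<open>a \<in> A\<close> A le_iff[of l a] by (auto simp: Lower_def)
    then show "\<Union>(d ` Lower L A) \<subseteq> d a" by blast
  qed (use that A in auto)
  moreover have "d l \<subseteq> d i" if "l \<in> Lower L A" for l
  proof -
    have "\<Union>(d ` Lower L A) \<subseteq> topspace X"
      using low by (meson UN_least closedin_subset closed_d subset_eq)
    from closure_of_subset[OF this] show ?thesis unfolding i using that by blast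
  qed
  ultimately have "i \<in> Lower L A" "\<And>l. l \<in> Lower L A \<Longrightarrow> l \<sqsubseteq> i"
    using low i(1) A by (auto simp: Lower_def le_iff[OF i(1)] le_iff[OF _ i(1)])
  then have "greatest L i (Lower L A)"
    unfolding greatest_def using low by blast
  then show "\<exists>i. greatest L i (Lower L A)" ..
qed

lemma d_Sup: "A \<subseteq> carrier L \<Longrightarrow> d (\<Squnion>A) = X closure_of \<Union>(d ` A)"
  using least_Upper_iff[of A "\<Squnion>A"] supI[of A "\<lambda>s. least L s (Upper L A)"] by auto

lemma d_bottom [simp]: "d \<bottom> = {}"
proof -
  obtain b where "b \<in> carrier L" "d b = {}" using ex_rep[OF regular_closed_empty] by blast
  then show ?thesis using le_iff[of \<bottom> b] by auto
qed

lemma d_eq_empty_iff: "a \<in> carrier L \<Longrightarrow> d a = {} \<longleftrightarrow> a = \<bottom>"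
  using d_inject[of a \<bottom>] by simp

lemma d_top [simp]: "d \<top> = topspace X"
proof -
  obtain b where b: "b \<in> carrier L" "d b = topspace X" using ex_rep[OF regular_closed_topspace] by blast
  then have "topspace X \<subseteq> d \<top>" using le_iff[of b \<top>] by auto
  moreover have "d \<top> \<subseteq> topspace X" by (intro closedin_subset) auto
  ultimately show ?thesis by blast
qed

lemma d_join [simp]:
  assumes "a \<in> carrier L" "b \<in> carrier L" shows "d (a \<squnion> b) = d a \<union> d b"
proof -
  obtain s where s: "s \<in> carrier L" "d s = d a \<union> d b"
    using assms ex_rep regular_closed_Un rc by meson
  then have "a \<squnion> b \<sqsubseteq> s" using assms by (intro join_le) (auto simp: le_iff)
  moreover have "a \<sqsubseteq> a \<squnion> b" "b \<sqsubseteq> a \<squnion> b" using assms by (auto intro: join_left join_right)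
  ultimately show ?thesis using s assms by (auto simp: le_iff)
qed

lemma d_meet [simp]:
  assumes "a \<in> carrier L" "b \<in> carrier L" shows "d (a \<sqinter> b) = regular_meet X (d a) (d b)"
proof
  have "a \<sqinter> b \<sqsubseteq> a" "a \<sqinter> b \<sqsubseteq> b" using assms by (auto intro: meet_left meet_right)
  then show "d (a \<sqinter> b) \<subseteq> regular_meet X (d a) (d b)"
    using assms by (intro subset_regular_meet) (auto simp: le_iff)
  obtain s where s: "s \<in> carrier L" "d s = regular_meet X (d a) (d b)"
    using ex_rep regular_closed_regular_meet by meson
  then have "s \<sqsubseteq> a \<sqinter> b"
    using assms regular_meet_subset[OF rc] by (intro meet_le) (simp_all add: le_iff)
  then show "regular_meet X (d a) (d b) \<subseteq> d (a \<sqinter> b)" using s assms by (simp add: le_iff)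
qed

lemma complement_rep:
  assumes "a \<in> carrier L" "b \<in> carrier L" "d b = X closure_of (topspace X - d a)"
  shows "a \<squnion> b = \<top>" "a \<sqinter> b = \<bottom>"
proof -
  have "topspace X - d a \<subseteq> d b" unfolding assms(3) by (intro closure_of_subset) auto
  moreover have "d a \<subseteq> topspace X" "d b \<subseteq> topspace X" using assms by (auto intro!: closedin_subset)
  ultimately have "d (a \<squnion> b) = d \<top>" using assms(1,2) by auto
  then show "a \<squnion> b = \<top>" using assms by (subst (asm) d_inject) auto
  have "X interior_of d a \<inter> X interior_of (d b) = {}"
    using interior_of_subset[of X "d b"] unfolding assms(3) closure_of_complement by blast
  then have "d (a \<sqinter> b) = d \<bottom>"
    using assms by (simp add: regular_meet_def)
  then show "a \<sqinter> b = \<bottom>" using assms by (subst (asm) d_inject) auto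
qed

sublocale boolean_lattice L
proof
  fix x y z assume c: "x \<in> carrier L" "y \<in> carrier L" "z \<in> carrier L"
  have "regular_meet X F G \<subseteq> regular_meet X F (G \<union> H)" "regular_meet X F H \<subseteq> regular_meet X F (G \<union> H)" for F G H
    unfolding regular_meet_def by (intro closure_of_mono Int_mono interior_of_mono; blast)+
  then have "x \<sqinter> y \<sqsubseteq> x \<sqinter> (y \<squnion> z)" "x \<sqinter> z \<sqsubseteq> x \<sqinter> (y \<squnion> z)"
    using c by (simp_all add: le_iff)
  then have "(x \<sqinter> y) \<squnion> (x \<sqinter> z) \<sqsubseteq> x \<sqinter> (y \<squnion> z)" using c by (intro join_le) auto
  moreover have "x \<sqinter> (y \<squnion> z) \<sqsubseteq> (x \<sqinter> y) \<squnion> (x \<sqinter> z)"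
    using c regular_meet_Un_distrib[of X "d x" "d y" "d z"] by (simp add: le_iff)
  ultimately show "x \<sqinter> (y \<squnion> z) = (x \<sqinter> y) \<squnion> (x \<sqinter> z)" using c by (intro le_antisym) auto
next
  fix x assume x: "x \<in> carrier L"
  then obtain y where "y \<in> carrier L" "d y = X closure_of (topspace X - d x)"
    using ex_rep regular_closed_closure_of_complement rc by meson
  then show "\<exists>y\<in>carrier L. x \<squnion> y = \<top> \<and> x \<sqinter> y = \<bottom>" using complement_rep x by blast
qed

lemma d_complement:
  assumes "a \<in> carrier L" shows "d (complement L a) = topspace X - X interior_of (d a)"
proof -
  obtain y where y: "y \<in> carrier L" "d y = X closure_of (topspace X - d a)"
    using ex_rep regular_closed_closure_of_complement rc assms by meson
  then have "complement L a = y" using complement_unique complement_rep assms by blast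
  then show ?thesis using y by (simp add: closure_of_complement)
qed

lemma way_inside_iff:
  assumes "a \<in> carrier L" "b \<in> carrier L"
  shows "way_inside L a b \<longleftrightarrow> d a \<subseteq> X interior_of (d b)"
  using assms closedin_subset[OF closed_d[of a]] unfolding way_inside_def
  by (auto simp: contact_iff complement_closed d_complement)

lemma bounded_in_carrier: "a \<in> bounded_elts L \<Longrightarrow> a \<in> carrier L"
  by (simp add: bounded_eq)

text \<open>The interpolation property (BC1), but for a compact set that need not be regular closed; singletons
  give bases of regular closed compact neighbourhoods.\<close>

lemma rc_nbhd:
  assumes "compactin X K" "openin X W" "K \<subseteq> W"
  obtains b where "b \<in> bounded_elts L" "K \<subseteq> X interior_of (d b)" "d b \<subseteq> W"
proof -
  obtain V where V: "openin X V" "K \<subseteq> V" "compactin X (X closure_of V)" "X closure_of V \<subseteq> W"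
    using locally_compact_Hausdorff_compact_nbhd[OF lc haus assms] by blast
  obtain b where b: "b \<in> carrier L" "d b = X closure_of V"
    using ex_rep regular_closed_closure_of_open V by meson
  have "V \<subseteq> X interior_of (d b)"
    unfolding b using V by (intro interior_of_maximal closure_of_subset openin_subset)
  then show thesis using that[of b] V b by (auto simp: bounded_eq)
qed

sublocale complete_local_contact_algebra L
proof
  show "contact L a a" if "a \<in> carrier L" "a \<noteq> \<bottom>" for a
    using that by (simp add: contact_iff d_eq_empty_iff)
  show "a \<noteq> \<bottom> \<and> b \<noteq> \<bottom>" if "a \<in> carrier L" "b \<in> carrier L" "contact L a b" for a b
    using that by (auto simp: contact_iff)
  show "contact L b a" if "a \<in> carrier L" "b \<in> carrier L" "contact L a b" for a b
    using that by (auto simp: contact_iff)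
  show "contact L a (b \<squnion> c) \<longleftrightarrow> contact L a b \<or> contact L a c"
    if "a \<in> carrier L" "b \<in> carrier L" "c \<in> carrier L" for a b c
    using that by (auto simp: contact_iff)
  show "lattice_ideal L (bounded_elts L)"
    unfolding lattice_ideal_def
    by (auto simp: bounded_eq le_iff compactin_Un intro: closed_compactin)
  show "\<exists>b\<in>bounded_elts L. way_inside L a b \<and> way_inside L b c"
    if a: "a \<in> bounded_elts L" and c: "c \<in> carrier L" "way_inside L a c" for a c
  proof -
    obtain b where "b \<in> bounded_elts L" "d a \<subseteq> X interior_of (d b)" "d b \<subseteq> X interior_of (d c)"
      using a c rc_nbhd[of "d a" "X interior_of (d c)"] by (auto simp: bounded_eq way_inside_iff)
    then show ?thesis using a c by (auto simp: bounded_in_carrier way_inside_iff)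
  qed
  show "\<exists>c\<in>bounded_elts L. contact L a (c \<sqinter> b)"
    if ab: "a \<in> carrier L" "b \<in> carrier L" "contact L a b" for a b
  proof -
    obtain x where x: "x \<in> d a" "x \<in> d b" using ab by (auto simp: contact_iff)
    then have xX: "x \<in> topspace X" using ab closedin_subset closed_d by blast
    then obtain c where c: "c \<in> bounded_elts L" "{x} \<subseteq> X interior_of (d c)"
      using rc_nbhd[of "{x}" "topspace X"] by auto
    have "x \<in> X interior_of (d c) \<inter> X closure_of (X interior_of (d b))"
      using x c rc[OF ab(2)] unfolding regular_closed_def by auto
    also have "\<dots> \<subseteq> regular_meet X (d c) (d b)"
      unfolding regular_meet_def by (rule openin_Int_closure_of_subset) simp
    finally show ?thesis using x ab c by (auto simp: contact_iff bounded_in_carrier)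
  qed
  show "\<exists>b\<in>bounded_elts L - {\<bottom>}. way_inside L b a" if a: "a \<in> carrier L" "a \<noteq> \<bottom>" for a
  proof -
    have "X interior_of (d a) \<noteq> {}"
      using a rc[OF a(1)] d_eq_empty_iff unfolding regular_closed_def by force
    then obtain x where x: "x \<in> X interior_of (d a)" by blast
    then have "x \<in> topspace X" using interior_of_subset_topspace by fastforce
    then obtain b where b: "b \<in> bounded_elts L" "{x} \<subseteq> X interior_of (d b)" "d b \<subseteq> X interior_of (d a)"
      using rc_nbhd[of "{x}" "X interior_of (d a)"] x by auto
    then have "d b \<noteq> {}" using interior_of_subset[of X "d b"] by auto
    then show ?thesis using a b by (auto simp: way_inside_iff bounded_in_carrier)
  qed
qed

end

section \<open>Skeletal maps\<close>

text \<open>If the closure of \<open>f W\<close> has empty interior, then its complement \<open>V\<close> is dense and the defining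
  condition for \<open>V\<close> forces \<open>W\<close> to meet the preimage of \<open>V\<close>, which is impossible. Conversely, a nonempty
  open \<open>W\<close> that is mapped into the closure of \<open>V\<close> but misses the preimage of \<open>V\<close> has an image
  disjoint from \<open>V\<close> whose closure contains a nonempty open set meeting \<open>V\<close>.\<close>

lemma continuous_skeletal_map_iff:
  assumes f: "continuous_map X Y f"
  shows "skeletal_map X Y f \<longleftrightarrow>
    (\<forall>W. openin X W \<longrightarrow> W \<noteq> {} \<longrightarrow> Y interior_of (Y closure_of (f ` W)) \<noteq> {})"
proof -
  have ft: "f \<in> topspace X \<rightarrow> topspace Y" using continuous_map_funspace[OF f] .
  have *: "Y interior_of (Y closure_of (f ` W)) \<noteq> {}"
    if sk: "\<And>V. openin Y V \<Longrightarrow> X interior_of {x \<in> topspace X. f x \<in> Y closure_of V} \<subseteq> X closure_of {x \<in> topspace X. f x \<in> V}"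
      and W: "openin X W" "W \<noteq> {}" for W
  proof
    assume emp: "Y interior_of (Y closure_of (f ` W)) = {}"
    let ?V = "topspace Y - Y closure_of (f ` W)"
    have WX: "W \<subseteq> topspace X" using W openin_subset by blast
    have "Y closure_of ?V = topspace Y" using emp by (simp add: closure_of_complement)
    moreover have "{x \<in> topspace X. f x \<in> topspace Y} = topspace X" using ft by blast
    ultimately have "topspace X \<subseteq> X closure_of {x \<in> topspace X. f x \<in> ?V}"
      using sk[of ?V] by (simp add: openin_diff)
    moreover have "f ` W \<subseteq> Y closure_of (f ` W)" using WX ft by (intro closure_of_subset) blast
    then have "W \<inter> {x \<in> topspace X. f x \<in> ?V} = {}" by blast
    then have "W \<inter> X closure_of {x \<in> topspace X. f x \<in> ?V} = {}"
      using openin_Int_closure_of_eq_empty[OF W(1)] by blast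
    ultimately show False using W(2) WX by blast
  qed
  have "X interior_of {x \<in> topspace X. f x \<in> Y closure_of V} \<subseteq> X closure_of {x \<in> topspace X. f x \<in> V}"
    if dense: "\<And>W. openin X W \<Longrightarrow> W \<noteq> {} \<Longrightarrow> Y interior_of (Y closure_of (f ` W)) \<noteq> {}"
      and V: "openin Y V" for V
  proof (rule ccontr)
    let ?P = "{x \<in> topspace X. f x \<in> V}"
    let ?W = "X interior_of {x \<in> topspace X. f x \<in> Y closure_of V} - X closure_of ?P"
    assume "\<not> ?thesis"
    then have W: "openin X ?W" "?W \<noteq> {}" by (auto intro: openin_diff)
    have WV: "f ` ?W \<subseteq> Y closure_of V" using interior_of_subset by fastforce
    have "?P \<subseteq> X closure_of ?P" by (intro closure_of_subset) blast
    then have disj: "f ` ?W \<inter> V = {}" using openin_subset[OF W(1)] by blast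
    let ?I = "Y interior_of (Y closure_of (f ` ?W))"
    have "?I \<subseteq> Y closure_of (f ` ?W)" by (rule interior_of_subset)
    moreover have "?I \<noteq> {}" using dense W by blast
    ultimately have "?I \<inter> f ` ?W \<noteq> {}"
      using openin_Int_closure_of_eq_empty[of Y ?I "f ` ?W"] by auto
    then have "?I \<inter> Y closure_of V \<noteq> {}" using WV by blast
    then have "?I \<inter> V \<noteq> {}" using openin_Int_closure_of_eq_empty[of Y ?I V] by auto
    then have "V \<inter> Y closure_of (f ` ?W) \<noteq> {}" using interior_of_subset[of Y] by blast
    then show False using openin_Int_closure_of_eq_empty[OF V, of "f ` ?W"] disj by blast
  qed
  with * show ?thesis unfolding skeletal_map_def using ft by meson
qed

lemma closure_of_image_closure_of:
  assumes "continuous_map X Y f" "S \<subseteq> topspace X"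
  shows "Y closure_of (f ` (X closure_of S)) = Y closure_of (f ` S)"
proof
  show "Y closure_of (f ` (X closure_of S)) \<subseteq> Y closure_of (f ` S)"
    using continuous_map_image_closure_subset[OF assms(1)] by (intro closure_of_minimal) auto
  show "Y closure_of (f ` S) \<subseteq> Y closure_of (f ` (X closure_of S))"
    using assms by (intro closure_of_mono image_mono closure_of_subset)
qed

lemma skeletal_map_compose:
  assumes f: "continuous_map X Y f" "skeletal_map X Y f" and g: "continuous_map Y Z g" "skeletal_map Y Z g"
  shows "skeletal_map X Z (g \<circ> f)"
proof -
  have "Z interior_of (Z closure_of ((g \<circ> f) ` W)) \<noteq> {}" if W: "openin X W" "W \<noteq> {}" for W
  proof -
    let ?I = "Y interior_of (Y closure_of (f ` W))"
    have fW: "f ` W \<subseteq> topspace Y" using openin_subset[OF W(1)] continuous_map_funspace[OF f(1)] by blast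
    have "?I \<noteq> {}" using W f continuous_skeletal_map_iff by blast
    then have "Z interior_of (Z closure_of (g ` ?I)) \<noteq> {}"
      using g continuous_skeletal_map_iff openin_interior_of by blast
    moreover have "Z closure_of (g ` ?I) \<subseteq> Z closure_of (g ` (Y closure_of (f ` W)))"
      by (intro closure_of_mono image_mono interior_of_subset)
    then have "Z closure_of (g ` ?I) \<subseteq> Z closure_of ((g \<circ> f) ` W)"
      using closure_of_image_closure_of[OF g(1) fW] by (simp add: image_comp)
    ultimately show ?thesis using interior_of_mono by blast
  qed
  then show ?thesis using continuous_skeletal_map_iff[OF continuous_map_compose[OF f(1) g(1)]] by blast
qed

text \<open>It suffices that \<open>f w\<close> lies in the closure of the interior of \<open>cl (f F)\<close> for \<open>w\<close> in the interior \<open>W\<close>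
  of \<open>F\<close>. For this, apply skeletality to the part of \<open>W\<close> that is mapped into a given neighbourhood of
  \<open>f w\<close>.\<close>

lemma regular_closed_closure_of_image:
  assumes f: "continuous_map X Y f" "skeletal_map X Y f" and F: "regular_closed X F"
  shows "regular_closed Y (Y closure_of (f ` F))"
proof -
  let ?W = "X interior_of F" and ?G = "Y closure_of (f ` (X interior_of F))"
  have WX: "?W \<subseteq> topspace X" by (rule interior_of_subset_topspace)
  have G: "Y closure_of (f ` F) = ?G"
    using closure_of_image_closure_of[OF f(1) WX] F unfolding regular_closed_def by simp
  have "f w \<in> Y closure_of (Y interior_of ?G)" if w: "w \<in> ?W" for w
    unfolding in_closure_of
  proof (intro conjI allI impI)
    show "f w \<in> topspace Y" using w WX continuous_map_funspace[OF f(1)] by blast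
    fix N assume N: "f w \<in> N \<and> openin Y N"
    let ?W' = "?W \<inter> {x \<in> topspace X. f x \<in> N}"
    let ?I = "Y interior_of (Y closure_of (f ` ?W'))"
    have "openin X ?W'" using N f(1) by (intro openin_Int openin_continuous_map_preimage) auto
    moreover have "?W' \<noteq> {}" using w WX N by blast
    ultimately have "?I \<noteq> {}" using f continuous_skeletal_map_iff by blast
    moreover have "?I \<subseteq> Y closure_of (f ` ?W')" by (rule interior_of_subset)
    moreover have "Y closure_of (f ` ?W') \<subseteq> Y closure_of N" by (intro closure_of_mono) blast
    ultimately have "?I \<inter> N \<noteq> {}" using openin_Int_closure_of_eq_empty[of Y ?I N] by auto
    moreover have "?I \<subseteq> Y interior_of ?G" by (intro interior_of_mono closure_of_mono) blast
    ultimately show "\<exists>y. y \<in> Y interior_of ?G \<and> y \<in> N" by blast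
  qed
  then have "?G \<subseteq> Y closure_of (Y interior_of ?G)" by (intro closure_of_minimal) auto
  moreover have "Y closure_of (Y interior_of ?G) \<subseteq> ?G" by (simp add: closure_of_minimal interior_of_subset)
  ultimately show ?thesis unfolding G regular_closed_def by blast
qed

lemma skeletal_map_cong:
  assumes "\<And>x. x \<in> topspace X \<Longrightarrow> f x = g x" "skeletal_map X Y f"
  shows "skeletal_map X Y g"
proof -
  have "{x \<in> topspace X. g x \<in> V} = {x \<in> topspace X. f x \<in> V}" for V using assms(1) by auto
  moreover have "g \<in> topspace X \<rightarrow> topspace Y"
  proof
    fix x assume x: "x \<in> topspace X"
    then have "f x \<in> topspace Y" using assms(2) unfolding skeletal_map_def by blast
    then show "g x \<in> topspace Y" using assms(1)[OF x] by simp
  qed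
  ultimately show ?thesis using assms(2) unfolding skeletal_map_def by simp
qed

lemma continuous_skeletal_restrict_id:
  "continuous_map X X (\<lambda>x\<in>topspace X. x)" "skeletal_map X X (\<lambda>x\<in>topspace X. x)"
proof -
  have "skeletal_map X X (\<lambda>x. x)"
  proof -
    have "X interior_of (X closure_of ((\<lambda>x. x) ` W)) \<noteq> {}" if W: "openin X W" "W \<noteq> {}" for W
      using W interior_of_maximal[OF closure_of_subset[OF openin_subset[OF W(1)]] W(1)] by auto
    then show ?thesis using continuous_skeletal_map_iff[of X X "\<lambda>x. x"] by simp
  qed
  then show "skeletal_map X X (\<lambda>x\<in>topspace X. x)" by (rule skeletal_map_cong[rotated]) simp
  show "continuous_map X X (\<lambda>x\<in>topspace X. x)" by (rule continuous_map_eq[of X X "\<lambda>x. x"]) auto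
qed

lemma continuous_skeletal_compose:
  assumes "continuous_map X Y f" "skeletal_map X Y f" "continuous_map Y Z g" "skeletal_map Y Z g"
  shows "continuous_map X Z (compose (topspace X) g f)" "skeletal_map X Z (compose (topspace X) g f)"
  using continuous_map_eq[OF continuous_map_compose[OF assms(1,3)], of "compose (topspace X) g f"]
    skeletal_map_cong[OF _ skeletal_map_compose[OF assms], of "compose (topspace X) g f"]
  by (auto simp: compose_def)

section \<open>Skeletal maps and morphisms of local contact algebras\<close>

text \<open>The operation \<open>F \<mapsto> cl (f F)\<close> on regular closed sets, read through representations \<open>d\<close> of the source
  and \<open>e\<close> of the target. It is extensional, as morphisms are required to be.\<close>

definition closure_image :: "'b local_contact_alg \<Rightarrow> ('b \<Rightarrow> 'a set) \<Rightarrow> 'c topology \<Rightarrow> 'd local_contact_alg \<Rightarrow> ('d \<Rightarrow> 'c set) \<Rightarrow> ('a \<Rightarrow> 'c) \<Rightarrow> 'b \<Rightarrow> 'd" where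
  "closure_image A d Y B e f = (\<lambda>a\<in>carrier A. inv_into (carrier B) e (Y closure_of (f ` d a)))"

locale rc_representation_pair =
  src: rc_representation X A d + tgt: rc_representation Y B e
  for X :: "'a topology" and A :: "'b local_contact_alg" and d :: "'b \<Rightarrow> 'a set"
    and Y :: "'c topology" and B :: "'d local_contact_alg" and e :: "'d \<Rightarrow> 'c set"
begin

lemma src_subset: "a \<in> carrier A \<Longrightarrow> d a \<subseteq> topspace X"
  by (intro closedin_subset) simp

lemma tgt_subset: "b \<in> carrier B \<Longrightarrow> e b \<subseteq> topspace Y"
  by (intro closedin_subset) simp

lemma closure_image:
  assumes "continuous_map X Y f" "skeletal_map X Y f" "a \<in> carrier A"
  shows "closure_image A d Y B e f a \<in> carrier B" "e (closure_image A d Y B e f a) = Y closure_of (f ` d a)"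
proof -
  have "regular_closed Y (Y closure_of (f ` d a))"
    using assms by (intro regular_closed_closure_of_image) auto
  then have "Y closure_of (f ` d a) \<in> e ` carrier B"
    using tgt.ex_rep by blast
  then show "closure_image A d Y B e f a \<in> carrier B" "e (closure_image A d Y B e f a) = Y closure_of (f ` d a)"
    using assms(3) by (simp_all add: closure_image_def inv_into_into f_inv_into_f)
qed

lemma closure_image_eqI:
  assumes f: "continuous_map X Y f" "skeletal_map X Y f"
    and \<psi>: "\<psi> \<in> extensional (carrier A)" "\<And>a. a \<in> carrier A \<Longrightarrow> \<psi> a \<in> carrier B \<and> e (\<psi> a) = Y closure_of (f ` d a)"
  shows "closure_image A d Y B e f = \<psi>"
proof (rule extensionalityI[of _ "carrier A"])
  show "closure_image A d Y B e f a = \<psi> a" if "a \<in> carrier A" for a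
    using \<psi>(2)[OF that] closure_image[OF f that] tgt.d_inject by metis
qed (simp_all add: \<psi> closure_image_def)

text \<open>Only (EF3) needs a construction: if \<open>b\<close> lies below the closure of \<open>f (d a)\<close>, take the closure
  of the set of points in the interior of \<open>d a\<close> that \<open>f\<close> maps into the interior of \<open>e b\<close>; their images
  are dense in \<open>e b\<close>.\<close>

lemma ESkeLC_morphism_closure_image:
  assumes f: "continuous_map X Y f" "skeletal_map X Y f"
  shows "ESkeLC_morphism A B (closure_image A d Y B e f)"
proof -
  let ?\<psi> = "closure_image A d Y B e f"
  note cl = closure_image[OF f]
  have fd: "f ` d a \<subseteq> topspace Y" if "a \<in> carrier A" for a
    using src_subset[OF that] continuous_map_funspace[OF f(1)] by blast
  then have fd_cl: "f ` d a \<subseteq> e (?\<psi> a)" if "a \<in> carrier A" for a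
    using that closure_of_subset[of "f ` d a" Y] by (simp add: cl)
  have EF1: "?\<psi> a = \<bottom>\<^bsub>B\<^esub> \<longleftrightarrow> a = \<bottom>\<^bsub>A\<^esub>" if a: "a \<in> carrier A" for a
  proof -
    have "?\<psi> a = \<bottom>\<^bsub>B\<^esub> \<longleftrightarrow> e (?\<psi> a) = {}" using a by (simp add: tgt.d_eq_empty_iff cl(1))
    also have "\<dots> \<longleftrightarrow> d a = {}" using closure_of_eq_empty[OF fd[OF a]] a by (simp add: cl)
    finally show ?thesis using a by (simp add: src.d_eq_empty_iff)
  qed
  have EF2: "?\<psi> (\<Squnion>\<^bsub>A\<^esub>S) = \<Squnion>\<^bsub>B\<^esub>(?\<psi> ` S)" if S: "S \<subseteq> carrier A" for S
  proof -
    have "?\<psi> ` S \<subseteq> carrier B" using S cl(1) by blast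
    with S have Sc: "\<Squnion>\<^bsub>A\<^esub>S \<in> carrier A" "?\<psi> ` S \<subseteq> carrier B" "\<Squnion>\<^bsub>B\<^esub>(?\<psi> ` S) \<in> carrier B"
      by (simp_all only: src.sup_closed tgt.sup_closed)
    have UX: "\<Union>(d ` S) \<subseteq> topspace X" using S src_subset by blast
    have "e (?\<psi> (\<Squnion>\<^bsub>A\<^esub>S)) = Y closure_of (f ` \<Union>(d ` S))"
      unfolding cl(2)[OF Sc(1)] src.d_Sup[OF S] by (rule closure_of_image_closure_of[OF f(1) UX])
    also have "\<dots> = Y closure_of \<Union>(e ` ?\<psi> ` S)"
    proof
      show "Y closure_of (f ` \<Union>(d ` S)) \<subseteq> Y closure_of \<Union>(e ` ?\<psi> ` S)"
      proof (intro closure_of_mono subsetI)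
        fix y assume "y \<in> f ` \<Union>(d ` S)"
        then obtain a where a: "a \<in> S" "y \<in> f ` d a" by blast
        then have "y \<in> e (?\<psi> a)" using fd_cl[of a] S by blast
        with a show "y \<in> \<Union>(e ` ?\<psi> ` S)" by blast
      qed
      have "e (?\<psi> a) \<subseteq> Y closure_of (f ` \<Union>(d ` S))" if "a \<in> S" for a
      proof -
        have "a \<in> carrier A" using that S by blast
        then show ?thesis unfolding cl(2)[OF \<open>a \<in> carrier A\<close>] using that by (intro closure_of_mono image_mono) blast
      qed
      then show "Y closure_of \<Union>(e ` ?\<psi> ` S) \<subseteq> Y closure_of (f ` \<Union>(d ` S))"
        by (intro closure_of_minimal) auto
    qed
    also have "\<dots> = e (\<Squnion>\<^bsub>B\<^esub>(?\<psi> ` S))" by (simp add: tgt.d_Sup[OF Sc(2)])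
    finally show ?thesis using Sc(3) cl(1)[OF Sc(1)] tgt.d_inject[of "?\<psi> (\<Squnion>\<^bsub>A\<^esub>S)" "\<Squnion>\<^bsub>B\<^esub>(?\<psi> ` S)"] by blast
  qed
  have EF3: "\<exists>c\<in>carrier A. c \<sqsubseteq>\<^bsub>A\<^esub> a \<and> ?\<psi> c = b"
    if ab: "a \<in> carrier A" "b \<in> carrier B" "b \<sqsubseteq>\<^bsub>B\<^esub> ?\<psi> a" for a b
  proof -
    let ?W = "X interior_of (d a) \<inter> {x \<in> topspace X. f x \<in> Y interior_of (e b)}"
    have W: "openin X ?W" using f(1) by (intro openin_Int openin_continuous_map_preimage) auto
    then have WX: "?W \<subseteq> topspace X" by (rule openin_subset)
    obtain c where c: "c \<in> carrier A" "d c = X closure_of ?W"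
      using src.ex_rep[OF regular_closed_closure_of_open[OF W]] by blast
    have "d c \<subseteq> d a" unfolding c using ab(1) interior_of_subset[of X "d a"]
      by (intro closure_of_minimal) auto
    moreover have "e (?\<psi> c) = e b"
    proof -
      have ec: "e (?\<psi> c) = Y closure_of (f ` ?W)"
        unfolding cl(2)[OF c(1)] c(2) by (rule closure_of_image_closure_of[OF f(1) WX])
      have "f ` ?W \<subseteq> e b" using interior_of_subset[of Y "e b"] by blast
      then have 1: "e (?\<psi> c) \<subseteq> e b" unfolding ec using ab(2) by (intro closure_of_minimal) auto
      have "e b \<subseteq> Y closure_of (f ` d a)"
        using ab cl[OF ab(1)] tgt.le_iff by simp
      also have "\<dots> = Y closure_of (f ` (X interior_of (d a)))"
        using closure_of_image_closure_of[OF f(1) interior_of_subset_topspace] src.rc[OF ab(1)]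
        unfolding regular_closed_def by metis
      finally have "Y interior_of (e b) \<subseteq> Y interior_of (e b) \<inter> Y closure_of (f ` (X interior_of (d a)))"
        using interior_of_subset[of Y "e b"] by blast
      also have "\<dots> \<subseteq> Y closure_of (Y interior_of (e b) \<inter> f ` (X interior_of (d a)))"
        by (rule openin_Int_closure_of_subset) simp
      also have "\<dots> \<subseteq> Y closure_of (f ` ?W)"
        using interior_of_subset_topspace[of X "d a"] by (intro closure_of_mono) blast
      finally have "Y interior_of (e b) \<subseteq> e (?\<psi> c)" unfolding ec .
      then have "e b \<subseteq> e (?\<psi> c)"
        using regular_closed_subset_iff[of Y "e b" "e (?\<psi> c)"] ab(2) cl(1)[OF c(1)] by simp
      with 1 show ?thesis by blast
    qed
    ultimately show ?thesis
      using c ab cl(1)[OF c(1)] tgt.d_inject[of "?\<psi> c" b] src.le_iff[of c a] by blast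
  qed
  have EL4: "contact B (?\<psi> a) (?\<psi> b)" if ab: "a \<in> carrier A" "b \<in> carrier A" "contact A a b" for a b
  proof -
    obtain x where "x \<in> d a" "x \<in> d b" using ab src.contact_iff[of a b] by blast
    then have "f x \<in> e (?\<psi> a) \<inter> e (?\<psi> b)" using fd_cl[OF ab(1)] fd_cl[OF ab(2)] by blast
    then show ?thesis using ab(1,2) cl(1) tgt.contact_iff[of "?\<psi> a" "?\<psi> b"] by blast
  qed
  have EL5: "?\<psi> a \<in> bounded_elts B" if "a \<in> bounded_elts A" for a
  proof -
    have a: "a \<in> carrier A" "compactin X (d a)" using that by (auto simp: src.bounded_eq)
    have comp: "compactin Y (f ` d a)" using a f(1) by (intro image_compactin)
    then have "Y closure_of (f ` d a) = f ` d a"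
      by (intro closure_of_closedin compactin_imp_closedin[OF tgt.haus])
    then show ?thesis using comp a by (simp add: tgt.bounded_eq cl)
  qed
  have "?\<psi> \<in> carrier A \<rightarrow> carrier B" using cl(1) by blast
  then show ?thesis unfolding ESkeLC_morphism_def
    by (intro conjI ballI allI impI EF1 EF2 EF3 EL4 EL5) assumption+
qed

text \<open>If \<open>f x\<close> and \<open>g x\<close> differ, a small regular closed neighbourhood of \<open>x\<close> has images with separated
  closures.\<close>

lemma continuous_maps_eqI:
  assumes f: "continuous_map X Y f" and g: "continuous_map X Y g"
    and eq: "\<And>a. a \<in> carrier A \<Longrightarrow> Y closure_of (f ` d a) = Y closure_of (g ` d a)"
    and x: "x \<in> topspace X"
  shows "f x = g x"
proof (rule ccontr)
  assume ne: "f x \<noteq> g x"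
  have "f x \<in> topspace Y" "g x \<in> topspace Y" using x f g continuous_map_funspace by blast+
  with ne obtain V W where V: "openin Y V" "openin Y W" "f x \<in> V" "g x \<in> W" "disjnt V W"
    using tgt.haus unfolding Hausdorff_space_def by metis
  let ?P = "{x \<in> topspace X. f x \<in> V} \<inter> {x \<in> topspace X. g x \<in> W}"
  have "openin X ?P" using f g V by (intro openin_Int openin_continuous_map_preimage) auto
  moreover have "{x} \<subseteq> ?P" using x V by blast
  ultimately obtain a where a: "a \<in> bounded_elts A" "{x} \<subseteq> X interior_of (d a)" "d a \<subseteq> ?P"
    using src.rc_nbhd[of "{x}" ?P] x by auto
  then have ac: "a \<in> carrier A" by (simp add: src.bounded_eq)
  have "x \<in> d a" using a interior_of_subset[of X "d a"] by blast
  moreover have "f ` d a \<subseteq> topspace Y" using src_subset[OF ac] continuous_map_funspace[OF f] by blast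
  ultimately have "f x \<in> Y closure_of (f ` d a)" using closure_of_subset by blast
  also have "\<dots> = Y closure_of (g ` d a)" by (rule eq[OF ac])
  also have "\<dots> \<subseteq> Y closure_of W" using a by (intro closure_of_mono) blast
  finally have "V \<inter> Y closure_of W \<noteq> {}" using V by blast
  then show False using openin_Int_closure_of_eq_empty[OF V(1), of W] V(5) unfolding disjnt_def by blast
qed

text \<open>The point \<open>f x\<close> is the common point of the sets \<open>\<psi> F\<close>, for \<open>F\<close> a regular closed neighbourhood of
  \<open>x\<close>. These sets form a filter base of nonempty sets with a compact member, so they have a common
  point, and every open set around the set \<open>I x\<close> of common points contains some \<open>\<psi> F\<close>; the latter
  also yields continuity. Two points of \<open>I x\<close> would be interior to disjoint regular closed sets \<open>G\<close> and
  \<open>H\<close>. By (EF1)-(EF3) the unit of the source is the join of an element sent below \<open>G\<close> and one sent below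
  the complement of \<open>G\<close>, and similarly for \<open>H\<close>. By (EL4) the element sent below \<open>G\<close> and the one sent
  below \<open>H\<close> are disjoint, so \<open>x\<close> is interior to one of the other two, whose image avoids one of the
  points.\<close>

lemma ex_continuous_map_of_morphism:
  assumes \<psi>: "ESkeLC_morphism A B \<psi>"
  shows "\<exists>f. f \<in> extensional (topspace X) \<and> continuous_map X Y f \<and> skeletal_map X Y f \<and>
           (\<forall>a\<in>carrier A. e (\<psi> a) = Y closure_of (f ` d a))"
proof -
  have \<psi>c: "\<psi> a \<in> carrier B" if "a \<in> carrier A" for a
    using \<psi> that unfolding ESkeLC_morphism_def by blast
  have EF1: "e (\<psi> a) = {} \<longleftrightarrow> d a = {}" if "a \<in> carrier A" for a
    using \<psi> that \<psi>c[OF that] unfolding ESkeLC_morphism_def by (simp add: tgt.d_eq_empty_iff src.d_eq_empty_iff)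
  have EF2: "e (\<psi> (\<Squnion>\<^bsub>A\<^esub>S)) = Y closure_of \<Union>((\<lambda>a. e (\<psi> a)) ` S)" if S: "S \<subseteq> carrier A" for S
  proof -
    have "\<psi> (\<Squnion>\<^bsub>A\<^esub>S) = \<Squnion>\<^bsub>B\<^esub>(\<psi> ` S)" using \<psi> S unfolding ESkeLC_morphism_def by blast
    moreover have "\<psi> ` S \<subseteq> carrier B" using S \<psi>c by blast
    ultimately show ?thesis using tgt.d_Sup[of "\<psi> ` S"] by (simp add: image_image)
  qed
  have EF3: "\<exists>c\<in>carrier A. d c \<subseteq> d a \<and> e (\<psi> c) = G"
    if a: "a \<in> carrier A" and G: "regular_closed Y G" "G \<subseteq> e (\<psi> a)" for a G
  proof -
    obtain b where b: "b \<in> carrier B" "e b = G" using tgt.ex_rep[OF G(1)] by blast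
    then have "b \<sqsubseteq>\<^bsub>B\<^esub> \<psi> a" using G \<psi>c[OF a] by (simp add: tgt.le_iff)
    then obtain c where "c \<in> carrier A" "c \<sqsubseteq>\<^bsub>A\<^esub> a" "\<psi> c = b"
      using \<psi> a b(1) unfolding ESkeLC_morphism_def by blast
    then show ?thesis using b a src.le_iff[of _ a] by blast
  qed
  have EL4: "e (\<psi> a) \<inter> e (\<psi> b) \<noteq> {}" if "a \<in> carrier A" "b \<in> carrier A" "d a \<inter> d b \<noteq> {}" for a b
  proof -
    have "contact B (\<psi> a) (\<psi> b)" using that \<psi> src.contact_iff[of a b] unfolding ESkeLC_morphism_def by blast
    then show ?thesis using tgt.contact_iff[of "\<psi> a" "\<psi> b"] \<psi>c that(1,2) by blast
  qed
  have EL5: "compactin Y (e (\<psi> a))" if "a \<in> bounded_elts A" for a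
    using \<psi> that unfolding ESkeLC_morphism_def by (simp add: tgt.bounded_eq)
  have mono: "e (\<psi> a) \<subseteq> e (\<psi> b)" if ab: "a \<in> carrier A" "b \<in> carrier A" "d a \<subseteq> d b" for a b
  proof -
    have "d (\<Squnion>\<^bsub>A\<^esub>{a, b}) = d b"
      using ab src.d_Sup[of "{a, b}"] by (simp add: closure_of_closedin Un_absorb1)
    then have "\<Squnion>\<^bsub>A\<^esub>{a, b} = b" using ab src.d_inject[of "\<Squnion>\<^bsub>A\<^esub>{a, b}" b] by (simp add: src.sup_closed)
    then have "e (\<psi> b) = e (\<psi> a) \<union> e (\<psi> b)"
      using EF2[of "{a, b}"] ab \<psi>c by (simp add: closure_of_closedin)
    then show ?thesis by blast
  qed
  \<comment> \<open>The witnesses are the largest elements sent below \<open>G\<close> and below its complement. If they did not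
    cover \<open>X\<close>, then (EF3) would provide a nonzero element outside both that is sent below \<open>G\<close> or below
    the complement.\<close>
  have split: "\<exists>a\<in>carrier A. \<exists>a'\<in>carrier A. d a \<union> d a' = topspace X \<and> e (\<psi> a) \<subseteq> G \<and> e (\<psi> a') \<subseteq> topspace Y - Y interior_of G"
    if G: "regular_closed Y G" for G
  proof -
    define S where "S H = {c \<in> carrier A. e (\<psi> c) \<subseteq> H}" for H
    have sup: "\<Squnion>\<^bsub>A\<^esub>(S H) \<in> carrier A" "e (\<psi> (\<Squnion>\<^bsub>A\<^esub>(S H))) \<subseteq> H" "\<And>c. c \<in> S H \<Longrightarrow> d c \<subseteq> d (\<Squnion>\<^bsub>A\<^esub>(S H))"
      if "closedin Y H" for H
    proof -
      have SA: "S H \<subseteq> carrier A" by (auto simp: S_def)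
      then show "\<Squnion>\<^bsub>A\<^esub>(S H) \<in> carrier A" by simp
      show "e (\<psi> (\<Squnion>\<^bsub>A\<^esub>(S H))) \<subseteq> H" unfolding EF2[OF SA] using that by (intro closure_of_minimal) (auto simp: S_def)
      have "\<Union>(d ` S H) \<subseteq> topspace X" using SA src_subset by blast
      then show "d c \<subseteq> d (\<Squnion>\<^bsub>A\<^esub>(S H))" if "c \<in> S H" for c
        using that closure_of_subset unfolding src.d_Sup[OF SA] by blast
    qed
    let ?H = "topspace Y - Y interior_of G"
    have clo: "closedin Y G" "closedin Y ?H" using G by (auto simp: regular_closed_closedin)
    let ?a = "\<Squnion>\<^bsub>A\<^esub>(S G)" and ?a' = "\<Squnion>\<^bsub>A\<^esub>(S ?H)"
    have "d ?a \<union> d ?a' = topspace X"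
    proof (rule ccontr)
      assume "\<not> ?thesis"
      moreover have "d ?a \<union> d ?a' \<subseteq> topspace X" using sup(1) clo src_subset by blast
      ultimately obtain x where x: "x \<in> topspace X" "x \<notin> d ?a" "x \<notin> d ?a'" by blast
      have "openin X (topspace X - (d ?a \<union> d ?a'))" using sup(1) clo by (intro openin_diff closedin_Un) auto
      then obtain c where c: "c \<in> bounded_elts A" "{x} \<subseteq> X interior_of (d c)" "d c \<subseteq> topspace X - (d ?a \<union> d ?a')"
        using src.rc_nbhd[of "{x}" "topspace X - (d ?a \<union> d ?a')"] x by auto
      have cc: "c \<in> carrier A" using c by (simp add: src.bounded_eq)
      have xc: "x \<in> d c" using c interior_of_subset[of X "d c"] by blast
      let ?M = "regular_meet Y (e (\<psi> c)) G"
      obtain c' where c': "c' \<in> carrier A" "d c' \<subseteq> d c" "e (\<psi> c') = ?M"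
        using EF3[OF cc regular_closed_regular_meet regular_meet_subset(1)[OF tgt.rc[OF \<psi>c[OF cc]]], of G] by blast
      then have "c' \<in> S G" using regular_meet_subset(2)[OF G] by (auto simp: S_def)
      then have "d c' \<subseteq> d ?a" by (rule sup(3)[OF clo(1)])
      then have "d c' = {}" using c' c by blast
      then have "?M = {}" using EF1[OF c'(1)] c'(3) by metis
      then have "Y interior_of (e (\<psi> c)) \<inter> Y interior_of G = {}"
        unfolding regular_meet_def using closure_of_eq_empty[of "Y interior_of (e (\<psi> c)) \<inter> Y interior_of G" Y]
          interior_of_subset_topspace[of Y G] by blast
      then have "Y interior_of (e (\<psi> c)) \<subseteq> ?H" using interior_of_subset_topspace[of Y "e (\<psi> c)"] by blast
      then have "c \<in> S ?H" using regular_closed_subset_iff[of Y "e (\<psi> c)" ?H] clo cc \<psi>c[OF cc] by (simp add: S_def)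
      then have "d c \<subseteq> d ?a'" by (rule sup(3)[OF clo(2)])
      then show False using x xc by blast
    qed
    then show ?thesis using sup(1,2)[OF clo(1)] sup(1,2)[OF clo(2)] by blast
  qed
  define nb where "nb x = {a \<in> carrier A. x \<in> X interior_of (d a)}" for x
  define I where "I x = (\<Inter>a\<in>nb x. e (\<psi> a))" for x
  have ex_nb: "\<exists>a\<in>nb x. a \<in> bounded_elts A \<and> d a \<subseteq> W" if W: "openin X W" "x \<in> W" for x W
  proof -
    have "x \<in> topspace X" using W openin_subset by blast
    then obtain b where "b \<in> bounded_elts A" "{x} \<subseteq> X interior_of (d b)" "d b \<subseteq> W"
      using src.rc_nbhd[of "{x}" W] W by auto
    then show ?thesis by (auto simp: nb_def src.bounded_eq)
  qed
  have nb_ne: "e (\<psi> a) \<noteq> {}" if "a \<in> nb x" for a x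
    using that EF1[of a] interior_of_subset[of X "d a"] by (auto simp: nb_def)
  \<comment> \<open>Compactness; taking \<open>N = {}\<close> shows that \<open>I x\<close> is nonempty.\<close>
  have small: "\<exists>a\<in>nb x. e (\<psi> a) \<subseteq> N" if x: "x \<in> topspace X" and N: "openin Y N" "I x \<subseteq> N" for x N
  proof -
    obtain a0 where a0: "a0 \<in> nb x" "a0 \<in> bounded_elts A" using ex_nb[of "topspace X" x] x by auto
    define \<C> where "\<C> = insert (topspace Y - N) ((\<lambda>a. e (\<psi> a)) ` nb x)"
    have "\<forall>C\<in>\<C>. closedin Y C" using N \<psi>c by (auto simp: nb_def \<C>_def)
    moreover have "e (\<psi> a0) \<inter> \<Inter>\<C> = {}" using N unfolding I_def \<C>_def by auto
    ultimately have "\<not> (\<forall>\<F>. finite \<F> \<and> \<F> \<subseteq> \<C> \<longrightarrow> e (\<psi> a0) \<inter> \<Inter>\<F> \<noteq> {})"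
      using EL5[OF a0(2), unfolded compactin_fip, THEN conjunct2, THEN spec, of \<C>] by simp
    then obtain \<F> where \<F>: "finite \<F>" "\<F> \<subseteq> \<C>" "e (\<psi> a0) \<inter> \<Inter>\<F> = {}"
      by blast
    then have "finite (\<F> - {topspace Y - N})" "\<F> - {topspace Y - N} \<subseteq> (\<lambda>a. e (\<psi> a)) ` nb x"
      by (auto simp: \<C>_def)
    then obtain T where T: "finite T" "T \<subseteq> nb x" "\<F> - {topspace Y - N} = (\<lambda>a. e (\<psi> a)) ` T"
      using finite_subset_image[of "\<F> - {topspace Y - N}" "\<lambda>a. e (\<psi> a)" "nb x"] by metis
    let ?W = "\<Inter>((\<lambda>a. X interior_of (d a)) ` insert a0 T)"
    have "openin X ?W" using T by (intro openin_Inter) auto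
    moreover have "x \<in> ?W" using a0 T by (auto simp: nb_def)
    ultimately obtain a where a: "a \<in> nb x" "d a \<subseteq> ?W" using ex_nb[of ?W x] by metis
    have le: "e (\<psi> a) \<subseteq> e (\<psi> t)" if "t \<in> insert a0 T" for t
    proof (rule mono)
      show "a \<in> carrier A" "t \<in> carrier A" using a a0 T that by (auto simp: nb_def)
      show "d a \<subseteq> d t" using a that interior_of_subset[of X "d t"] by blast
    qed
    have "e (\<psi> a) \<inter> (topspace Y - N) \<subseteq> e (\<psi> a0) \<inter> \<Inter>\<F>"
    proof -
      have "e (\<psi> a) \<inter> (topspace Y - N) \<subseteq> F" if F: "F \<in> \<F>" for F
      proof (cases "F = topspace Y - N")
        case False
        then have "F \<in> (\<lambda>a. e (\<psi> a)) ` T" using F T(3) by blast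
        then obtain t where "t \<in> T" "F = e (\<psi> t)" by blast
        then show ?thesis using le[of t] by blast
      qed simp
      then show ?thesis using le[of a0] by blast
    qed
    moreover have "e (\<psi> a) \<subseteq> topspace Y" using a tgt_subset[OF \<psi>c[of a]] by (simp add: nb_def)
    ultimately have "e (\<psi> a) \<subseteq> N" using \<F>(3) by blast
    then show ?thesis using a by blast
  qed
  have ne: "I x \<noteq> {}" if "x \<in> topspace X" for x
    using small[OF that, of "{}"] nb_ne by (metis empty_subsetI openin_empty subset_empty)
  have sub: "I x \<subseteq> e (\<psi> a)" if "a \<in> nb x" for x a
    using that unfolding I_def by blast
  have IY: "I x \<subseteq> topspace Y" if "x \<in> topspace X" for x
  proof -
    obtain a where a: "a \<in> nb x" using ex_nb[of "topspace X" x] \<open>x \<in> topspace X\<close> by auto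
    then have "a \<in> carrier A" by (simp add: nb_def)
    then show ?thesis using sub[OF a] tgt_subset[OF \<psi>c] by blast
  qed
  have uniq: "y = z" if x: "x \<in> topspace X" and y: "y \<in> I x" and z: "z \<in> I x" for x y z
  proof (rule ccontr)
    assume ne: "y \<noteq> z"
    have yz: "y \<in> topspace Y" "z \<in> topspace Y" using y z IY[OF x] by blast+
    with ne obtain V W where V: "openin Y V" "openin Y W" "y \<in> V" "z \<in> W" "disjnt V W"
      using tgt.haus unfolding Hausdorff_space_def by metis
    obtain g where g: "g \<in> bounded_elts B" "{y} \<subseteq> Y interior_of (e g)" "e g \<subseteq> V"
      using tgt.rc_nbhd[of "{y}" V] V yz by auto
    obtain h where h: "h \<in> bounded_elts B" "{z} \<subseteq> Y interior_of (e h)" "e h \<subseteq> W"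
      using tgt.rc_nbhd[of "{z}" W] V yz by auto
    have gh: "regular_closed Y (e g)" "regular_closed Y (e h)" using g h by (auto simp: tgt.bounded_eq)
    obtain a a' where a: "a \<in> carrier A" "a' \<in> carrier A" "d a \<union> d a' = topspace X" "e (\<psi> a) \<subseteq> e g"
        "e (\<psi> a') \<subseteq> topspace Y - Y interior_of (e g)" using split[OF gh(1)] by blast
    obtain b b' where b: "b \<in> carrier A" "b' \<in> carrier A" "d b \<union> d b' = topspace X" "e (\<psi> b) \<subseteq> e h"
        "e (\<psi> b') \<subseteq> topspace Y - Y interior_of (e h)" using split[OF gh(2)] by blast
    have disj: "d a \<inter> d b = {}" using EL4[OF a(1) b(1)] a(4) b(4) g(3) h(3) V(5) unfolding disjnt_def by blast
    have key: "w \<notin> I x" if "c \<in> carrier A" "c' \<in> carrier A" "d c \<union> d c' = topspace X" "x \<notin> d c"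
        "e (\<psi> c') \<subseteq> topspace Y - Y interior_of K" "w \<in> Y interior_of K" for c c' w K
    proof -
      have "topspace X - d c \<subseteq> X interior_of (d c')" using that by (intro interior_of_maximal openin_diff) auto
      then have "c' \<in> nb x" using that x by (auto simp: nb_def)
      then show ?thesis using sub[of c' x] that by blast
    qed
    show False
    proof (cases "x \<in> d a")
      case True
      then have "x \<notin> d b" using disj by blast
      then show False using key[OF b(1,2,3) _ b(5)] z h(2) by blast
    next
      case False
      then show False using key[OF a(1,2,3) _ a(5)] y g(2) by blast
    qed
  qed
  define f where "f = (\<lambda>x\<in>topspace X. SOME y. y \<in> I x)"
  have fI: "f x \<in> I x" if "x \<in> topspace X" for x
    using ne[OF that] that by (simp add: f_def some_in_eq)
  have I: "I x = {f x}" if "x \<in> topspace X" for x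
    using fI[OF that] uniq[OF that] by blast
  have cont: "continuous_map X Y f"
    unfolding continuous_map_def
  proof (intro conjI allI impI)
    show "f \<in> topspace X \<rightarrow> topspace Y"
    proof
      fix x assume "x \<in> topspace X"
      then show "f x \<in> topspace Y" using fI[of x] IY[of x] by blast
    qed
    fix N assume N: "openin Y N"
    show "openin X {x \<in> topspace X. f x \<in> N}"
    proof (subst openin_subopen, intro ballI)
      fix x assume "x \<in> {x \<in> topspace X. f x \<in> N}"
      then have x: "x \<in> topspace X" "f x \<in> N" by auto
      then obtain a where a: "a \<in> nb x" "e (\<psi> a) \<subseteq> N" using small[OF x(1) N] I[OF x(1)] by auto
      have "X interior_of (d a) \<subseteq> {x \<in> topspace X. f x \<in> N}"
      proof
        fix x' assume x': "x' \<in> X interior_of (d a)"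
        then have "x' \<in> topspace X" using interior_of_subset_topspace by fastforce
        moreover have "a \<in> nb x'" using x' a by (auto simp: nb_def)
        ultimately show "x' \<in> {x \<in> topspace X. f x \<in> N}" using fI[of x'] sub[of a x'] a(2) by blast
      qed
      then show "\<exists>T. openin X T \<and> x \<in> T \<and> T \<subseteq> {x \<in> topspace X. f x \<in> N}"
        using a by (intro exI[of _ "X interior_of (d a)"]) (auto simp: nb_def)
    qed
  qed
  have eq: "e (\<psi> a) = Y closure_of (f ` d a)" if a: "a \<in> carrier A" for a
  proof
    have int: "f ` (X interior_of (d a)) \<subseteq> e (\<psi> a)"
    proof
      fix y assume "y \<in> f ` (X interior_of (d a))"
      then obtain x where x: "x \<in> X interior_of (d a)" "y = f x" by blast
      then have "x \<in> topspace X" using interior_of_subset_topspace by fastforce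
      moreover have "a \<in> nb x" using x a by (auto simp: nb_def)
      ultimately show "y \<in> e (\<psi> a)" using x(2) fI[of x] sub[of a x] by blast
    qed
    have "Y closure_of (f ` d a) = Y closure_of (f ` (X interior_of (d a)))"
      using closure_of_image_closure_of[OF cont interior_of_subset_topspace] src.rc[OF a]
      unfolding regular_closed_def by metis
    also have "\<dots> \<subseteq> e (\<psi> a)" using int \<psi>c[OF a] by (intro closure_of_minimal) auto
    finally show "Y closure_of (f ` d a) \<subseteq> e (\<psi> a)" .
    show "e (\<psi> a) \<subseteq> Y closure_of (f ` d a)"
    proof (rule ccontr)
      assume "\<not> ?thesis"
      then have "\<not> Y interior_of (e (\<psi> a)) \<subseteq> Y closure_of (f ` d a)"
        using regular_closed_subset_iff[OF tgt.rc[OF \<psi>c[OF a]]] by simp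
      then obtain y where y: "y \<in> Y interior_of (e (\<psi> a)) - Y closure_of (f ` d a)" by blast
      moreover have "openin Y (Y interior_of (e (\<psi> a)) - Y closure_of (f ` d a))" by (intro openin_diff) auto
      moreover have "y \<in> topspace Y" using y interior_of_subset_topspace by fastforce
      ultimately obtain g where g: "g \<in> bounded_elts B" "{y} \<subseteq> Y interior_of (e g)"
          "e g \<subseteq> Y interior_of (e (\<psi> a)) - Y closure_of (f ` d a)"
        using tgt.rc_nbhd[of "{y}" "Y interior_of (e (\<psi> a)) - Y closure_of (f ` d a)"] by auto
      have "regular_closed Y (e g)" using g by (auto simp: tgt.bounded_eq)
      moreover have "e g \<subseteq> e (\<psi> a)" using g interior_of_subset[of Y "e (\<psi> a)"] by blast
      ultimately obtain c where c: "c \<in> carrier A" "d c \<subseteq> d a" "e (\<psi> c) = e g" using EF3[OF a] by blast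
      have "y \<in> e g" using g(2) interior_of_subset[of Y "e g"] by blast
      then have "d c \<noteq> {}" using EF1[OF c(1)] c(3) by auto
      then have "X interior_of (d c) \<noteq> {}" using src.rc[OF c(1)] unfolding regular_closed_def by force
      then obtain x where x: "x \<in> X interior_of (d c)" by blast
      then have xX: "x \<in> topspace X" using interior_of_subset_topspace by fastforce
      have "c \<in> nb x" using x c by (auto simp: nb_def)
      then have "f x \<in> e g" using fI[OF xX] sub[of c x] c(3) by blast
      moreover have "x \<in> d a" using x c interior_of_subset[of X "d c"] by blast
      moreover have "f ` d a \<subseteq> topspace Y" using src_subset[OF a] continuous_map_funspace[OF cont] by blast
      ultimately show False using closure_of_subset[of "f ` d a" Y] g(3) by blast
    qed
  qed
  have "skeletal_map X Y f"
    unfolding continuous_skeletal_map_iff[OF cont]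
  proof (intro allI impI)
    fix W assume W: "openin X W" "W \<noteq> {}"
    obtain c where c: "c \<in> carrier A" "d c = X closure_of W"
      using src.ex_rep[OF regular_closed_closure_of_open[OF W(1)]] by blast
    have "d c \<noteq> {}" unfolding c using W closure_of_eq_empty openin_subset by metis
    then have "e (\<psi> c) \<noteq> {}" using EF1[OF c(1)] by simp
    then have "Y interior_of (e (\<psi> c)) \<noteq> {}" using tgt.rc[OF \<psi>c[OF c(1)]] unfolding regular_closed_def by force
    moreover have "e (\<psi> c) = Y closure_of (f ` W)"
      unfolding eq[OF c(1)] c(2) by (rule closure_of_image_closure_of[OF cont openin_subset[OF W(1)]])
    ultimately show "Y interior_of (Y closure_of (f ` W)) \<noteq> {}" by simp
  qed
  moreover have "f \<in> extensional (topspace X)" unfolding f_def by (rule restrict_extensional)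
  ultimately show ?thesis using cont eq by (intro exI[of _ f] conjI ballI)
qed

end

lemma closure_image_restrict_id:
  assumes "rc_representation X A d"
  shows "closure_image A d X A d (\<lambda>x\<in>topspace X. x) = (\<lambda>a\<in>carrier A. a)"
proof -
  interpret rc_representation_pair X A d X A d using assms by (simp add: rc_representation_pair_def)
  show ?thesis
  proof (rule closure_image_eqI[OF continuous_skeletal_restrict_id])
    fix a assume a: "a \<in> carrier A"
    have "(\<lambda>x\<in>topspace X. x) ` d a = d a" using src_subset[OF a] by (force simp: image_iff)
    then show "(\<lambda>a\<in>carrier A. a) a \<in> carrier A \<and> d ((\<lambda>a\<in>carrier A. a) a) = X closure_of ((\<lambda>x\<in>topspace X. x) ` d a)"
      using a by (simp add: closure_of_closedin)
  qed simp
qed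

lemma closure_image_compose:
  assumes "rc_representation X A d" "rc_representation Y B e" "rc_representation Z C k"
    and f: "continuous_map X Y f" "skeletal_map X Y f" and g: "continuous_map Y Z g" "skeletal_map Y Z g"
  shows "closure_image A d Z C k (compose (topspace X) g f) =
    compose (carrier A) (closure_image B e Z C k g) (closure_image A d Y B e f)"
proof -
  interpret XZ: rc_representation_pair X A d Z C k using assms by (simp add: rc_representation_pair_def)
  interpret XY: rc_representation_pair X A d Y B e using assms by (simp add: rc_representation_pair_def)
  interpret YZ: rc_representation_pair Y B e Z C k using assms by (simp add: rc_representation_pair_def)
  show ?thesis
  proof (rule XZ.closure_image_eqI[OF continuous_skeletal_compose[OF f g]])
    fix a assume a: "a \<in> carrier A"
    have sub: "f ` d a \<subseteq> topspace Y" using XZ.src_subset[OF a] continuous_map_funspace[OF f(1)] by blast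
    have im: "compose (topspace X) g f ` d a = g ` f ` d a"
      using XZ.src_subset[OF a] unfolding compose_def image_image by (intro image_cong) auto
    note 1 = XY.closure_image[OF f a]
    note 2 = YZ.closure_image[OF g 1(1)]
    have "k (closure_image B e Z C k g (closure_image A d Y B e f a)) = Z closure_of (compose (topspace X) g f ` d a)"
      unfolding 2(2) 1(2) im by (rule closure_of_image_closure_of[OF g(1) sub])
    then show "compose (carrier A) (closure_image B e Z C k g) (closure_image A d Y B e f) a \<in> carrier C \<and>
        k (compose (carrier A) (closure_image B e Z C k g) (closure_image A d Y B e f) a) =
        Z closure_of (compose (topspace X) g f ` d a)"
      using 2(1) a by (simp add: compose_def)
  qed (simp add: compose_def)
qed

text \<open>The two morphisms induced by the identity map are mutually inverse, by functoriality.\<close>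

lemma isomorphism_of_representations:
  assumes A: "rc_representation X A d" "A \<in> Obj (ESkeLC U)" and B: "rc_representation X B e" "B \<in> Obj (ESkeLC U)"
  shows "\<exists>t. isomorphism (ESkeLC U) A B t"
proof -
  interpret AB: rc_representation_pair X A d X B e using assms by (simp add: rc_representation_pair_def)
  interpret BA: rc_representation_pair X B e X A d using assms by (simp add: rc_representation_pair_def)
  let ?i = "\<lambda>x\<in>topspace X. x"
  note i = continuous_skeletal_restrict_id[of X]
  let ?t = "closure_image A d X B e ?i" and ?s = "closure_image B e X A d ?i"
  have "compose (topspace X) ?i ?i = ?i" by (rule compose_Id) auto
  then have "compose (carrier A) ?s ?t = (\<lambda>a\<in>carrier A. a)" "compose (carrier B) ?t ?s = (\<lambda>b\<in>carrier B. b)"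
    using closure_image_compose[OF A(1) B(1) A(1) i i] closure_image_compose[OF B(1) A(1) B(1) i i]
      closure_image_restrict_id[OF A(1)] closure_image_restrict_id[OF B(1)] by simp_all
  moreover have "?t \<in> Hom (ESkeLC U) A B" "?s \<in> Hom (ESkeLC U) B A"
    using AB.ESkeLC_morphism_closure_image[OF i] BA.ESkeLC_morphism_closure_image[OF i]
    by (simp_all add: ESkeLC_def closure_image_def)
  ultimately have "isomorphism (ESkeLC U) A B ?t"
    unfolding isomorphism_def by (auto simp: ESkeLC_def)
  then show ?thesis by (rule exI[of _ ?t])
qed

section \<open>Ultrafilters and clusters\<close>

context boolean_lattice
begin

definition ultrafilter :: "'a set \<Rightarrow> bool" where
  "ultrafilter u \<longleftrightarrow> u \<subseteq> carrier L \<and> \<top> \<in> u \<and> \<bottom> \<notin> u \<and>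
    (\<forall>x\<in>u. \<forall>y\<in>carrier L. x \<sqsubseteq> y \<longrightarrow> y \<in> u) \<and> (\<forall>x\<in>u. \<forall>y\<in>u. x \<sqinter> y \<in> u) \<and>
    (\<forall>x\<in>carrier L. x \<in> u \<or> complement L x \<in> u)"

lemma
  assumes "ultrafilter u"
  shows ultrafilter_carrier: "x \<in> u \<Longrightarrow> x \<in> carrier L"
    and ultrafilter_not_bottom: "\<bottom> \<notin> u"
    and ultrafilter_upward: "\<lbrakk>x \<in> u; y \<in> carrier L; x \<sqsubseteq> y\<rbrakk> \<Longrightarrow> y \<in> u"
    and ultrafilter_meet: "\<lbrakk>x \<in> u; y \<in> u\<rbrakk> \<Longrightarrow> x \<sqinter> y \<in> u"
    and ultrafilter_complement: "x \<in> carrier L \<Longrightarrow> x \<in> u \<or> complement L x \<in> u"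
  using assms unfolding ultrafilter_def by blast+

text \<open>By Zorn's lemma there is a maximal filter \<open>M\<close> containing \<open>S\<close> and disjoint from \<open>I\<close>. It is an
  ultrafilter: if neither \<open>x\<close> nor its complement were in \<open>M\<close>, maximality would give \<open>m\<close> and \<open>n\<close> in
  \<open>M\<close> such that the meets of \<open>m\<close> with \<open>x\<close> and of \<open>n\<close> with the complement of \<open>x\<close> lie in \<open>I\<close>, and then
  the meet of \<open>m\<close> and \<open>n\<close> would lie in \<open>I\<close> as well.\<close>

lemma ultrafilter_avoiding_ideal:
  assumes I: "lattice_ideal L I" and S: "S \<subseteq> carrier L" "S \<noteq> {}" "S \<inter> I = {}"
    and meet: "\<And>x y. \<lbrakk>x \<in> S; y \<in> S\<rbrakk> \<Longrightarrow> x \<sqinter> y \<in> S"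
  shows "\<exists>u. ultrafilter u \<and> S \<subseteq> u \<and> u \<inter> I = {}"
proof -
  have Ic: "x \<in> carrier L" if "x \<in> I" for x using I that unfolding lattice_ideal_def by blast
  have Idown: "y \<in> I" if "x \<in> I" "y \<in> carrier L" "y \<sqsubseteq> x" for x y
    using I that unfolding lattice_ideal_def by blast
  have Ijoin: "x \<squnion> y \<in> I" if "x \<in> I" "y \<in> I" for x y
    using I that unfolding lattice_ideal_def by blast
  define up where "up B = {y \<in> carrier L. \<exists>b\<in>B. b \<sqsubseteq> y}" for B
  define filt where "filt F \<longleftrightarrow> F \<subseteq> carrier L \<and> up F \<subseteq> F \<and> (\<forall>x\<in>F. \<forall>y\<in>F. x \<sqinter> y \<in> F)" for F
  have filt_up: "filt (up B)" "B \<subseteq> up B" if B: "B \<subseteq> carrier L" "\<And>x y. x \<in> B \<Longrightarrow> y \<in> B \<Longrightarrow> \<exists>z\<in>B. z \<sqsubseteq> x \<and> z \<sqsubseteq> y" for B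
  proof -
    have "y \<in> up B" if y: "y \<in> up (up B)" for y
    proof -
      obtain b x where "b \<in> B" "b \<sqsubseteq> x" "x \<sqsubseteq> y" "x \<in> carrier L" "y \<in> carrier L" using y unfolding up_def by blast
      then show ?thesis unfolding up_def using B(1) le_trans[of b x y] by blast
    qed
    moreover have "x \<sqinter> y \<in> up B" if x: "x \<in> up B" and y: "y \<in> up B" for x y
    proof -
      obtain b c where b: "b \<in> B" "b \<sqsubseteq> x" "x \<in> carrier L" "c \<in> B" "c \<sqsubseteq> y" "y \<in> carrier L"
        using x y unfolding up_def by blast
      then obtain z where z: "z \<in> B" "z \<sqsubseteq> b" "z \<sqsubseteq> c" using B(2) by blast
      have c: "z \<in> carrier L" "b \<in> carrier L" "c \<in> carrier L" using b z B by blast+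
      have "z \<sqsubseteq> x" "z \<sqsubseteq> y" using le_trans[of z b x] le_trans[of z c y] b z c by blast+
      then have "z \<sqsubseteq> x \<sqinter> y" using b c by (intro meet_le) auto
      then show ?thesis unfolding up_def using b z by auto
    qed
    ultimately show "filt (up B)" unfolding filt_def by (auto simp: up_def)
    show "B \<subseteq> up B"
    proof
      fix b assume b: "b \<in> B"
      then have "b \<in> carrier L" using B(1) by blast
      then show "b \<in> up B" unfolding up_def using b le_refl by blast
    qed
  qed
  have S_dir: "\<exists>z\<in>S. z \<sqsubseteq> x \<and> z \<sqsubseteq> y" if "x \<in> S" "y \<in> S" for x y
  proof -
    have "x \<in> carrier L" "y \<in> carrier L" using that S by blast+
    then show ?thesis using meet[OF that] meet_left[of x y] meet_right[of x y] by blast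
  qed
  define \<F> where "\<F> = {F. filt F \<and> S \<subseteq> F \<and> F \<inter> I = {}}"
  have "up S \<inter> I = {}" using S(1,3) Idown unfolding up_def by blast
  then have "up S \<in> \<F>" using filt_up[OF S(1) S_dir] unfolding \<F>_def by blast
  then have "\<F> \<noteq> {}" by blast
  moreover have "\<Union>\<C> \<in> \<F>" if C: "\<C> \<noteq> {}" "subset.chain \<F> \<C>" for \<C>
  proof -
    have F: "filt F" "S \<subseteq> F" "F \<inter> I = {}" if "F \<in> \<C>" for F
      using that C(2) unfolding subset.chain_def \<F>_def by blast+
    have "x \<sqinter> y \<in> \<Union>\<C>" if x: "F \<in> \<C>" "x \<in> F" and y: "G \<in> \<C>" "y \<in> G" for x y F G
    proof -
      have "F \<subseteq> G \<or> G \<subseteq> F" using C(2) x y unfolding subset.chain_def by blast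
      then have "x \<sqinter> y \<in> F \<or> x \<sqinter> y \<in> G" using F(1)[OF x(1)] F(1)[OF y(1)] x y unfolding filt_def by blast
      then show ?thesis using x y by blast
    qed
    moreover have "\<Union>\<C> \<subseteq> carrier L" using F(1) unfolding filt_def by blast
    moreover have "up (\<Union>\<C>) \<subseteq> \<Union>\<C>"
    proof
      fix y assume "y \<in> up (\<Union>\<C>)"
      then obtain F where F': "F \<in> \<C>" "y \<in> up F" unfolding up_def by blast
      then show "y \<in> \<Union>\<C>" using F(1)[OF F'(1)] unfolding filt_def by blast
    qed
    ultimately have "filt (\<Union>\<C>)" unfolding filt_def by blast
    moreover have "S \<subseteq> \<Union>\<C>" using C(1) F(2) by blast
    moreover have "\<Union>\<C> \<inter> I = {}" using F(3) by blast
    ultimately show ?thesis unfolding \<F>_def by blast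
  qed
  ultimately obtain M where M: "M \<in> \<F>" and max: "\<And>F. F \<in> \<F> \<Longrightarrow> M \<subseteq> F \<Longrightarrow> F = M"
    using subset_Zorn_nonempty[of \<F>] by metis
  have Mf: "M \<subseteq> carrier L" "up M \<subseteq> M" "S \<subseteq> M" "M \<inter> I = {}" and Mm: "\<And>x y. x \<in> M \<Longrightarrow> y \<in> M \<Longrightarrow> x \<sqinter> y \<in> M"
    using M unfolding \<F>_def filt_def by blast+
  have Mup: "y \<in> M" if "x \<in> M" "y \<in> carrier L" "x \<sqsubseteq> y" for x y
    using that Mf(2) unfolding up_def by blast
  obtain s where s: "s \<in> M" using S Mf by blast
  \<comment> \<open>If neither \<open>x\<close> nor its complement could be added, then both adjunctions would meet \<open>I\<close>.\<close>
  have adj: "\<exists>m\<in>M. m \<sqinter> x \<in> I" if x: "x \<in> carrier L" "x \<notin> M" for x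
  proof (rule ccontr)
    assume no: "\<not> ?thesis"
    let ?B = "(\<lambda>m. m \<sqinter> x) ` M"
    have B: "?B \<subseteq> carrier L" using x Mf by auto
    have mono: "(m \<sqinter> n) \<sqinter> x \<sqsubseteq> m \<sqinter> x" "(m \<sqinter> n) \<sqinter> x \<sqsubseteq> n \<sqinter> x" if "m \<in> M" "n \<in> M" for m n
    proof -
      have c: "m \<in> carrier L" "n \<in> carrier L" using that Mf by blast+
      have 1: "(m \<sqinter> n) \<sqinter> x \<sqsubseteq> m \<sqinter> n" "(m \<sqinter> n) \<sqinter> x \<sqsubseteq> x" "m \<sqinter> n \<sqsubseteq> m" "m \<sqinter> n \<sqsubseteq> n"
        using c x(1) by (auto intro: meet_left meet_right)
      then have "(m \<sqinter> n) \<sqinter> x \<sqsubseteq> m" "(m \<sqinter> n) \<sqinter> x \<sqsubseteq> n"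
        using c x(1) le_trans[OF 1(1,3)] le_trans[OF 1(1,4)] by auto
      then show "(m \<sqinter> n) \<sqinter> x \<sqsubseteq> m \<sqinter> x" "(m \<sqinter> n) \<sqinter> x \<sqsubseteq> n \<sqinter> x"
        using 1(2) c x(1) by (auto intro!: meet_le)
    qed
    have dir: "\<exists>z\<in>?B. z \<sqsubseteq> y \<and> z \<sqsubseteq> y'" if yy: "y \<in> ?B" "y' \<in> ?B" for y y'
    proof -
      obtain m n where mn: "m \<in> M" "n \<in> M" "y = m \<sqinter> x" "y' = n \<sqinter> x" using yy by blast
      have "(m \<sqinter> n) \<sqinter> x \<in> ?B" using Mm[OF mn(1,2)] by (rule imageI)
      then show ?thesis using mono[OF mn(1,2)] mn(3,4) by blast
    qed
    have "up ?B \<inter> I = {}" using no B Idown unfolding up_def by blast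
    moreover have sub: "M \<subseteq> up ?B"
    proof
      fix m assume m: "m \<in> M"
      then have "m \<in> carrier L" using Mf by blast
      then show "m \<in> up ?B" unfolding up_def using m x(1) meet_left[of m x] by blast
    qed
    ultimately have "up ?B \<in> \<F>" using filt_up(1)[OF B dir] Mf(3) unfolding \<F>_def by blast
    then have "up ?B = M" using max sub by blast
    moreover have "x \<in> up ?B"
      using s Mf(1) x(1) meet_right[of s x] unfolding up_def by blast
    ultimately show False using x by blast
  qed
  have "x \<in> M \<or> complement L x \<in> M" if x: "x \<in> carrier L" for x
  proof (rule ccontr)
    assume no: "\<not> ?thesis"
    have x': "complement L x \<in> carrier L" using x by (rule complement_closed)
    obtain m where m: "m \<in> M" "m \<sqinter> x \<in> I" using adj[OF x] no by blast
    obtain n where n: "n \<in> M" "n \<sqinter> complement L x \<in> I" using adj[OF x'] no by blast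
    have c: "m \<in> carrier L" "n \<in> carrier L" using m n Mf by blast+
    have "(m \<sqinter> n) \<sqinter> x \<sqsubseteq> m \<sqinter> x"
      using c x le_trans[OF meet_left[of "m \<sqinter> n" x] meet_left[of m n]] by (intro meet_le) (auto intro: meet_right)
    then have 1: "(m \<sqinter> n) \<sqinter> x \<in> I" using Idown[OF m(2)] c x by simp
    have "(m \<sqinter> n) \<sqinter> complement L x \<sqsubseteq> n \<sqinter> complement L x"
      using c x' le_trans[OF meet_left[of "m \<sqinter> n" "complement L x"] meet_right[of m n]] by (intro meet_le) (auto intro: meet_right)
    then have "(m \<sqinter> n) \<sqinter> complement L x \<in> I" using Idown[OF n(2)] c x' by simp
    with 1 have "m \<sqinter> n \<in> I" using Ijoin split_by_complement[of "m \<sqinter> n" x] c x by fastforce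
    then show False using Mm[OF m(1) n(1)] Mf by blast
  qed
  moreover have "\<top> \<in> M" using Mup[OF s] s Mf by auto
  moreover have "\<bottom> \<notin> M" using I Mf unfolding lattice_ideal_def by blast
  ultimately have "ultrafilter M" unfolding ultrafilter_def using Mf(1) Mup Mm by blast
  then show ?thesis using Mf by blast
qed

end

context local_contact_algebra
begin

lemma bounded_carrier: "a \<in> bounded_elts L \<Longrightarrow> a \<in> carrier L"
  using ideal unfolding lattice_ideal_def by blast

lemma bounded_downward: "\<lbrakk>a \<in> bounded_elts L; b \<in> carrier L; b \<sqsubseteq> a\<rbrakk> \<Longrightarrow> b \<in> bounded_elts L"
  using ideal unfolding lattice_ideal_def by blast

lemma bounded_join: "\<lbrakk>a \<in> bounded_elts L; b \<in> bounded_elts L\<rbrakk> \<Longrightarrow> a \<squnion> b \<in> bounded_elts L"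
  using ideal unfolding lattice_ideal_def by blast

lemma bounded_bottom: "\<bottom> \<in> bounded_elts L"
  using ideal unfolding lattice_ideal_def by blast

lemma contact_commute: "\<lbrakk>a \<in> carrier L; b \<in> carrier L\<rbrakk> \<Longrightarrow> contact L a b \<longleftrightarrow> contact L b a"
  using C3 by blast

lemma contact_mono:
  assumes "a \<in> carrier L" "b \<in> carrier L" "c \<in> carrier L" "contact L a b" "b \<sqsubseteq> c"
  shows "contact L a c"
  using C4[of a b c] assms le_iff_meet[of b c] by simp

lemma contact_mono_left:
  assumes "a \<in> carrier L" "b \<in> carrier L" "c \<in> carrier L" "contact L b a" "b \<sqsubseteq> c"
  shows "contact L c a"
  using assms contact_mono contact_commute by meson

lemma contact_meet_complement:
  assumes "a \<in> carrier L" "b \<in> carrier L" "c \<in> carrier L" "contact L a b"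
  shows "contact L a (b \<sqinter> c) \<or> contact L a (b \<sqinter> complement L c)"
proof -
  have "contact L a ((b \<sqinter> c) \<squnion> (b \<sqinter> complement L c))" using split_by_complement assms by simp
  then show ?thesis using assms C4[of a "b \<sqinter> c" "b \<sqinter> complement L c"] by (simp add: complement_closed)
qed

lemma ex_bounded_way_inside:
  assumes "a \<in> bounded_elts L" shows "\<exists>b\<in>bounded_elts L. way_inside L a b"
proof -
  have "way_inside L a \<top>"
    unfolding way_inside_def complement_top using C2[of a \<bottom>] assms by (auto simp: bounded_carrier)
  then show ?thesis using BC1[OF assms top_closed] by blast
qed

text \<open>Bounded ultrafilters are those that converge in the space to be constructed; ultrafilters without
  bounded elements correspond to points at infinity.\<close>

definition bounded_ultrafilter :: "'a set \<Rightarrow> bool" where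
  "bounded_ultrafilter u \<longleftrightarrow> ultrafilter u \<and> u \<inter> bounded_elts L \<noteq> {}"

text \<open>The regular closed sets to which the limit of the ultrafilter belongs.\<close>

definition cluster :: "'a set \<Rightarrow> 'a set" where
  "cluster u = {a \<in> carrier L. \<forall>b\<in>u. contact L a b}"

lemma cluster_carrier: "a \<in> cluster u \<Longrightarrow> a \<in> carrier L"
  by (simp add: cluster_def)

lemma ultrafilter_subset_cluster:
  assumes u: "ultrafilter u" shows "u \<subseteq> cluster u"
proof
  fix a assume a: "a \<in> u"
  have ac: "a \<in> carrier L" using ultrafilter_carrier[OF u a] .
  have "contact L a b" if b: "b \<in> u" for b
  proof -
    have c: "b \<in> carrier L" "a \<sqinter> b \<in> u" using ultrafilter_carrier[OF u b] ultrafilter_meet[OF u a b] by auto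
    then have "a \<sqinter> b \<noteq> \<bottom>" using ultrafilter_not_bottom[OF u] by metis
    then have "contact L (a \<sqinter> b) (a \<sqinter> b)" using C1 ac c by simp
    then have "contact L (a \<sqinter> b) b" using contact_mono[of "a \<sqinter> b" "a \<sqinter> b" b] meet_right ac c by simp
    then show ?thesis using contact_mono_left[of b "a \<sqinter> b" a] meet_left ac c by simp
  qed
  then show "a \<in> cluster u" using ac by (simp add: cluster_def)
qed

lemma cluster_upward:
  assumes "ultrafilter u" "a \<in> cluster u" "b \<in> carrier L" "a \<sqsubseteq> b" shows "b \<in> cluster u"
  using assms contact_mono_left[of _ a b] ultrafilter_carrier[OF assms(1)] unfolding cluster_def by simp

lemma join_in_cluster_iff:
  assumes u: "ultrafilter u" and a: "a \<in> carrier L" and b: "b \<in> carrier L"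
  shows "a \<squnion> b \<in> cluster u \<longleftrightarrow> a \<in> cluster u \<or> b \<in> cluster u"
proof
  assume ab: "a \<squnion> b \<in> cluster u"
  show "a \<in> cluster u \<or> b \<in> cluster u"
  proof (rule ccontr)
    assume "\<not> ?thesis"
    then obtain c d where cd: "c \<in> u" "\<not> contact L a c" "d \<in> u" "\<not> contact L b d"
      using a b unfolding cluster_def by blast
    have cdc: "c \<in> carrier L" "d \<in> carrier L" "c \<sqinter> d \<in> u"
      using cd ultrafilter_carrier[OF u] ultrafilter_meet[OF u] by blast+
    then have "contact L (c \<sqinter> d) (a \<squnion> b)" using ab a b contact_commute[of "c \<sqinter> d" "a \<squnion> b"] unfolding cluster_def by simp
    then have "contact L (c \<sqinter> d) a \<or> contact L (c \<sqinter> d) b" using C4[of "c \<sqinter> d" a b] a b cdc by simp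
    then have "contact L c a \<or> contact L d b"
      using contact_mono_left[of a "c \<sqinter> d" c] contact_mono_left[of b "c \<sqinter> d" d] meet_left[of c d] meet_right[of c d] a b cdc by auto
    then show False using cd(2,4) contact_commute[OF a cdc(1)] contact_commute[OF b cdc(2)] by blast
  qed
next
  assume "a \<in> cluster u \<or> b \<in> cluster u"
  then show "a \<squnion> b \<in> cluster u"
    using cluster_upward[OF u, of a "a \<squnion> b"] cluster_upward[OF u, of b "a \<squnion> b"] join_left[OF a b] join_right[OF a b] a b by auto
qed

lemma bottom_notin_cluster: "ultrafilter u \<Longrightarrow> \<bottom> \<notin> cluster u"
  using C2[of \<bottom> \<top>] unfolding cluster_def ultrafilter_def by auto

lemma top_in_cluster: "ultrafilter u \<Longrightarrow> \<top> \<in> cluster u"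
  using ultrafilter_subset_cluster[of u] unfolding ultrafilter_def by blast

lemma way_inside_cluster:
  assumes u: "ultrafilter u" and "a \<in> cluster u" "c \<in> carrier L" "way_inside L a c"
  shows "c \<in> u"
  using ultrafilter_complement[OF u assms(3)] assms unfolding cluster_def way_inside_def by blast

text \<open>Here boundedness matters. Suppose that \<open>a\<close> and \<open>b\<close> are not in contact, and let \<open>c\<close> be a bounded
  member of \<open>u\<close>, well inside a bounded \<open>c'\<close>. Interpolation (BC1) is available for the bounded part
  of \<open>a\<close> below \<open>c'\<close> and gives \<open>d\<close> between it and the complement of \<open>b\<close>. Since \<open>b\<close> is in the cluster,
  \<open>d\<close> is not in \<open>u\<close>, hence the meet of \<open>c\<close> with the complement of \<open>d\<close> is in \<open>u\<close>; but it is in contact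
  neither with the part of \<open>a\<close> below \<open>c'\<close> nor with the part outside \<open>c'\<close>.\<close>

lemma contact_in_cluster:
  assumes u: "bounded_ultrafilter u" and a: "a \<in> cluster u" and b: "b \<in> cluster u"
  shows "contact L a b"
proof (rule ccontr)
  assume no: "\<not> contact L a b"
  have uf: "ultrafilter u" using u unfolding bounded_ultrafilter_def by blast
  have ac: "a \<in> carrier L" and bc: "b \<in> carrier L" using a b by (auto simp: cluster_carrier)
  obtain c where c: "c \<in> u" "c \<in> bounded_elts L" using u unfolding bounded_ultrafilter_def by blast
  obtain c' where c': "c' \<in> bounded_elts L" "way_inside L c c'" using ex_bounded_way_inside[OF c(2)] by blast
  have cc: "c \<in> carrier L" "c' \<in> carrier L" using c c' by (auto simp: bounded_carrier)
  have ac': "a \<sqinter> c' \<in> bounded_elts L" "a \<sqinter> c' \<in> carrier L"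
    using bounded_downward[OF c'(1), of "a \<sqinter> c'"] ac cc meet_right[of a c'] by auto
  have "way_inside L (a \<sqinter> c') (complement L b)"
    unfolding way_inside_def complement_complement[OF bc]
    using no contact_mono_left[of b "a \<sqinter> c'" a] ac bc cc meet_left[of a c'] by auto
  then obtain d where d: "d \<in> bounded_elts L" "way_inside L (a \<sqinter> c') d" "way_inside L d (complement L b)"
    using BC1[OF ac'(1) complement_closed[OF bc]] by blast
  have dc: "d \<in> carrier L" "complement L d \<in> carrier L" using d by (auto simp: bounded_carrier complement_closed)
  have "d \<notin> u" using d(3) b bc dc contact_commute[of d b] unfolding way_inside_def complement_complement[OF bc] cluster_def by blast
  then have "complement L d \<in> u" using ultrafilter_complement[OF uf dc(1)] by blast
  then have cd: "c \<sqinter> complement L d \<in> u" using ultrafilter_meet[OF uf c(1)] by blast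
  let ?e = "c \<sqinter> complement L d"
  have ec: "?e \<in> carrier L" using cc dc by simp
  have "contact L ?e a" using a cd contact_commute[OF ac ec] unfolding cluster_def by blast
  then consider "contact L ?e (a \<sqinter> c')" | "contact L ?e (a \<sqinter> complement L c')"
    using contact_meet_complement[OF ec ac cc(2)] by blast
  then show False
  proof cases
    case 1
    then have "contact L (complement L d) (a \<sqinter> c')"
      using contact_mono_left[of "a \<sqinter> c'" ?e "complement L d"] ac'(2) ec dc cc meet_right[of c "complement L d"] by auto
    then show False using d(2) contact_commute[of "a \<sqinter> c'" "complement L d"] ac' dc unfolding way_inside_def by blast
  next
    case 2
    then have "contact L c (a \<sqinter> complement L c')"
      using contact_mono_left[of "a \<sqinter> complement L c'" ?e c] ac ec dc cc meet_left[of c "complement L d"] by (auto simp: complement_closed)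
    then have "contact L c (complement L c')"
      using contact_mono[of c "a \<sqinter> complement L c'" "complement L c'"] meet_right[of a "complement L c'"] ac cc by (auto simp: complement_closed)
    then show False using c'(2) unfolding way_inside_def by blast
  qed
qed

text \<open>By (BC2) some bounded part \<open>d\<close> of \<open>b\<close> is in contact with \<open>a\<close>. The elements not in contact with \<open>a\<close>
  form an ideal that does not contain \<open>d\<close>, and an ultrafilter that contains \<open>d\<close> and avoids this ideal is
  as required.\<close>

lemma ex_cluster_of_contact:
  assumes a: "a \<in> carrier L" and b: "b \<in> carrier L" and "contact L a b"
  shows "\<exists>u. bounded_ultrafilter u \<and> a \<in> cluster u \<and> b \<in> cluster u"
proof -
  obtain c where c: "c \<in> bounded_elts L" "contact L a (c \<sqinter> b)" using BC2 assms by blast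
  let ?d = "c \<sqinter> b"
  have cc: "c \<in> carrier L" using c by (simp add: bounded_carrier)
  then have d: "?d \<in> carrier L" "?d \<in> bounded_elts L" "?d \<sqsubseteq> b"
    using b bounded_downward[OF c(1)] meet_left[of c b] meet_right[of c b] by auto
  let ?I = "{x \<in> carrier L. \<not> contact L a x}"
  have "lattice_ideal L ?I"
    unfolding lattice_ideal_def
  proof (intro conjI ballI impI)
    show "\<bottom> \<in> ?I" using C2[of a \<bottom>] a by auto
    show "y \<in> ?I" if "x \<in> ?I" "y \<in> carrier L" "y \<sqsubseteq> x" for x y
      using that contact_mono[of a y x] a by auto
    show "x \<squnion> y \<in> ?I" if "x \<in> ?I" "y \<in> ?I" for x y
      using that C4[of a x y] a by auto
  qed auto
  moreover have "{?d} \<inter> ?I = {}" using c by blast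
  moreover have "?d \<sqinter> ?d = ?d" using d le_iff_join[of ?d ?d] by simp
  ultimately obtain u where u: "ultrafilter u" "{?d} \<subseteq> u" "u \<inter> ?I = {}"
    using ultrafilter_avoiding_ideal[of ?I "{?d}"] d(1) by auto
  have "a \<in> cluster u" unfolding cluster_def using a u(3) ultrafilter_carrier[OF u(1)] by blast
  moreover have "b \<in> cluster u"
    using ultrafilter_upward[OF u(1) _ b d(3)] u(2) ultrafilter_subset_cluster[OF u(1)] by blast
  ultimately show ?thesis using u d unfolding bounded_ultrafilter_def by blast
qed

text \<open>By (BC3) there is a nonzero bounded element well inside the difference of \<open>a\<close> and \<open>b\<close>; take a
  cluster containing it.\<close>

lemma ex_cluster_separating:
  assumes a: "a \<in> carrier L" and b: "b \<in> carrier L" and "\<not> a \<sqsubseteq> b"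
  shows "\<exists>u. bounded_ultrafilter u \<and> a \<in> cluster u \<and> b \<notin> cluster u"
proof -
  let ?c = "a \<sqinter> complement L b"
  have b': "complement L b \<in> carrier L" using b by (rule complement_closed)
  then have c: "?c \<in> carrier L" "?c \<noteq> \<bottom>" using assms le_iff_meet_complement[OF a b] by auto
  obtain d where d: "d \<in> bounded_elts L" "d \<noteq> \<bottom>" "way_inside L d ?c" using BC3[OF c] by blast
  have dc: "d \<in> carrier L" using d by (simp add: bounded_carrier)
  obtain u where u: "bounded_ultrafilter u" "d \<in> cluster u"
    using ex_cluster_of_contact[OF dc dc C1[OF dc d(2)]] by blast
  then have uf: "ultrafilter u" unfolding bounded_ultrafilter_def by blast
  have cu: "?c \<in> u" using way_inside_cluster[OF uf u(2) c(1) d(3)] .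
  then have "a \<in> cluster u"
    using ultrafilter_upward[OF uf cu a] meet_left[OF a b'] ultrafilter_subset_cluster[OF uf] by blast
  moreover have "b \<notin> cluster u"
  proof
    assume bu: "b \<in> cluster u"
    have "contact L d b" using contact_in_cluster[OF u(1,2) bu] .
    moreover have "b \<sqsubseteq> complement L ?c"
      using complement_antimono[of ?c "complement L b"] meet_right[OF a b'] c(1) b b' by (simp add: complement_complement)
    ultimately have "contact L d (complement L ?c)"
      using contact_mono[OF dc b] c by (simp add: complement_closed)
    then show False using d(3) unfolding way_inside_def by blast
  qed
  ultimately show ?thesis using u by blast
qed

end

section \<open>The space of clusters\<close>

text \<open>The points are elements of a set \<open>P\<close> that is in bijection with the clusters, rather than the clusters
  themselves, so that the space can be built on a member of the universe.\<close>

locale cluster_space = complete_local_contact_algebra L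
  for L :: "'a local_contact_alg" (structure) +
  fixes P :: "'p set" and cl :: "'p \<Rightarrow> 'a set"
  assumes bij_cl: "bij_betw cl P {cluster u |u. bounded_ultrafilter u}"
begin

text \<open>The set of points that corresponds to the algebra element \<open>a\<close>.\<close>

definition extent :: "'a \<Rightarrow> 'p set" where "extent a = {p \<in> P. a \<in> cl p}"

text \<open>The topology for which the sets \<open>extent a\<close> are a base of the closed sets.\<close>

definition cluster_topology :: "'p topology" where
  "cluster_topology = topology (\<lambda>U. U \<subseteq> P \<and> (\<forall>p\<in>U. \<exists>a\<in>carrier L. p \<notin> extent a \<and> P - extent a \<subseteq> U))"

abbreviation "T \<equiv> cluster_topology"

lemma point_cluster:
  assumes "p \<in> P" obtains u where "bounded_ultrafilter u" "ultrafilter u" "cl p = cluster u"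
proof -
  have "cl p \<in> {cluster u |u. bounded_ultrafilter u}" using bij_betw_apply[OF bij_cl assms] .
  then obtain u where "bounded_ultrafilter u" "cl p = cluster u" by blast
  then show thesis using that[of u] unfolding bounded_ultrafilter_def by blast
qed

lemma ex_point:
  assumes "bounded_ultrafilter u" obtains p where "p \<in> P" "cl p = cluster u"
proof -
  have "cluster u \<in> cl ` P" using assms bij_betw_imp_surj_on[OF bij_cl] by blast
  then show thesis using that by blast
qed

lemma extent_subset: "extent a \<subseteq> P"
  by (auto simp: extent_def)

lemma extent_join:
  assumes "a \<in> carrier L" "b \<in> carrier L" shows "extent (a \<squnion> b) = extent a \<union> extent b"
proof -
  have "a \<squnion> b \<in> cl p \<longleftrightarrow> a \<in> cl p \<or> b \<in> cl p" if p: "p \<in> P" for p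
  proof -
    obtain u where "ultrafilter u" "cl p = cluster u" using point_cluster[OF p] .
    then show ?thesis using join_in_cluster_iff[OF _ assms, of u] by simp
  qed
  then show ?thesis unfolding extent_def by blast
qed

lemma extent_bottom: "extent \<bottom> = {}"
proof -
  have "\<bottom> \<notin> cl p" if p: "p \<in> P" for p
  proof -
    obtain u where "ultrafilter u" "cl p = cluster u" using point_cluster[OF p] .
    then show ?thesis using bottom_notin_cluster by simp
  qed
  then show ?thesis unfolding extent_def by blast
qed

lemma extent_top: "extent \<top> = P"
proof -
  have "\<top> \<in> cl p" if p: "p \<in> P" for p
  proof -
    obtain u where "ultrafilter u" "cl p = cluster u" using point_cluster[OF p] .
    then show ?thesis using top_in_cluster by simp
  qed
  then show ?thesis unfolding extent_def by blast
qed

lemma extent_mono: "\<lbrakk>a \<in> carrier L; b \<in> carrier L; a \<sqsubseteq> b\<rbrakk> \<Longrightarrow> extent a \<subseteq> extent b"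
  using extent_join[of a b] le_iff_meet[of a b] by auto

lemma extent_subset_iff:
  assumes "a \<in> carrier L" "b \<in> carrier L" shows "extent a \<subseteq> extent b \<longleftrightarrow> a \<sqsubseteq> b"
proof
  show "a \<sqsubseteq> b" if sub: "extent a \<subseteq> extent b"
  proof (rule ccontr)
    assume "\<not> a \<sqsubseteq> b"
    then obtain u where u: "bounded_ultrafilter u" "a \<in> cluster u" "b \<notin> cluster u"
      using ex_cluster_separating[OF assms] by blast
    obtain p where "p \<in> P" "cl p = cluster u" using ex_point[OF u(1)] by blast
    then show False using u sub unfolding extent_def by blast
  qed
qed (rule extent_mono[OF assms])

lemma extent_Int_iff:
  assumes "a \<in> carrier L" "b \<in> carrier L" shows "extent a \<inter> extent b \<noteq> {} \<longleftrightarrow> contact L a b"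
proof
  assume "extent a \<inter> extent b \<noteq> {}"
  then obtain p where p: "p \<in> P" "a \<in> cl p" "b \<in> cl p" unfolding extent_def by blast
  obtain u where "bounded_ultrafilter u" "cl p = cluster u" using point_cluster[OF p(1)] by metis
  then show "contact L a b" using p contact_in_cluster[of u a b] by simp
next
  assume "contact L a b"
  then obtain u where u: "bounded_ultrafilter u" "a \<in> cluster u" "b \<in> cluster u"
    using ex_cluster_of_contact[OF assms] by blast
  obtain p where "p \<in> P" "cl p = cluster u" using ex_point[OF u(1)] by blast
  then show "extent a \<inter> extent b \<noteq> {}" using u unfolding extent_def by blast
qed

lemma extent_complement: "a \<in> carrier L \<Longrightarrow> extent a \<union> extent (complement L a) = P"
  using extent_join[of a "complement L a"] by (simp add: complement_closed join_complement extent_top)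

lemma complement_le_of_extent_cover:
  assumes "a \<in> carrier L" "b \<in> carrier L" "P \<subseteq> extent a \<union> extent b"
  shows "complement L a \<sqsubseteq> b"
proof -
  have "extent \<top> \<subseteq> extent (a \<squnion> b)" using assms extent_join extent_top by simp
  then have "\<top> \<sqsubseteq> a \<squnion> b" using extent_subset_iff[of \<top> "a \<squnion> b"] assms by simp
  then have "a \<squnion> b = \<top>" using assms le_antisym[of "a \<squnion> b" \<top>] by simp
  then show ?thesis using complement_le_of_join_eq_top[OF assms(1,2)] by blast
qed

lemma openin_T: "openin T U \<longleftrightarrow> U \<subseteq> P \<and> (\<forall>p\<in>U. \<exists>a\<in>carrier L. p \<notin> extent a \<and> P - extent a \<subseteq> U)"
proof -
  have "istopology (\<lambda>U. U \<subseteq> P \<and> (\<forall>p\<in>U. \<exists>a\<in>carrier L. p \<notin> extent a \<and> P - extent a \<subseteq> U))"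
    unfolding istopology_def
  proof (intro conjI allI impI)
    fix U V assume U: "U \<subseteq> P \<and> (\<forall>p\<in>U. \<exists>a\<in>carrier L. p \<notin> extent a \<and> P - extent a \<subseteq> U)"
      and V: "V \<subseteq> P \<and> (\<forall>p\<in>V. \<exists>a\<in>carrier L. p \<notin> extent a \<and> P - extent a \<subseteq> V)"
    show "U \<inter> V \<subseteq> P" using U by blast
    show "\<forall>p\<in>U \<inter> V. \<exists>a\<in>carrier L. p \<notin> extent a \<and> P - extent a \<subseteq> U \<inter> V"
    proof
      fix p assume p: "p \<in> U \<inter> V"
      obtain a where a: "a \<in> carrier L" "p \<notin> extent a" "P - extent a \<subseteq> U" using U p by blast
      obtain b where b: "b \<in> carrier L" "p \<notin> extent b" "P - extent b \<subseteq> V" using V p by blast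
      have "a \<squnion> b \<in> carrier L" "p \<notin> extent (a \<squnion> b)" "P - extent (a \<squnion> b) \<subseteq> U \<inter> V"
        using a b by (auto simp: extent_join)
      then show "\<exists>a\<in>carrier L. p \<notin> extent a \<and> P - extent a \<subseteq> U \<inter> V" by blast
    qed
  next
    fix \<K> assume K: "\<forall>U\<in>\<K>. U \<subseteq> P \<and> (\<forall>p\<in>U. \<exists>a\<in>carrier L. p \<notin> extent a \<and> P - extent a \<subseteq> U)"
    show "\<Union>\<K> \<subseteq> P" using K by blast
    show "\<forall>p\<in>\<Union>\<K>. \<exists>a\<in>carrier L. p \<notin> extent a \<and> P - extent a \<subseteq> \<Union>\<K>"
    proof
      fix p assume "p \<in> \<Union>\<K>"
      then obtain U where U: "U \<in> \<K>" "p \<in> U" by blast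
      then obtain a where "a \<in> carrier L" "p \<notin> extent a" "P - extent a \<subseteq> U" using K by blast
      then show "\<exists>a\<in>carrier L. p \<notin> extent a \<and> P - extent a \<subseteq> \<Union>\<K>" using U by blast
    qed
  qed
  then show ?thesis unfolding cluster_topology_def by simp
qed

lemma topspace_T: "topspace T = P"
proof -
  have "openin T P" unfolding openin_T using extent_bottom bottom_closed by blast
  moreover have "topspace T \<subseteq> P" using openin_topspace[of T] unfolding openin_T by blast
  ultimately show ?thesis using openin_subset by blast
qed

lemma openin_complement_extent: "a \<in> carrier L \<Longrightarrow> openin T (P - extent a)"
  unfolding openin_T by blast

lemma closedin_extent: "a \<in> carrier L \<Longrightarrow> closedin T (extent a)"
  unfolding closedin_def topspace_T using openin_complement_extent extent_subset by blast

lemma closedin_separated: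
  assumes "closedin T C" "p \<in> P" "p \<notin> C"
  obtains a where "a \<in> carrier L" "C \<subseteq> extent a" "p \<notin> extent a"
proof -
  have "openin T (P - C)" "C \<subseteq> P" using assms unfolding closedin_def topspace_T by auto
  then obtain a where "a \<in> carrier L" "p \<notin> extent a" "P - extent a \<subseteq> P - C"
    using assms unfolding openin_T by blast
  then show thesis using that[of a] \<open>C \<subseteq> P\<close> by blast
qed

text \<open>A basic open set, the complement of some \<open>extent b\<close>, lies inside \<open>extent a\<close> only if the join of \<open>a\<close>
  and \<open>b\<close> is the unit, that is, if \<open>b\<close> lies above the complement of \<open>a\<close>.\<close>

lemma interior_of_extent:
  assumes a: "a \<in> carrier L" shows "T interior_of (extent a) = P - extent (complement L a)"
proof
  show "P - extent (complement L a) \<subseteq> T interior_of (extent a)"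
    using extent_complement[OF a] a by (intro interior_of_maximal openin_complement_extent complement_closed) auto
  show "T interior_of (extent a) \<subseteq> P - extent (complement L a)"
  proof
    fix p assume p: "p \<in> T interior_of (extent a)"
    have "openin T (T interior_of (extent a))" by simp
    then obtain b where b: "b \<in> carrier L" "p \<notin> extent b" "P - extent b \<subseteq> T interior_of (extent a)"
      using p unfolding openin_T by blast
    then have "P \<subseteq> extent a \<union> extent b" using interior_of_subset[of T "extent a"] by blast
    then have "extent (complement L a) \<subseteq> extent b"
      using extent_mono complement_le_of_extent_cover[OF a b(1)] complement_closed[OF a] b(1) by simp
    moreover have "p \<in> P" using p interior_of_subset[of T "extent a"] extent_subset by blast
    ultimately show "p \<in> P - extent (complement L a)" using b by blast
  qed
qed

lemma closure_of_complement_extent: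
  assumes a: "a \<in> carrier L" shows "T closure_of (P - extent (complement L a)) = extent a"
proof
  show "T closure_of (P - extent (complement L a)) \<subseteq> extent a"
    using extent_complement[OF a] by (intro closure_of_minimal closedin_extent a) auto
  show "extent a \<subseteq> T closure_of (P - extent (complement L a))"
  proof (rule ccontr)
    assume "\<not> ?thesis"
    then obtain p where p: "p \<in> extent a" "p \<notin> T closure_of (P - extent (complement L a))" by blast
    then have "p \<in> P" using extent_subset by blast
    then obtain b where b: "b \<in> carrier L" "T closure_of (P - extent (complement L a)) \<subseteq> extent b" "p \<notin> extent b"
      using closedin_separated[OF closedin_closure_of] p by metis
    have "P - extent (complement L a) \<subseteq> extent b"
      using b(2) closure_of_subset[of "P - extent (complement L a)" T] topspace_T by blast
    then have "complement L (complement L a) \<sqsubseteq> b"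
      using complement_le_of_extent_cover[OF complement_closed[OF a] b(1)] by blast
    then show False using extent_mono[OF a b(1)] complement_complement[OF a] p b by auto
  qed
qed

lemma regular_closed_extent: "a \<in> carrier L \<Longrightarrow> regular_closed T (extent a)"
  unfolding regular_closed_def interior_of_extent by (rule closure_of_complement_extent)

text \<open>Completeness of the algebra enters here: the element sought is the supremum of all \<open>c\<close> whose extent is
  contained in \<open>F\<close>.\<close>

lemma regular_closed_is_extent:
  assumes F: "regular_closed T F" shows "\<exists>a\<in>carrier L. extent a = F"
proof
  define S where "S = {c \<in> carrier L. extent c \<subseteq> F}"
  have S: "S \<subseteq> carrier L" unfolding S_def by blast
  let ?a = "\<Squnion>S"
  show a: "?a \<in> carrier L" using S by (rule sup_closed)
  have lub: "least L ?a (Upper L S)" using supI[of S "\<lambda>s. least L s (Upper L S)"] S by blast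
  have closed: "closedin T F" using F by (rule regular_closed_closedin)
  show "extent ?a = F"
  proof
    show "extent ?a \<subseteq> F"
    proof (rule ccontr)
      assume "\<not> ?thesis"
      then obtain p where p: "p \<in> extent ?a" "p \<notin> F" by blast
      then have "p \<in> P" using extent_subset by blast
      then obtain b where b: "b \<in> carrier L" "F \<subseteq> extent b" "p \<notin> extent b" using closedin_separated[OF closed] p(2) by metis
      have "c \<sqsubseteq> b" if "c \<in> S" for c
        using that b extent_subset_iff[of c b] unfolding S_def by blast
      then have "?a \<sqsubseteq> b" using lub b(1) unfolding least_def Upper_def by blast
      then show False using extent_mono[OF a b(1)] p b by blast
    qed
    have "T interior_of F \<subseteq> extent ?a"
    proof
      fix p assume p: "p \<in> T interior_of F"
      have "openin T (T interior_of F)" by simp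
      then obtain b where b: "b \<in> carrier L" "p \<notin> extent b" "P - extent b \<subseteq> T interior_of F" and pP: "p \<in> P"
        using p unfolding openin_T by blast
      have b': "complement L b \<in> carrier L" using b(1) by (rule complement_closed)
      have "extent (complement L b) = T closure_of (P - extent b)"
        using closure_of_complement_extent[OF b'] complement_complement[OF b(1)] by simp
      also have "\<dots> \<subseteq> T closure_of (T interior_of F)" by (rule closure_of_mono[OF b(3)])
      also have "\<dots> = F" using F unfolding regular_closed_def .
      finally have "complement L b \<in> S" using b' unfolding S_def by blast
      then have "complement L b \<sqsubseteq> ?a" using lub b' unfolding least_def Upper_def by blast
      then have "extent (complement L b) \<subseteq> extent ?a" by (rule extent_mono[OF b' a])
      then show "p \<in> extent ?a" using extent_complement[OF b(1)] b(2) pP by blast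
    qed
    then show "F \<subseteq> extent ?a" using regular_closed_subset_iff[OF F closedin_extent[OF a]] by blast
  qed
qed

text \<open>Given a family of closed sets with the finite intersection property relative to \<open>extent b\<close>, one
  constructs an ultrafilter whose cluster belongs to all of them. If \<open>c\<close> has some \<open>a\<close> well inside it, then
  \<open>c\<close> belongs to every ultrafilter whose cluster contains \<open>a\<close>. The elements that are forced, in
  the same sense, by finitely many \<open>a\<close> whose extents include members of the family form a proper
  filter, and any ultrafilter containing it will do; it is bounded because \<open>b\<close> is well inside a bounded element.\<close>

lemma compactin_extent:
  assumes b: "b \<in> bounded_elts L" shows "compactin T (extent b)"
  unfolding compactin_fip
proof (intro conjI allI impI)
  show "extent b \<subseteq> topspace T" using extent_subset topspace_T by simp
  fix \<U> assume asm: "(\<forall>C\<in>\<U>. closedin T C) \<and> (\<forall>\<F>. finite \<F> \<and> \<F> \<subseteq> \<U> \<longrightarrow> extent b \<inter> \<Inter>\<F> \<noteq> {})"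
  have bc: "b \<in> carrier L" using b by (rule bounded_carrier)
  define A where "A = insert b {a \<in> carrier L. \<exists>C\<in>\<U>. C \<subseteq> extent a}"
  have Ac: "a \<in> carrier L" if "a \<in> A" for a using that bc unfolding A_def by blast
  have fip: "\<exists>u. bounded_ultrafilter u \<and> F \<subseteq> cluster u" if F: "finite F" "F \<subseteq> A" for F
  proof -
    have "\<exists>C\<in>\<U>. C \<subseteq> extent a" if "a \<in> F - {b}" for a using that F unfolding A_def by blast
    then obtain C where C: "\<And>a. a \<in> F - {b} \<Longrightarrow> C a \<in> \<U> \<and> C a \<subseteq> extent a" by metis
    have "extent b \<inter> \<Inter>(C ` (F - {b})) \<noteq> {}"
    proof -
      have "finite (C ` (F - {b}))" using F by simp
      moreover have "C ` (F - {b}) \<subseteq> \<U>" using C by blast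
      ultimately show ?thesis using asm by blast
    qed
    then obtain p where p: "p \<in> extent b" "\<And>a. a \<in> F - {b} \<Longrightarrow> p \<in> C a" by blast
    have "a \<in> cl p" if "a \<in> F" for a
    proof (cases "a = b")
      case False
      then have "p \<in> extent a" using that p(2)[of a] C[of a] by blast
      then show ?thesis unfolding extent_def by blast
    qed (use p(1) in \<open>simp add: extent_def\<close>)
    moreover have "p \<in> P" using p(1) extent_subset by blast
    then obtain u where "bounded_ultrafilter u" "cl p = cluster u" using point_cluster by metis
    ultimately show ?thesis by blast
  qed
  \<comment> \<open>The filter of elements forced into every bounded ultrafilter whose cluster contains suitable
    finitely many members of \<open>A\<close>.\<close>
  define S where "S = {s \<in> carrier L. \<exists>F. finite F \<and> F \<subseteq> A \<and> (\<forall>u. bounded_ultrafilter u \<longrightarrow> F \<subseteq> cluster u \<longrightarrow> s \<in> u)}"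
  have way: "c \<in> S" if a: "a \<in> A" and c: "c \<in> carrier L" "way_inside L a c" for a c
  proof -
    have "c \<in> u" if "bounded_ultrafilter u" "{a} \<subseteq> cluster u" for u
      using that way_inside_cluster[of u a c] c unfolding bounded_ultrafilter_def by blast
    then show ?thesis unfolding S_def using a c by (intro CollectI conjI exI[of _ "{a}"]) auto
  qed
  obtain b' where b': "b' \<in> bounded_elts L" "way_inside L b b'" using ex_bounded_way_inside[OF b] by blast
  have b'S: "b' \<in> S" using way[of b b'] b' bounded_carrier unfolding A_def by blast
  have "\<bottom> \<notin> S"
  proof
    assume "\<bottom> \<in> S"
    then obtain F where "finite F" "F \<subseteq> A" "\<And>u. bounded_ultrafilter u \<Longrightarrow> F \<subseteq> cluster u \<Longrightarrow> \<bottom> \<in> u" unfolding S_def by blast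
    then obtain u where "bounded_ultrafilter u" "\<bottom> \<in> u" using fip[of F] by blast
    then show False using ultrafilter_not_bottom[of u] unfolding bounded_ultrafilter_def by blast
  qed
  moreover have "x \<sqinter> y \<in> S" if x: "x \<in> S" and y: "y \<in> S" for x y
  proof -
    obtain F where F: "finite F" "F \<subseteq> A" "\<And>u. bounded_ultrafilter u \<Longrightarrow> F \<subseteq> cluster u \<Longrightarrow> x \<in> u" using x unfolding S_def by blast
    obtain G where G: "finite G" "G \<subseteq> A" "\<And>u. bounded_ultrafilter u \<Longrightarrow> G \<subseteq> cluster u \<Longrightarrow> y \<in> u" using y unfolding S_def by blast
    have "x \<sqinter> y \<in> u" if u: "bounded_ultrafilter u" "F \<union> G \<subseteq> cluster u" for u
      using F(3)[OF u(1)] G(3)[OF u(1)] u ultrafilter_meet[of u x y] unfolding bounded_ultrafilter_def by blast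
    moreover have "x \<sqinter> y \<in> carrier L" using x y unfolding S_def by simp
    ultimately show ?thesis unfolding S_def using F(1,2) G(1,2) by (intro CollectI conjI exI[of _ "F \<union> G"]) auto
  qed
  moreover have "lattice_ideal L {\<bottom>}"
  proof -
    have "y = \<bottom>" if "y \<in> carrier L" "y \<sqsubseteq> \<bottom>" for y
      using that le_antisym[of y \<bottom>] by simp
    moreover have "\<bottom> \<squnion> \<bottom> = \<bottom>" using bottom_join[of \<bottom>] by (simp add: eq_is_equal)
    ultimately show ?thesis unfolding lattice_ideal_def by simp
  qed
  moreover have "S \<subseteq> carrier L" unfolding S_def by blast
  ultimately obtain u where u: "ultrafilter u" "S \<subseteq> u" using ultrafilter_avoiding_ideal[of "{\<bottom>}" S] b'S by blast
  then have bu: "bounded_ultrafilter u" using b' b'S unfolding bounded_ultrafilter_def by blast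
  obtain p where p: "p \<in> P" "cl p = cluster u" using ex_point[OF bu] by blast
  have Au: "a \<in> cluster u" if a: "a \<in> A" for a
  proof -
    have "contact L a x" if x: "x \<in> u" for x
    proof (rule ccontr)
      assume no: "\<not> contact L a x"
      have xc: "x \<in> carrier L" using ultrafilter_carrier[OF u(1) x] .
      have "way_inside L a (complement L x)" using no complement_complement[OF xc] unfolding way_inside_def by simp
      then have "complement L x \<in> u" using way[OF a complement_closed[OF xc]] u(2) by blast
      then have "x \<sqinter> complement L x \<in> u" using ultrafilter_meet[OF u(1) x] by blast
      then show False using meet_complement[OF xc] ultrafilter_not_bottom[OF u(1)] by simp
    qed
    then show ?thesis using Ac[OF a] unfolding cluster_def by blast
  qed
  have "p \<in> extent b" using Au[of b] p unfolding A_def extent_def by blast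
  moreover have "p \<in> C" if C: "C \<in> \<U>" for C
  proof (rule ccontr)
    assume "p \<notin> C"
    then obtain a where a: "a \<in> carrier L" "C \<subseteq> extent a" "p \<notin> extent a" using closedin_separated[of C p] asm C p by metis
    then have "a \<in> A" using C unfolding A_def by blast
    then show False using Au p a(3) unfolding extent_def by blast
  qed
  ultimately show "extent b \<inter> \<Inter>\<U> \<noteq> {}" by blast
qed

lemma ex_interior_extent:
  assumes p: "p \<in> P" obtains b where "b \<in> bounded_elts L" "p \<in> P - extent (complement L b)"
proof -
  obtain u where u: "bounded_ultrafilter u" "ultrafilter u" "cl p = cluster u" using point_cluster[OF p] .
  obtain b where b: "b \<in> u" "b \<in> bounded_elts L" using u unfolding bounded_ultrafilter_def by blast
  obtain c where c: "c \<in> bounded_elts L" "way_inside L b c" using ex_bounded_way_inside[OF b(2)] by blast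
  have "b \<in> cluster u" using ultrafilter_subset_cluster[OF u(2)] b by blast
  then have "complement L c \<notin> cluster u" using contact_in_cluster[OF u(1), of b] c unfolding way_inside_def by blast
  then show thesis using that[of c] p u c unfolding extent_def by blast
qed

lemma ex_upper_bound_of_finite_bounded:
  assumes "finite B" "B \<subseteq> bounded_elts L" shows "\<exists>c\<in>bounded_elts L. \<forall>b\<in>B. b \<sqsubseteq> c"
  using assms
proof (induction B rule: finite_induct)
  case (insert b B)
  then obtain c where c: "c \<in> bounded_elts L" "\<forall>b\<in>B. b \<sqsubseteq> c" by blast
  have bc: "b \<in> bounded_elts L" "b \<in> carrier L" "c \<in> carrier L" using insert c bounded_carrier by auto
  have "x \<sqsubseteq> b \<squnion> c" if "x \<in> insert b B" for x
  proof (cases "x = b")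
    case False
    then have "x \<in> carrier L" "x \<sqsubseteq> c" using that insert.prems c bounded_carrier by auto
    then show ?thesis using le_trans[of x c "b \<squnion> c"] join_right bc by simp
  qed (use join_left bc in simp)
  then show ?case using bounded_join[OF bc(1) c(1)] by blast
qed (use bounded_bottom in blast)

text \<open>A compact extent is covered by the interiors of finitely many bounded extents, hence lies below a
  finite join of bounded elements.\<close>

lemma compactin_extent_iff:
  assumes a: "a \<in> carrier L" shows "compactin T (extent a) \<longleftrightarrow> a \<in> bounded_elts L"
proof
  assume comp: "compactin T (extent a)"
  let ?U = "\<lambda>b. P - extent (complement L b)"
  have "openin T V" if "V \<in> ?U ` bounded_elts L" for V
    using that openin_complement_extent[OF complement_closed[OF bounded_carrier]] by blast
  moreover have "extent a \<subseteq> \<Union>(?U ` bounded_elts L)"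
  proof
    fix p assume "p \<in> extent a"
    then have "p \<in> P" using extent_subset by blast
    then obtain b where "b \<in> bounded_elts L" "p \<in> ?U b" using ex_interior_extent by metis
    then show "p \<in> \<Union>(?U ` bounded_elts L)" by blast
  qed
  ultimately obtain \<F> where \<F>: "finite \<F>" "\<F> \<subseteq> ?U ` bounded_elts L" "extent a \<subseteq> \<Union>\<F>"
    using compactinD[OF comp] by meson
  obtain B where B: "finite B" "B \<subseteq> bounded_elts L" "\<F> = ?U ` B" using finite_subset_image[OF \<F>(1,2)] by blast
  obtain c where c: "c \<in> bounded_elts L" "\<forall>b\<in>B. b \<sqsubseteq> c" using ex_upper_bound_of_finite_bounded[OF B(1,2)] by blast
  have cc: "c \<in> carrier L" using c by (simp add: bounded_carrier)
  have "?U b \<subseteq> extent c" if "b \<in> B" for b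
  proof -
    have bc: "b \<in> carrier L" using that B bounded_carrier by blast
    then show ?thesis using extent_complement[OF bc] extent_mono[OF bc cc] c that by blast
  qed
  then have "extent a \<subseteq> extent c" using \<F>(3) B(3) by blast
  then show "a \<in> bounded_elts L" using extent_subset_iff[OF a cc] bounded_downward[OF c(1) a] by blast
qed (rule compactin_extent)

text \<open>Some member \<open>b\<close> of the ultrafilter of \<open>q\<close> is not in contact with \<open>a\<close>, and it can be chosen bounded.
  Interpolating \<open>d\<close> between \<open>b\<close> and the complement of \<open>a\<close> separates the points by the interiors of
  \<open>d\<close> and of its complement.\<close>

lemma separate_points:
  assumes pq: "p \<in> P" "q \<in> P" and a: "a \<in> cl p" "a \<notin> cl q"
  shows "\<exists>V W. openin T V \<and> openin T W \<and> p \<in> V \<and> q \<in> W \<and> disjnt V W"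
proof -
  obtain u where u: "bounded_ultrafilter u" "ultrafilter u" "cl p = cluster u" using point_cluster[OF pq(1)] .
  obtain v where v: "bounded_ultrafilter v" "ultrafilter v" "cl q = cluster v" using point_cluster[OF pq(2)] .
  have ac: "a \<in> carrier L" using a u cluster_carrier by blast
  obtain b where b: "b \<in> v" "\<not> contact L a b" using a(2) ac v unfolding cluster_def by blast
  obtain e where e: "e \<in> v" "e \<in> bounded_elts L" using v unfolding bounded_ultrafilter_def by blast
  have c: "b \<in> carrier L" "e \<in> carrier L" using b e ultrafilter_carrier[OF v(2)] by blast+
  let ?b = "e \<sqinter> b"
  have bv: "?b \<in> v" using ultrafilter_meet[OF v(2) e(1) b(1)] .
  have bb: "?b \<in> bounded_elts L" "?b \<in> carrier L" using bounded_downward[OF e(2)] meet_left[of e b] c by auto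
  have "\<not> contact L a ?b" using contact_mono[OF ac bb(2) c(1)] meet_right[of e b] c b(2) by blast
  then have "way_inside L ?b (complement L a)"
    unfolding way_inside_def complement_complement[OF ac] using contact_commute[OF ac bb(2)] by blast
  then obtain d where d: "d \<in> bounded_elts L" "way_inside L ?b d" "way_inside L d (complement L a)"
    using BC1[OF bb(1) complement_closed[OF ac]] by blast
  have dc: "d \<in> carrier L" "complement L d \<in> carrier L" using d by (auto simp: bounded_carrier complement_closed)
  have "?b \<in> cluster v" using ultrafilter_subset_cluster[OF v(2)] bv by blast
  then have "complement L d \<notin> cl q" using contact_in_cluster[OF v(1), of ?b] d(2) v(3) unfolding way_inside_def by blast
  moreover have "d \<notin> cl p"
    using contact_in_cluster[OF u(1), of d a] a(1) u(3) d(3) unfolding way_inside_def complement_complement[OF ac] by blast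
  ultimately have "p \<in> P - extent d" "q \<in> P - extent (complement L d)" using pq unfolding extent_def by blast+
  moreover have "disjnt (P - extent d) (P - extent (complement L d))" using extent_complement[OF dc(1)] unfolding disjnt_def by blast
  ultimately show ?thesis using openin_complement_extent dc by blast
qed

lemma Hausdorff_T: "Hausdorff_space T"
  unfolding Hausdorff_space_def topspace_T
proof (intro allI impI)
  fix p q assume pq: "p \<in> P \<and> q \<in> P \<and> p \<noteq> q"
  then have "cl p \<noteq> cl q" using inj_on_eq_iff[OF bij_betw_imp_inj_on[OF bij_cl]] by blast
  then consider a where "a \<in> cl p" "a \<notin> cl q" | a where "a \<in> cl q" "a \<notin> cl p" by blast
  then show "\<exists>V W. openin T V \<and> openin T W \<and> p \<in> V \<and> q \<in> W \<and> disjnt V W"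
  proof cases
    case 1 then show ?thesis using separate_points pq by blast
  next
    case 2
    then obtain V W where "openin T V" "openin T W" "q \<in> V" "p \<in> W" "disjnt V W" using separate_points[of q p] pq by blast
    then show ?thesis using disjnt_sym by blast
  qed
qed

lemma locally_compact_T: "locally_compact_space T"
  unfolding locally_compact_space_def topspace_T
proof
  fix p assume "p \<in> P"
  then obtain b where b: "b \<in> bounded_elts L" "p \<in> P - extent (complement L b)" using ex_interior_extent by metis
  then have bc: "b \<in> carrier L" by (simp add: bounded_carrier)
  have "P - extent (complement L b) \<subseteq> extent b" using extent_complement[OF bc] by blast
  then show "\<exists>U K. openin T U \<and> compactin T K \<and> p \<in> U \<and> U \<subseteq> K"
    using b compactin_extent openin_complement_extent[OF complement_closed[OF bc]] by blast
qed

lemma rc_representation_extent: "rc_representation T L extent"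
proof
  show "bij_betw extent (carrier L) {F. regular_closed T F}"
    unfolding bij_betw_def
  proof
    show "inj_on extent (carrier L)"
    proof (rule inj_onI)
      fix a b assume ab: "a \<in> carrier L" "b \<in> carrier L" "extent a = extent b"
      then have "a \<sqsubseteq> b" "b \<sqsubseteq> a" using extent_subset_iff[of a b] extent_subset_iff[of b a] by auto
      then show "a = b" using ab le_antisym by blast
    qed
    show "extent ` carrier L = {F. regular_closed T F}"
    proof (intro equalityI subsetI)
      fix F assume "F \<in> extent ` carrier L"
      then show "F \<in> {F. regular_closed T F}" using regular_closed_extent by blast
    next
      fix F assume "F \<in> {F. regular_closed T F}"
      then have "\<exists>a\<in>carrier L. extent a = F" using regular_closed_is_extent by blast
      then show "F \<in> extent ` carrier L" by blast
    qed
  qed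
  show "bounded_elts L = {a \<in> carrier L. compactin T (extent a)}"
    using compactin_extent_iff bounded_carrier by blast
qed (simp_all add: locally_compact_T Hausdorff_T eq_is_equal extent_subset_iff extent_Int_iff)

end

section \<open>The categories and their equivalence\<close>

lemma category_SkeLC: "category (SkeLC U)"
  unfolding category_def
proof (intro conjI ballI)
  show "Ident (SkeLC U) X \<in> Hom (SkeLC U) X X" for X
    by (simp add: SkeLC_def continuous_skeletal_restrict_id)
  show "Comp (SkeLC U) X Y Z g f \<in> Hom (SkeLC U) X Z"
    if "f \<in> Hom (SkeLC U) X Y" "g \<in> Hom (SkeLC U) Y Z" for X Y Z f g
    using that continuous_skeletal_compose[of X Y f Z g] by (simp add: SkeLC_def)
  have funcset: "f \<in> topspace X \<rightarrow> topspace Y" "f \<in> extensional (topspace X)" if "f \<in> Hom (SkeLC U) X Y" for X Y f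
    using that continuous_map_funspace[of X Y f] by (simp_all add: SkeLC_def)
  show "Comp (SkeLC U) X X Y f (Ident (SkeLC U) X) = f" "Comp (SkeLC U) X Y Y (Ident (SkeLC U) Y) f = f"
    if "f \<in> Hom (SkeLC U) X Y" for X Y f
    using compose_Id[OF funcset[OF that]] Id_compose[OF funcset[OF that]] by (simp_all add: SkeLC_def)
  show "Comp (SkeLC U) W X Z (Comp (SkeLC U) X Y Z h g) f = Comp (SkeLC U) W Y Z h (Comp (SkeLC U) W X Y g f)"
    if "f \<in> Hom (SkeLC U) W X" for W X Y Z f g h
    using compose_assoc[OF funcset(1)[OF that], of h g] by (simp add: SkeLC_def)
qed

lemma ESkeLC_morphism_ident:
  assumes "complete_local_contact_algebra A"
  shows "ESkeLC_morphism A A (\<lambda>a\<in>carrier A. a)"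
proof -
  interpret complete_local_contact_algebra A by (rule assms)
  have bd: "a \<in> carrier A" if "a \<in> bounded_elts A" for a by (rule bounded_carrier[OF that])
  have "(\<lambda>a\<in>carrier A. a) ` S = S" if "S \<subseteq> carrier A" for S using that by (force simp: image_iff)
  then have sup: "(\<lambda>a\<in>carrier A. a) (\<Squnion>\<^bsub>A\<^esub>S) = \<Squnion>\<^bsub>A\<^esub>((\<lambda>a\<in>carrier A. a) ` S)" if "S \<subseteq> carrier A" for S
    using that by (simp only: sup_closed restrict_apply' if_True)
  show ?thesis
    unfolding ESkeLC_morphism_def
    by (intro conjI ballI allI impI sup) (auto simp: bd)
qed

lemma ESkeLC_morphism_compose:
  assumes "complete_local_contact_algebra A"
    and \<phi>: "ESkeLC_morphism A B \<phi>" and \<psi>: "ESkeLC_morphism B C \<psi>"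
  shows "ESkeLC_morphism A C (compose (carrier A) \<psi> \<phi>)"
proof -
  interpret complete_local_contact_algebra A by (rule assms)
  let ?c = "compose (carrier A) \<psi> \<phi>"
  have c: "?c a = \<psi> (\<phi> a)" if "a \<in> carrier A" for a using that by (simp add: compose_def)
  have \<phi>c: "\<phi> a \<in> carrier B" if "a \<in> carrier A" for a using that \<phi> unfolding ESkeLC_morphism_def by blast
  have \<psi>c: "\<psi> a \<in> carrier C" if "a \<in> carrier B" for a using that \<psi> unfolding ESkeLC_morphism_def by blast
  have "?c \<in> carrier A \<rightarrow> carrier C" using c \<phi>c \<psi>c by simp
  moreover have "\<forall>a\<in>carrier A. ?c a = \<bottom>\<^bsub>C\<^esub> \<longleftrightarrow> a = \<bottom>\<^bsub>A\<^esub>"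
    using \<phi> \<psi> \<phi>c c unfolding ESkeLC_morphism_def by simp
  moreover have "?c (\<Squnion>\<^bsub>A\<^esub>S) = \<Squnion>\<^bsub>C\<^esub>(?c ` S)" if S: "S \<subseteq> carrier A" for S
  proof -
    have "?c (\<Squnion>\<^bsub>A\<^esub>S) = \<psi> (\<phi> (\<Squnion>\<^bsub>A\<^esub>S))" using S by (simp add: c)
    also have "\<dots> = \<psi> (\<Squnion>\<^bsub>B\<^esub>(\<phi> ` S))" using S \<phi> unfolding ESkeLC_morphism_def by simp
    also have "\<dots> = \<Squnion>\<^bsub>C\<^esub>(\<psi> ` \<phi> ` S)"
    proof -
      have "\<phi> ` S \<subseteq> carrier B" using S \<phi>c by blast
      then show ?thesis using \<psi> unfolding ESkeLC_morphism_def by blast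
    qed
    also have "\<psi> ` \<phi> ` S = ?c ` S" unfolding image_image using S c by (intro image_cong) auto
    finally show ?thesis .
  qed
  moreover have "\<exists>x\<in>carrier A. x \<sqsubseteq>\<^bsub>A\<^esub> a \<and> ?c x = b"
    if ab: "a \<in> carrier A" "b \<in> carrier C" "b \<sqsubseteq>\<^bsub>C\<^esub> ?c a" for a b
  proof -
    have "b \<sqsubseteq>\<^bsub>C\<^esub> \<psi> (\<phi> a)" using ab c by simp
    then obtain y where y: "y \<in> carrier B" "y \<sqsubseteq>\<^bsub>B\<^esub> \<phi> a" "\<psi> y = b"
      using \<psi> ab(2) \<phi>c[OF ab(1)] unfolding ESkeLC_morphism_def by blast
    then obtain x where "x \<in> carrier A" "x \<sqsubseteq>\<^bsub>A\<^esub> a" "\<phi> x = y"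
      using \<phi> ab(1) unfolding ESkeLC_morphism_def by blast
    then show ?thesis using y c by auto
  qed
  moreover have "contact C (?c a) (?c b)" if "a \<in> carrier A" "b \<in> carrier A" "contact A a b" for a b
    using that \<phi> \<psi> \<phi>c c unfolding ESkeLC_morphism_def by simp
  moreover have "?c a \<in> bounded_elts C" if "a \<in> bounded_elts A" for a
    using that \<phi> \<psi> c[OF bounded_carrier[OF that]] unfolding ESkeLC_morphism_def by simp
  ultimately show ?thesis unfolding ESkeLC_morphism_def by (intro conjI allI impI ballI) simp_all
qed

lemma category_ESkeLC: "category (ESkeLC U)"
  unfolding category_def
proof (intro conjI ballI)
  show "Ident (ESkeLC U) A \<in> Hom (ESkeLC U) A A" if "A \<in> Obj (ESkeLC U)" for A
    using that by (simp add: ESkeLC_def ESkeLC_morphism_ident)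
  show "Comp (ESkeLC U) A B C g f \<in> Hom (ESkeLC U) A C"
    if "A \<in> Obj (ESkeLC U)" "f \<in> Hom (ESkeLC U) A B" "g \<in> Hom (ESkeLC U) B C" for A B C f g
    using that ESkeLC_morphism_compose[of A B f C g] by (simp add: ESkeLC_def)
  have funcset: "f \<in> carrier A \<rightarrow> carrier B" "f \<in> extensional (carrier A)" if "f \<in> Hom (ESkeLC U) A B" for A B f
    using that by (simp_all add: ESkeLC_def ESkeLC_morphism_def)
  show "Comp (ESkeLC U) A A B f (Ident (ESkeLC U) A) = f" "Comp (ESkeLC U) A B B (Ident (ESkeLC U) B) f = f"
    if "f \<in> Hom (ESkeLC U) A B" for A B f
    using compose_Id[OF funcset[OF that]] Id_compose[OF funcset[OF that]] by (simp_all add: ESkeLC_def)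
  show "Comp (ESkeLC U) A B D (Comp (ESkeLC U) B C D h g) f = Comp (ESkeLC U) A C D h (Comp (ESkeLC U) A B C g f)"
    if "f \<in> Hom (ESkeLC U) A B" for A B C D f g h
    using compose_assoc[OF funcset(1)[OF that], of h g] by (simp add: ESkeLC_def)
qed

lemma powerset_universe_coding:
  assumes "powerset_universe U" "S \<in> U"
  shows "\<exists>g. inj_on g (Pow S) \<and> g ` Pow S \<in> U"
proof -
  obtain P where "P \<in> U" "Pow S \<approx> P" using assms unfolding powerset_universe_def by blast
  then obtain g where "bij_betw g (Pow S) P" unfolding eqpoll_def by blast
  then show ?thesis using \<open>P \<in> U\<close> unfolding bij_betw_def by blast
qed

lemma powerset_universe_subset: "\<lbrakk>powerset_universe U; A \<in> U; B \<subseteq> A\<rbrakk> \<Longrightarrow> B \<in> U"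
  unfolding powerset_universe_def by blast

text \<open>An injective coding of the subsets of \<open>S\<close> by elements of a member of \<open>U\<close>. The objects of \<open>ESkeLC U\<close>
  live on elements of the base type, so sets of points have to be coded.\<close>

definition code_of :: "'u set set \<Rightarrow> 'u set \<Rightarrow> 'u set \<Rightarrow> 'u" where
  "code_of U S = (SOME g. inj_on g (Pow S) \<and> g ` Pow S \<in> U)"

definition decode :: "'u set set \<Rightarrow> 'u topology \<Rightarrow> 'u \<Rightarrow> 'u set" where
  "decode U X = inv_into (Pow (topspace X)) (code_of U (topspace X))"

definition rc_algebra :: "'u set set \<Rightarrow> 'u topology \<Rightarrow> 'u local_contact_alg" where
  "rc_algebra U X =
    \<lparr> carrier = code_of U (topspace X) ` {F. regular_closed X F},
      eq = (=),
      le = (\<lambda>a b. decode U X a \<subseteq> decode U X b),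
      contact = (\<lambda>a b. decode U X a \<inter> decode U X b \<noteq> {}),
      bounded_elts = {a \<in> code_of U (topspace X) ` {F. regular_closed X F}. compactin X (decode U X a)} \<rparr>"

lemma
  assumes U: "powerset_universe U" and X: "X \<in> Obj (SkeLC U)"
  shows rc_representation_rc_algebra: "rc_representation X (rc_algebra U X) (decode U X)"
    and rc_algebra_Obj: "rc_algebra U X \<in> Obj (ESkeLC U)"
proof -
  have X': "topspace X \<in> U" "locally_compact_space X" "Hausdorff_space X" using X by (simp_all add: SkeLC_def)
  let ?g = "code_of U (topspace X)"
  have g: "inj_on ?g (Pow (topspace X))" "?g ` Pow (topspace X) \<in> U"
    unfolding code_of_def using someI_ex[OF powerset_universe_coding[OF U X'(1)]] by blast+
  have sub: "{F. regular_closed X F} \<subseteq> Pow (topspace X)" using regular_closed_subset_topspace by blast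
  have dec: "decode U X (?g F) = F" if "regular_closed X F" for F
    unfolding decode_def using inv_into_f_f[OF g(1)] sub that by blast
  have bij: "bij_betw (decode U X) (carrier (rc_algebra U X)) {F. regular_closed X F}"
  proof (rule bij_betw_imageI)
    show "inj_on (decode U X) (carrier (rc_algebra U X))"
      by (rule inj_onI) (auto simp: rc_algebra_def dec)
    show "decode U X ` carrier (rc_algebra U X) = {F. regular_closed X F}"
      by (simp add: rc_algebra_def image_image dec)
  qed
  then show rep: "rc_representation X (rc_algebra U X) (decode U X)"
    using X' by unfold_locales (simp_all add: rc_algebra_def)
  interpret rc_representation X "rc_algebra U X" "decode U X" by (rule rep)
  have "carrier (rc_algebra U X) \<subseteq> ?g ` Pow (topspace X)" unfolding rc_algebra_def using sub by auto
  then have "carrier (rc_algebra U X) \<in> U" by (rule powerset_universe_subset[OF U g(2)])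
  then show "rc_algebra U X \<in> Obj (ESkeLC U)"
    using complete_local_contact_algebra_axioms by (simp add: ESkeLC_def)
qed

text \<open>Clusters are subsets of the carrier, so coding the subsets of the carrier places the space of clusters
  on a member of the universe.\<close>

lemma ex_space_representing:
  assumes U: "powerset_universe U" and A: "A \<in> Obj (ESkeLC U)"
  shows "\<exists>X\<in>Obj (SkeLC U). \<exists>d. rc_representation X A d"
proof -
  have A': "carrier A \<in> U" "complete_local_contact_algebra A" using A by (simp_all add: ESkeLC_def)
  interpret A: complete_local_contact_algebra A by (rule A'(2))
  let ?K = "{A.cluster u |u. A.bounded_ultrafilter u}"
  obtain g where g: "inj_on g (Pow (carrier A))" "g ` Pow (carrier A) \<in> U"
    using powerset_universe_coding[OF U A'(1)] by blast
  have sub: "?K \<subseteq> Pow (carrier A)" using A.cluster_carrier by blast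
  have bij: "bij_betw (inv_into (Pow (carrier A)) g) (g ` ?K) ?K"
    using bij_betw_inv_into_subset[OF inj_on_imp_bij_betw[OF g(1)] sub refl] .
  interpret cluster_space A "g ` ?K" "inv_into (Pow (carrier A)) g"
    using bij by unfold_locales
  have "g ` ?K \<subseteq> g ` Pow (carrier A)" using sub by (rule image_mono)
  then have "g ` ?K \<in> U" by (rule powerset_universe_subset[OF U g(2)])
  then have "cluster_topology \<in> Obj (SkeLC U)"
    by (simp add: SkeLC_def topspace_T locally_compact_T Hausdorff_T)
  then show ?thesis using rc_representation_extent by blast
qed

definition rc_map :: "'u set set \<Rightarrow> 'u topology \<Rightarrow> 'u topology \<Rightarrow> ('u \<Rightarrow> 'u) \<Rightarrow> 'u \<Rightarrow> 'u" where
  "rc_map U X Y f = closure_image (rc_algebra U X) (decode U X) Y (rc_algebra U Y) (decode U Y) f"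

lemma is_functor_rc_algebra:
  assumes U: "powerset_universe U"
  shows "is_functor (SkeLC U) (ESkeLC U) (rc_algebra U) (rc_map U)"
  unfolding is_functor_def
proof (intro conjI ballI)
  note rep = rc_representation_rc_algebra[OF U]
  show "rc_algebra U X \<in> Obj (ESkeLC U)" if "X \<in> Obj (SkeLC U)" for X
    using rc_algebra_Obj[OF U that] .
  show "rc_map U X Y f \<in> Hom (ESkeLC U) (rc_algebra U X) (rc_algebra U Y)"
    if X: "X \<in> Obj (SkeLC U)" and Y: "Y \<in> Obj (SkeLC U)" and f: "f \<in> Hom (SkeLC U) X Y" for X Y f
  proof -
    interpret rc_representation_pair X "rc_algebra U X" "decode U X" Y "rc_algebra U Y" "decode U Y"
      using rep[OF X] rep[OF Y] by (simp add: rc_representation_pair_def)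
    show ?thesis using f ESkeLC_morphism_closure_image[of f]
      by (simp add: SkeLC_def ESkeLC_def rc_map_def closure_image_def)
  qed
  show "rc_map U X X (Ident (SkeLC U) X) = Ident (ESkeLC U) (rc_algebra U X)" if X: "X \<in> Obj (SkeLC U)" for X
    using closure_image_restrict_id[OF rep[OF X]] by (simp add: SkeLC_def ESkeLC_def rc_map_def)
  show "rc_map U X Z (Comp (SkeLC U) X Y Z g f) =
      Comp (ESkeLC U) (rc_algebra U X) (rc_algebra U Y) (rc_algebra U Z) (rc_map U Y Z g) (rc_map U X Y f)"
    if X: "X \<in> Obj (SkeLC U)" and Y: "Y \<in> Obj (SkeLC U)" and Z: "Z \<in> Obj (SkeLC U)"
      and "f \<in> Hom (SkeLC U) X Y" "g \<in> Hom (SkeLC U) Y Z" for X Y Z f g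
    using that closure_image_compose[OF rep[OF X] rep[OF Y] rep[OF Z], of f g]
    by (simp add: SkeLC_def ESkeLC_def rc_map_def)
qed

theorem theorem4p4:
  fixes U :: "'u set set"
  assumes "powerset_universe U"
  shows "equivalent_categories (SkeLC U) (ESkeLC U)"
proof (rule equivalent_categories_if_fully_faithful_essentially_surjective
    [OF category_SkeLC category_ESkeLC is_functor_rc_algebra[OF assms]])
  note rep = rc_representation_rc_algebra[OF assms]
  have pair: "rc_representation_pair X (rc_algebra U X) (decode U X) Y (rc_algebra U Y) (decode U Y)"
    if "X \<in> Obj (SkeLC U)" "Y \<in> Obj (SkeLC U)" for X Y
    using rep that by (simp add: rc_representation_pair_def)
  {
    fix X Y f g
    assume X: "X \<in> Obj (SkeLC U)" and Y: "Y \<in> Obj (SkeLC U)" and f: "f \<in> Hom (SkeLC U) X Y"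
      and g: "g \<in> Hom (SkeLC U) X Y" and eq: "rc_map U X Y f = rc_map U X Y g"
    interpret rc_representation_pair X "rc_algebra U X" "decode U X" Y "rc_algebra U Y" "decode U Y"
      using pair[OF X Y] .
    have fg: "f \<in> extensional (topspace X)" "continuous_map X Y f" "skeletal_map X Y f"
      "g \<in> extensional (topspace X)" "continuous_map X Y g" "skeletal_map X Y g"
      using f g by (simp_all add: SkeLC_def)
    show "f = g"
    proof (rule extensionalityI[OF fg(1,4)])
      show "f x = g x" if x: "x \<in> topspace X" for x
      proof (rule continuous_maps_eqI[OF fg(2,5) _ x])
        show "Y closure_of (f ` decode U X a) = Y closure_of (g ` decode U X a)" if a: "a \<in> carrier (rc_algebra U X)" for a
          using closure_image(2)[OF fg(2,3) a] closure_image(2)[OF fg(5,6) a] eq unfolding rc_map_def by simp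
      qed
    qed
  next
    fix X Y \<psi>
    assume X: "X \<in> Obj (SkeLC U)" and Y: "Y \<in> Obj (SkeLC U)"
      and \<psi>: "\<psi> \<in> Hom (ESkeLC U) (rc_algebra U X) (rc_algebra U Y)"
    interpret rc_representation_pair X "rc_algebra U X" "decode U X" Y "rc_algebra U Y" "decode U Y"
      using pair[OF X Y] .
    have \<psi>': "\<psi> \<in> extensional (carrier (rc_algebra U X))" "ESkeLC_morphism (rc_algebra U X) (rc_algebra U Y) \<psi>"
      using \<psi> by (simp_all add: ESkeLC_def)
    obtain f where f: "f \<in> extensional (topspace X)" "continuous_map X Y f" "skeletal_map X Y f"
      "\<forall>a\<in>carrier (rc_algebra U X). decode U Y (\<psi> a) = Y closure_of (f ` decode U X a)"
      using ex_continuous_map_of_morphism[OF \<psi>'(2)] by blast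
    have "\<psi> a \<in> carrier (rc_algebra U Y)" if "a \<in> carrier (rc_algebra U X)" for a
      using \<psi>'(2) that unfolding ESkeLC_morphism_def by blast
    then have "rc_map U X Y f = \<psi>"
      unfolding rc_map_def using f \<psi>'(1) by (intro closure_image_eqI) auto
    then show "\<exists>f\<in>Hom (SkeLC U) X Y. rc_map U X Y f = \<psi>"
      using f by (intro bexI[of _ f]) (simp_all add: SkeLC_def)
  next
    fix A assume A: "A \<in> Obj (ESkeLC U)"
    obtain X d where X: "X \<in> Obj (SkeLC U)" "rc_representation X A d"
      using ex_space_representing[OF assms A] by blast
    then show "\<exists>X\<in>Obj (SkeLC U). \<exists>t. isomorphism (ESkeLC U) (rc_algebra U X) A t"
      using isomorphism_of_representations[OF rep[OF X(1)] rc_algebra_Obj[OF assms X(1)] X(2) A] by blast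
  }
qed

end
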